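(* Let $A_1,A_0,A_{-1},B\in B(\mathfrak k)$ and $s\in\mathbb R$. Among families $U^t_s$, $t\ge s$, of sesquilinear forms on $\mathcal K_s(\mathfrak R,\mathfrak k)$ of the form $U^t_s=\mathcal B(u^t_s)$ with a kernel $(t,\sigma,\tau,\upsilon)\mapsto u^t_s(\sigma,\tau,\upsilon)\in B(\mathfrak k)$, symmetric in each of $\sigma,\tau,\upsilon$ and locally integrable in all four variables, the equation \begin{multline*}\langle f|U^t_s|g\rangle=\langle f|g\rangle+\int_s^tdr\,\langle a(r)f|A_1U^r_s|g\rangle+\int_s^tdr\,\langle a(r)f|A_0U^r_s|a(r)g\rangle\\+\int_s^tdr\,\langle f|A_{-1}U^r_s|a(r)g\rangle+\int_s^tdr\,\langle f|BU^r_s|g\rangle\qquad(t\ge s,\ f,g\in\mathcal K_s(\mathfrak R,\mathfrak k))\end{multline*} has a unique solution, namely $$U^t_s=\mathcal B\bigl(u^t_s(A_1,A_0,A_{-1};B)\bigr).$$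
   Context: $\mathfrak k$ is a Hilbert space with countable base; for $x\in\mathfrak k$, $x^+$ is the dual vector, $x^+y=\langle x,y\rangle$. $\mathfrak R=\{\emptyset\}+\mathbb R+\mathbb R^2+\cdots$ (disjoint union). For a finite index set $\alpha$, $t_\alpha=(t_c)_{c\in\alpha}$; for symmetric $f$ on $\mathfrak R$, $f(\alpha)$ abbreviates $f(t_\alpha)$; $+$ of index sets is disjoint union. $\int f(\alpha)\lambda_\alpha=f(\emptyset)+\sum_{n\ge1}\frac1{n!}\int_{\mathbb R^n}f(t_1,\dots,t_n)dt_1\cdots dt_n$, and analogously (factor $1/n!$ for each variable) for functions on $\mathfrak R^k$ symmetric in each variable; local integrability is in norm with respect to Lebesgue measure, and kernels are identified if equal Lebesgue almost everywhere. $\mathcal K_s(\mathfrak R,\mathfrak k)$: symmetric norm-continuous functions $\mathfrak R\to\mathfrak k$ with compact support; $\langle f|g\rangle=\int f^+(\omega)g(\omega)\lambda_\omega$; $(a(r)f)(t_1,\dots,t_n)=f(r,t_1,\dots,t_n)$. For locally integrable $F:\mathfrak R^3\to B(\mathfrak k)$, $\mathcal B(F)$ is the sesquilinear form $$\langle f|\mathcal B(F)|g\rangle=\int f^+(\omega+\sigma+\tau)F(\sigma,\tau,\upsilon)g(\omega+\tau+\upsilon)\,\lambda_{\omega+\sigma+\tau+\upsilon},$$ and for $A\in B(\mathfrak k)$, $A\,\mathcal B(F)=\mathcal B(AF)$. Kernel $u^t_s=u^t_s(A_1,A_0,A_{-1};B)$: for $s<t$ and $(t_\sigma,t_\tau,t_\upsilon)$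 such that $s,t$ and all coordinates are pairwise different, let $s_1<\dots<s_n$ be all coordinates in increasing order and $i_j=1,0,-1$ according to whether $s_j$ belongs to $t_\sigma$, $t_\tau$, $t_\upsilon$; then $$u^t_s(t_\sigma,t_\tau,t_\upsilon)=\mathbf 1\{s<s_1<\dots<s_n<t\}\,e^{(t-s_n)B}A_{i_n}e^{(s_n-s_{n-1})B}A_{i_{n-1}}\cdots A_{i_2}e^{(s_2-s_1)B}A_{i_1}e^{(s_1-s)B},$$ with $u^t_s(\emptyset,\emptyset,\emptyset)=e^{(t-s)B}$; for $t=s$, $\mathcal B(u^s_s)$ is the form $\langle f|g\rangle$. *)

theory Defs
  imports "HOL-Analysis.Analysis" "HOL-Library.Multiset"
begin

section \<open>Complex Hilbert spaces and their bounded operators\<close>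

text \<open>
  The inner product is conjugate linear in the first and linear in the second argument, so
  that \<open>cinner x y\<close> is \<open>x\<^sup>+ y\<close>. The norm and the topology are those of the underlying real
  Hilbert space, whose inner product is the real part of \<open>cinner\<close>.
\<close>

class complex_hilbert_space = banach + real_inner +
  fixes scaleC :: "complex \<Rightarrow> 'a \<Rightarrow> 'a" (infixr \<open>*\<^sub>C\<close> 75)
    and cinner :: "'a \<Rightarrow> 'a \<Rightarrow> complex"
  assumes scaleC_add_right: "c *\<^sub>C (x + y) = c *\<^sub>C x + c *\<^sub>C y"
    and scaleC_add_left: "(c + d) *\<^sub>C x = c *\<^sub>C x + d *\<^sub>C x"
    and scaleC_scaleC: "c *\<^sub>C d *\<^sub>C x = (c * d) *\<^sub>C x"
    and scaleC_of_real: "complex_of_real r *\<^sub>C x = r *\<^sub>R x"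
    and cinner_commute: "cinner x y = cnj (cinner y x)"
    and cinner_add_right: "cinner x (y + z) = cinner x y + cinner x z"
    and cinner_scaleC_right: "cinner x (c *\<^sub>C y) = c * cinner x y"
    and Re_cinner: "Re (cinner x y) = inner x y"

instantiation complex :: complex_hilbert_space
begin

definition scaleC_complex :: "complex \<Rightarrow> complex \<Rightarrow> complex" where "scaleC_complex c x = c * x"

definition cinner_complex :: "complex \<Rightarrow> complex \<Rightarrow> complex" where "cinner_complex x y = cnj x * y"

instance
  by standard
     (simp_all add: scaleC_complex_def cinner_complex_def algebra_simps scaleR_conv_of_real inner_complex_def)

end

text \<open>
  \<open>'k \<Rightarrow>\<^sub>L 'k\<close> consists of the bounded real linear operators; \<open>B(k)\<close> is its closed subspace of
  complex linear ones, with the same (operator) norm.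
\<close>

definition bounded_ops :: "('k::complex_hilbert_space \<Rightarrow>\<^sub>L 'k) set" where
  "bounded_ops = {T. \<forall>c x. blinfun_apply T (c *\<^sub>C x) = c *\<^sub>C blinfun_apply T x}"

definition blinfun_exp :: "('k::banach \<Rightarrow>\<^sub>L 'k) \<Rightarrow> ('k \<Rightarrow>\<^sub>L 'k)" where
  "blinfun_exp T = (\<Sum>n. (1 / fact n) *\<^sub>R (((\<lambda>S. T o\<^sub>L S) ^^ n) id_blinfun))"


section \<open>The space of finite real sequences\<close>

text \<open>
  The disjoint union of the spaces \<open>\<real>\<^sup>n\<close>, \<open>n \<ge> 0\<close>, is the type \<^typ>\<open>real list\<close>, with \<open>\<real>\<^sup>n\<close> the
  set of lists of length \<open>n\<close>. For symmetric functions the sum of index sets becomes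
  concatenation of lists.
\<close>

definition coords :: "nat \<Rightarrow> (nat \<Rightarrow> real) \<Rightarrow> real list" where
  "coords n x = map x [0..<n]"

definition config_topology :: "real list topology" where
  "config_topology =
     topology (\<lambda>U. \<forall>n. openin (powertop_real {..<n}) {x \<in> {..<n} \<rightarrow>\<^sub>E UNIV. coords n x \<in> U})"

definition lebesgue_n :: "nat \<Rightarrow> (nat \<Rightarrow> real) measure" where
  "lebesgue_n n = PiM {..<n} (\<lambda>_. lborel)"

text \<open>The measure \<open>\<lambda>\<close>, equal to \<open>1/n!\<close> times Lebesgue measure on \<open>\<real>\<^sup>n\<close>, on Borel sets.\<close>

definition config_measure :: "real list measure" where
  "config_measure =
     measure_of UNIV {A. \<forall>n. {x \<in> space (lebesgue_n n). coords n x \<in> A} \<in> sets (lebesgue_n n)}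
       (\<lambda>A. \<Sum>n. emeasure (lebesgue_n n) {x \<in> space (lebesgue_n n). coords n x \<in> A} / fact n)"

definition config_box :: "nat \<Rightarrow> real list set" where
  "config_box n = {xs. length xs \<le> n \<and> set xs \<subseteq> {- real n..real n}}"

lemma length_coords [simp]: "length (coords n x) = n"
  by (simp add: coords_def)

lemma set_coords [simp]: "set (coords n x) = x ` {..<n}"
  by (simp add: coords_def atLeast0LessThan)

lemma openin_config_topology:
  "openin config_topology U \<longleftrightarrow>
     (\<forall>n. openin (powertop_real {..<n}) {x \<in> {..<n} \<rightarrow>\<^sub>E UNIV. coords n x \<in> U})"
proof -
  have 1: "{x \<in> {..<n} \<rightarrow>\<^sub>E UNIV. coords n x \<in> S \<inter> T} =
      {x \<in> {..<n} \<rightarrow>\<^sub>E UNIV. coords n x \<in> S} \<inter> {x \<in> {..<n} \<rightarrow>\<^sub>E UNIV. coords n x \<in> T}"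
    for n S T by auto
  have 2: "{x \<in> {..<n} \<rightarrow>\<^sub>E UNIV. coords n x \<in> \<Union>K} =
      \<Union>((\<lambda>S. {x \<in> {..<n} \<rightarrow>\<^sub>E UNIV. coords n x \<in> S}) ` K)" for n K by auto
  have "istopology (\<lambda>U. \<forall>n. openin (powertop_real {..<n}) {x \<in> {..<n} \<rightarrow>\<^sub>E UNIV. coords n x \<in> U})"
    unfolding istopology_def 1 2 by (auto intro!: openin_Union)
  then show ?thesis
    by (simp add: config_topology_def topology_inverse')
qed

lemma topspace_config_topology [simp]: "topspace config_topology = UNIV"
proof -
  have "openin (powertop_real {..<n}) ({..<n} \<rightarrow>\<^sub>E UNIV)" for n :: nat
    using openin_topspace[of "powertop_real {..<n}"] by simp
  then have "openin config_topology UNIV"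
    by (simp add: openin_config_topology)
  then show ?thesis
    using openin_subset by blast
qed

lemma continuous_map_coords: "continuous_map (powertop_real {..<n}) config_topology (coords n)"
  by (auto simp: continuous_map openin_config_topology)

lemma compactin_config_box: "compactin config_topology (config_box n)"
proof -
  have "config_box n = (\<Union>m\<le>n. coords m ` ({..<m} \<rightarrow>\<^sub>E {- real n..real n}))" (is "?L = ?R")
  proof
    show "?L \<subseteq> ?R"
    proof
      fix xs assume xs: "xs \<in> config_box n"
      define x where "x = (\<lambda>i\<in>{..<length xs}. xs ! i)"
      have "coords (length xs) x = xs"
        by (auto simp: coords_def x_def intro!: nth_equalityI)
      moreover have "x \<in> {..<length xs} \<rightarrow>\<^sub>E {- real n..real n}"
        using xs nth_mem[of _ xs] by (auto simp: x_def config_box_def simp del: nth_mem)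
      ultimately have "xs \<in> coords (length xs) ` ({..<length xs} \<rightarrow>\<^sub>E {- real n..real n})"
        by (metis imageI)
      moreover have "length xs \<in> {..n}"
        using xs by (simp add: config_box_def)
      ultimately show "xs \<in> ?R"
        by (rule UN_I[rotated])
    qed
    show "?R \<subseteq> ?L"
    proof
      fix xs assume "xs \<in> ?R"
      then obtain m x where m: "m \<le> n" and x: "x \<in> {..<m} \<rightarrow>\<^sub>E {- real n..real n}" and "xs = coords m x"
        by blast
      moreover have "x ` {..<m} \<subseteq> {- real n..real n}"
        using x by (intro image_subsetI) (rule PiE_mem)
      ultimately show "xs \<in> ?L"
        by (simp add: config_box_def)
    qed
  qed
  moreover have "compactin (powertop_real {..<m}) ({..<m} \<rightarrow>\<^sub>E {- real n..real n})" for m :: nat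
    by (simp add: compactin_PiE)
  ultimately show ?thesis
    by (auto intro!: compactin_Union image_compactin[OF _ continuous_map_coords])
qed

lemma compactin_config_topology_subset_box:
  assumes "compactin config_topology K"
  shows "\<exists>n. K \<subseteq> config_box n"
proof -
  define U :: "nat \<Rightarrow> real list set"
    where "U n = {xs. length xs < n \<and> set xs \<subseteq> {- real n<..<real n}}" for n
  have op: "openin config_topology (U n)" for n
    unfolding openin_config_topology
  proof
    fix m
    have "{x \<in> {..<m} \<rightarrow>\<^sub>E UNIV. coords m x \<in> U n} =
        (if m < n then {..<m} \<rightarrow>\<^sub>E {- real n<..<real n} else {})"
      by (intro set_eqI) (simp add: U_def PiE_iff image_subset_iff Ball_def conj_commute)
    then show "openin (powertop_real {..<m}) {x \<in> {..<m} \<rightarrow>\<^sub>E UNIV. coords m x \<in> U n}"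
      by (auto intro!: openin_PiE[THEN iffD2])
  qed
  have mono: "U m \<subseteq> U n" if "m \<le> n" for m n
  proof
    fix xs assume "xs \<in> U m"
    moreover have "{- real m<..<real m} \<subseteq> {- real n<..<real n}"
      using that by auto
    ultimately show "xs \<in> U n"
      using that by (auto simp: U_def)
  qed
  have "xs \<in> \<Union>(range U)" for xs
  proof -
    obtain b where b: "\<And>x. x \<in> set xs \<Longrightarrow> \<bar>x\<bar> \<le> b"
      using finite_set[of xs] by (metis bounded_real finite_imp_bounded)
    obtain n where n: "b < real n"
      using reals_Archimedean2 by blast
    have "- real (Suc (n + length xs)) < x \<and> x < real (Suc (n + length xs))" if "x \<in> set xs" for x
      using b[OF that] n unfolding of_nat_Suc of_nat_add by (intro conjI; linarith)
    then have "xs \<in> U (Suc (n + length xs))"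
      by (auto simp: U_def)
    then show ?thesis by blast
  qed
  then have "K \<subseteq> \<Union>(range U)" by blast
  then obtain F where F: "finite F" "F \<subseteq> range U" "K \<subseteq> \<Union>F"
    using compactinD[OF assms, of "range U"] op by auto
  then obtain I where I: "finite I" "F = U ` I"
    by (meson finite_subset_image)
  obtain n where "\<forall>i\<in>I. i \<le> n"
    using I(1) finite_nat_set_iff_bounded_le by blast
  then have "K \<subseteq> U n"
    using F I mono by blast
  then show ?thesis
    by (intro exI[of _ n]) (auto simp: U_def config_box_def subset_iff less_imp_le)
qed

lemma sets_config_measure:
  "A \<in> sets config_measure \<longleftrightarrow>
     (\<forall>n. {x \<in> space (lebesgue_n n). coords n x \<in> A} \<in> sets (lebesgue_n n))"
proof -
  let ?S = "{A. \<forall>n. {x \<in> space (lebesgue_n n). coords n x \<in> A} \<in> sets (lebesgue_n n)}"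
  have "sigma_algebra UNIV ?S"
    unfolding sigma_algebra_iff2
  proof (intro conjI ballI allI impI)
    fix A assume "A \<in> ?S"
    then have "space (lebesgue_n n) - {x \<in> space (lebesgue_n n). coords n x \<in> A} \<in> sets (lebesgue_n n)" for n
      by blast
    moreover have "{x \<in> space (lebesgue_n n). coords n x \<in> UNIV - A} =
        space (lebesgue_n n) - {x \<in> space (lebesgue_n n). coords n x \<in> A}" for n
      by auto
    ultimately show "UNIV - A \<in> ?S" by simp
  next
    fix A :: "nat \<Rightarrow> real list set" assume "range A \<subseteq> ?S"
    then have "(\<Union>i. {x \<in> space (lebesgue_n n). coords n x \<in> A i}) \<in> sets (lebesgue_n n)" for n
      by (intro sets.countable_UN) auto
    moreover have "{x \<in> space (lebesgue_n n). coords n x \<in> \<Union>(range A)} =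
        (\<Union>i. {x \<in> space (lebesgue_n n). coords n x \<in> A i})" for n
      by auto
    ultimately show "\<Union>(range A) \<in> ?S" by simp
  qed auto
  then show ?thesis
    by (simp add: config_measure_def sigma_algebra.sigma_sets_eq)
qed

lemma space_config_measure [simp]: "space config_measure = UNIV"
  by (simp add: config_measure_def space_measure_of_conv)

lemma measurable_coords: "coords n \<in> measurable (lebesgue_n n) config_measure"
  by (auto simp: measurable_def sets_config_measure vimage_def Int_def conj_commute)

lemma emeasure_config_measure:
  assumes "A \<in> sets config_measure"
  shows "emeasure config_measure A =
    (\<Sum>n. emeasure (lebesgue_n n) {x \<in> space (lebesgue_n n). coords n x \<in> A} / fact n)"
proof (rule emeasure_measure_of[OF config_measure_def _ _ _ assms])
  let ?m = "\<lambda>A n. emeasure (lebesgue_n n) {x \<in> space (lebesgue_n n). coords n x \<in> A} / fact n"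
  show "positive (sets config_measure) (\<lambda>A. \<Sum>n. ?m A n)"
    by (simp add: positive_def)
  show "countably_additive (sets config_measure) (\<lambda>A. \<Sum>n. ?m A n)"
  proof (rule countably_additiveI)
    fix A :: "nat \<Rightarrow> real list set"
    assume A: "range A \<subseteq> sets config_measure" "disjoint_family A"
    have eq: "(\<Sum>i. ?m (A i) n) = ?m (\<Union>i. A i) n" for n
    proof -
      let ?B = "\<lambda>i. {x \<in> space (lebesgue_n n). coords n x \<in> A i}"
      have "(\<Sum>i. emeasure (lebesgue_n n) (?B i)) = emeasure (lebesgue_n n) (\<Union>i. ?B i)"
        using A by (intro suminf_emeasure) (auto simp: sets_config_measure disjoint_family_on_def)
      moreover have "(\<Union>i. ?B i) = {x \<in> space (lebesgue_n n). coords n x \<in> (\<Union>i. A i)}"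
        by auto
      ultimately show ?thesis
        by (simp add: ennreal_suminf_divide)
    qed
    have swap: "(\<Sum>i. \<Sum>n. g i n) = (\<Sum>n. \<Sum>i. g i n)" for g :: "nat \<Rightarrow> nat \<Rightarrow> ennreal"
    proof -
      have "(\<Sum>i. \<Sum>n. g i n) = (\<Sum>i. \<integral>\<^sup>+n. g i n \<partial>count_space UNIV)"
        by (simp add: nn_integral_count_space_nat)
      also have "\<dots> = (\<integral>\<^sup>+n. (\<Sum>i. g i n) \<partial>count_space UNIV)"
        by (rule nn_integral_suminf[symmetric]) simp
      finally show ?thesis by (simp add: nn_integral_count_space_nat)
    qed
    show "(\<Sum>i. \<Sum>n. ?m (A i) n) = (\<Sum>n. ?m (\<Union>i. A i) n)"
      unfolding swap[of "\<lambda>i n. ?m (A i) n"] eq ..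
  qed
qed auto

lemma integral_config_measure:
  fixes f :: "real list \<Rightarrow> 'b::{banach, second_countable_topology}"
  assumes f: "integrable config_measure f"
  shows "integral\<^sup>L config_measure f =
    (\<Sum>n. (1 / fact n) *\<^sub>R (LINT x|lebesgue_n n. f (coords n x)))"
proof -
  define L :: "nat \<Rightarrow> real list set" where "L n = {xs. length xs = n}" for n
  have L: "L n \<in> sets config_measure" for n
    by (auto simp: sets_config_measure L_def)
  have f_meas: "f \<in> borel_measurable config_measure"
    using f by simp
  have dens: "density config_measure (indicator (L n)) =
      distr (density (lebesgue_n n) (\<lambda>_. ennreal (1 / fact n))) config_measure (coords n)" (is "?D = ?N") for n
  proof (rule measure_eqI)
    fix A assume "A \<in> sets ?D"
    then have A: "A \<in> sets config_measure" by simp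
    let ?B = "{x \<in> space (lebesgue_n n). coords n x \<in> A}"
    have B: "?B \<in> sets (lebesgue_n n)"
      using A by (simp add: sets_config_measure)
    have B': "{x \<in> space (lebesgue_n m). coords m x \<in> L n \<inter> A} = (if m = n then ?B else {})" for m
      by (auto simp: L_def)
    have "emeasure ?D A = emeasure config_measure (L n \<inter> A)"
      using A L by (simp add: emeasure_density flip: indicator_inter_arith)
    also have "\<dots> = (\<Sum>m. if m = n then emeasure (lebesgue_n n) ?B / fact n else 0)"
      unfolding emeasure_config_measure[OF sets.Int[OF L A]] B' by (rule suminf_cong) simp
    also have "\<dots> = emeasure (lebesgue_n n) ?B / fact n"
      by (subst suminf_finite[of "{n}"]) auto
    also have "\<dots> = ennreal (1 / fact n) * emeasure (lebesgue_n n) ?B"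
    proof -
      have "(fact n :: ennreal) = ennreal (fact n)"
        by (metis ennreal_of_nat_eq_real_of_nat of_nat_fact)
      then have "inverse (fact n :: ennreal) = ennreal (1 / fact n)"
        by (simp add: inverse_ennreal inverse_eq_divide)
      then show ?thesis
        by (simp add: divide_ennreal_def mult.commute)
    qed
    also have "\<dots> = emeasure (density (lebesgue_n n) (\<lambda>_. ennreal (1 / fact n))) ?B"
      using B by (simp add: emeasure_density_const)
    also have "?B = coords n -` A \<inter> space (density (lebesgue_n n) (\<lambda>_. ennreal (1 / fact n)))"
      by auto
    also have "emeasure (density (lebesgue_n n) (\<lambda>_. ennreal (1 / fact n))) \<dots> = emeasure ?N A"
      using A by (subst emeasure_distr) (auto intro: measurable_coords)
    finally show "emeasure ?D A = emeasure ?N A" .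
  qed simp
  have "(LINT x:(L n)|config_measure. f x) = (1 / fact n) *\<^sub>R (LINT x|lebesgue_n n. f (coords n x))" for n
  proof -
    have fc: "(\<lambda>x. f (coords n x)) \<in> borel_measurable (lebesgue_n n)"
      using measurable_compose[OF measurable_coords f_meas] .
    have "(LINT x:(L n)|config_measure. f x) = integral\<^sup>L (density config_measure (\<lambda>x. ennreal (indicator (L n) x))) f"
      unfolding set_lebesgue_integral_def using f_meas L by (subst integral_density) auto
    also have "\<dots> = integral\<^sup>L (density config_measure (indicator (L n))) f"
      by (simp add: ennreal_indicator)
    also have "\<dots> = (LINT x|density (lebesgue_n n) (\<lambda>_. ennreal (1 / fact n)). f (coords n x))"
      unfolding dens using f_meas by (intro integral_distr) (auto intro: measurable_coords)
    also have "\<dots> = (1 / fact n) *\<^sub>R (LINT x|lebesgue_n n. f (coords n x))"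
      using fc by (subst integral_density) auto
    finally show ?thesis .
  qed
  moreover have UN: "(\<Union>n. L n) = UNIV" by (auto simp: L_def)
  moreover have "set_integrable config_measure (\<Union>n. L n) f"
    unfolding UN set_integrable_def using f by simp
  then have "(LINT x:(\<Union>n. L n)|config_measure. f x) = (\<Sum>n. LINT x:(L n)|config_measure. f x)"
    using L by (intro lebesgue_integral_countable_add) (auto simp: L_def)
  ultimately show ?thesis
    by (simp add: set_lebesgue_integral_def)
qed


section \<open>Test functions and local integrability\<close>

definition symmetric :: "(real list \<Rightarrow> 'b) \<Rightarrow> bool" where
  "symmetric f \<longleftrightarrow> (\<forall>xs ys. mset xs = mset ys \<longrightarrow> f xs = f ys)"

definition test_functions :: "(real list \<Rightarrow> 'k::complex_hilbert_space) set" where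
  "test_functions = {f. symmetric f \<and> continuous_map config_topology euclidean f \<and>
     (\<exists>K. compactin config_topology K \<and> (\<forall>xs. xs \<notin> K \<longrightarrow> f xs = 0))}"

definition annihilate :: "real \<Rightarrow> (real list \<Rightarrow> 'k) \<Rightarrow> real list \<Rightarrow> 'k" where
  "annihilate r f = (\<lambda>xs. f (r # xs))"

text \<open>
  Bochner integrability. The library version is not available for functions with values in
  \<open>B(k)\<close>, which is not separable in norm. The measure \<open>M\<close> is meant to be complete.
\<close>

definition norm_integrable :: "'a measure \<Rightarrow> ('a \<Rightarrow> 'b::real_normed_vector) \<Rightarrow> bool" where
  "norm_integrable M F \<longleftrightarrow>
     (\<exists>S. (\<forall>i::nat. simple_function M (S i)) \<and> (AE x in M. (\<lambda>i. S i x) \<longlonglongrightarrow> F x)) \<and>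
     integrable M (\<lambda>x. norm (F x))"

text \<open>
  Here \<open>K\<close> is an increasing sequence of compact sets such that each compact subset is contained
  in one of them, cf. the lemmas \<open>compactin_config_box\<close> and \<open>compactin_config_topology_subset_box\<close>.
\<close>

definition locally_integrable ::
  "'a measure \<Rightarrow> (nat \<Rightarrow> 'a set) \<Rightarrow> ('a \<Rightarrow> 'b::real_normed_vector) \<Rightarrow> bool" where
  "locally_integrable M K F \<longleftrightarrow> (\<forall>n. norm_integrable M (\<lambda>x. indicator (K n) x *\<^sub>R F x))"

type_synonym 'k kernel = "real list \<Rightarrow> real list \<Rightarrow> real list \<Rightarrow> ('k \<Rightarrow>\<^sub>L 'k)"

definition locally_integrable_kernel :: "'k::complex_hilbert_space kernel \<Rightarrow> bool" where
  "locally_integrable_kernel F \<longleftrightarrow>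
     locally_integrable
       (completion (config_measure \<Otimes>\<^sub>M config_measure \<Otimes>\<^sub>M config_measure))
       (\<lambda>n. config_box n \<times> config_box n \<times> config_box n)
       (\<lambda>(\<sigma>, \<tau>, \<upsilon>). F \<sigma> \<tau> \<upsilon>)"


section \<open>Sesquilinear forms with integral kernels\<close>

definition test_inner ::
  "(real list \<Rightarrow> 'k) \<Rightarrow> (real list \<Rightarrow> 'k::complex_hilbert_space) \<Rightarrow> complex" where
  "test_inner f g = (LINT \<omega>|config_measure. cinner (f \<omega>) (g \<omega>))"

definition kernel_form ::
  "'k kernel \<Rightarrow> (real list \<Rightarrow> 'k) \<Rightarrow> (real list \<Rightarrow> 'k::complex_hilbert_space) \<Rightarrow> complex" where
  "kernel_form F f g =
     (LINT (\<omega>, \<sigma>, \<tau>, \<upsilon>)|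
        completion (config_measure \<Otimes>\<^sub>M config_measure \<Otimes>\<^sub>M config_measure \<Otimes>\<^sub>M config_measure).
        cinner (f (\<omega> @ \<sigma> @ \<tau>)) (blinfun_apply (F \<sigma> \<tau> \<upsilon>) (g (\<omega> @ \<tau> @ \<upsilon>))))"

definition kernel_lmult :: "('k \<Rightarrow>\<^sub>L 'k) \<Rightarrow> 'k kernel \<Rightarrow> 'k::complex_hilbert_space kernel" where
  "kernel_lmult A F = (\<lambda>\<sigma> \<tau> \<upsilon>. A o\<^sub>L F \<sigma> \<tau> \<upsilon>)"


section \<open>The equation and its explicit solution\<close>

text \<open>The values of \<open>u t\<close> for \<open>t < s\<close> are irrelevant.\<close>

definition admissible :: "real \<Rightarrow> (real \<Rightarrow> 'k::complex_hilbert_space kernel) \<Rightarrow> bool" where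
  "admissible s u \<longleftrightarrow>
     (\<forall>t\<ge>s. \<forall>\<sigma> \<tau> \<upsilon>. u t \<sigma> \<tau> \<upsilon> \<in> bounded_ops) \<and>
     (\<forall>t\<ge>s. (\<forall>\<tau> \<upsilon>. symmetric (\<lambda>\<sigma>. u t \<sigma> \<tau> \<upsilon>)) \<and>
            (\<forall>\<sigma> \<upsilon>. symmetric (\<lambda>\<tau>. u t \<sigma> \<tau> \<upsilon>)) \<and>
            (\<forall>\<sigma> \<tau>. symmetric (\<lambda>\<upsilon>. u t \<sigma> \<tau> \<upsilon>))) \<and>
     (\<forall>t\<ge>s. locally_integrable_kernel (u t)) \<and>
     locally_integrable
       (completion (lborel \<Otimes>\<^sub>M config_measure \<Otimes>\<^sub>M config_measure \<Otimes>\<^sub>M config_measure))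
       (\<lambda>n. {s..s + real n} \<times> config_box n \<times> config_box n \<times> config_box n)
       (\<lambda>(t, \<sigma>, \<tau>, \<upsilon>). u t \<sigma> \<tau> \<upsilon>)"

definition solves_equation ::
  "('k \<Rightarrow>\<^sub>L 'k) \<Rightarrow> ('k \<Rightarrow>\<^sub>L 'k) \<Rightarrow> ('k \<Rightarrow>\<^sub>L 'k) \<Rightarrow> ('k \<Rightarrow>\<^sub>L 'k) \<Rightarrow> real \<Rightarrow>
   (real \<Rightarrow> 'k::complex_hilbert_space kernel) \<Rightarrow> bool" where
  "solves_equation A1 A0 Am1 B s u \<longleftrightarrow>
     (\<forall>t\<ge>s. \<forall>f\<in>test_functions. \<forall>g\<in>test_functions.
        kernel_form (u t) f g = test_inner f g
          + (LINT r:{s..t}|lebesgue. kernel_form (kernel_lmult A1 (u r)) (annihilate r f) g)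
          + (LINT r:{s..t}|lebesgue. kernel_form (kernel_lmult A0 (u r)) (annihilate r f) (annihilate r g))
          + (LINT r:{s..t}|lebesgue. kernel_form (kernel_lmult Am1 (u r)) f (annihilate r g))
          + (LINT r:{s..t}|lebesgue. kernel_form (kernel_lmult B (u r)) f g))"

text \<open>
  For times \<open>s\<^sub>1 < \<dots> < s\<^sub>n\<close> with operators \<open>C\<^sub>1, \<dots>, C\<^sub>n\<close> the following is
  \<open>e\<^bsup>(t - s\<^sub>n)B\<^esup> C\<^sub>n \<cdots> C\<^sub>1 e\<^bsup>(s\<^sub>1 - s)B\<^esup>\<close>.
\<close>

fun ordered_product ::
  "('k::banach \<Rightarrow>\<^sub>L 'k) \<Rightarrow> real \<Rightarrow> (real \<times> ('k \<Rightarrow>\<^sub>L 'k)) list \<Rightarrow> real \<Rightarrow> ('k \<Rightarrow>\<^sub>L 'k)" where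
  "ordered_product B s [] t = blinfun_exp ((t - s) *\<^sub>R B)"
| "ordered_product B s ((r, C) # cs) t =
     ordered_product B r cs t o\<^sub>L C o\<^sub>L blinfun_exp ((r - s) *\<^sub>R B)"

text \<open>
  Points with coinciding coordinates, or with a coordinate equal to \<open>s\<close> or \<open>t\<close>, form a null
  set; the kernel is set to \<open>0\<close> there. For \<open>t = s\<close> the formula leaves only the identity at
  \<open>([], [], [])\<close>, which is the kernel of the form \<open>test_inner\<close>.
\<close>

definition explicit_kernel ::
  "('k \<Rightarrow>\<^sub>L 'k) \<Rightarrow> ('k \<Rightarrow>\<^sub>L 'k) \<Rightarrow> ('k \<Rightarrow>\<^sub>L 'k) \<Rightarrow> ('k \<Rightarrow>\<^sub>L 'k) \<Rightarrow> real \<Rightarrow> real \<Rightarrow>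
   'k::complex_hilbert_space kernel" where
  "explicit_kernel A1 A0 Am1 B s t = (\<lambda>\<sigma> \<tau> \<upsilon>.
     if distinct (\<sigma> @ \<tau> @ \<upsilon>) \<and> set (\<sigma> @ \<tau> @ \<upsilon>) \<subseteq> {s<..<t}
     then ordered_product B s
            (sort_key fst (map (\<lambda>r. (r, A1)) \<sigma> @ map (\<lambda>r. (r, A0)) \<tau> @ map (\<lambda>r. (r, Am1)) \<upsilon>)) t
     else 0)"

end

theory Submission
  imports Defs
begin

text \<open>
  Existence. Writing the arguments of the kernel as one list of labelled times, the explicit kernel
  is a sum over its points of which only the latest contributes. Integrating this recursion against
  \<open>B\<close> in the upper time variable gives, pointwise, the kernel version of the equation; tested
  with \<open>f\<close> and \<open>g\<close>, the sums over the points of a configuration become integrals over an extra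
  point \<open>r\<close> by Mecke's formula, which turns them into the terms with \<open>a(r)\<close>.

  Uniqueness. Since \<open>A \<B>(F)\<close> at \<open>(f, g)\<close> is \<open>\<B>(F)\<close> at \<open>(A\<^sup>* f, g)\<close> and \<open>a(r)\<close>
  lowers the number of points on which a test function is supported, by induction two solutions
  agree in all but the last term of the equation. Their difference \<open>D\<close> then satisfies
  \<open>D\<^sub>t(f) = \<integral>\<^sub>s\<^sup>t D\<^sub>r(B\<^sup>* f) dr\<close>, and \<open>D\<^sub>r((B\<^sup>*)\<^sup>j f)\<close> is at most \<open>\<parallel>B\<^sup>*\<parallel>\<^sup>j\<close> times a locally integrable function
  of \<open>r\<close>, so that iteration gives \<open>D = 0\<close>.
\<close>


section \<open>Hilbert spaces\<close>

text \<open>Two obstacles shape the work. In general \<open>B(k)\<close> is not separable in norm,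
  and Borel measurability of operator-valued functions need not survive sums and products; kernels
  are therefore handled as everywhere limits of simple functions and become ordinary measurable
  functions once they are tested with vectors. Moreover kernels are locally integrable for completed
  measures, while Fubini's theorem is applied to plain product measures, so kernels are replaced by
  representatives. The latest point is the one split off because every coefficient of the equation
  stands to the left of \<open>U\<close>. The full kernel jumps when the upper time passes its
  latest coordinate, so only exponentials are differentiated; the jumps are exactly the summands
  that become the terms with \<open>a(r)\<close>. In the uniqueness proof, local integrability
  controls the forms for almost every time only. The equation itself upgrades this to every time,
  since its right-hand side consists of integrals.\<close>

interpretation blinfun_compose: bounded_bilinear blinfun_compose
  by (rule bounded_bilinear_blinfun_compose)

section \<open>The complex inner product as a bounded bilinear map\<close>

lemma cinner_add_left: "cinner (x + y) (z::'k::complex_hilbert_space) = cinner x z + cinner y z"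
  by (metis cinner_commute cinner_add_right complex_cnj_add)

lemma cinner_scaleC_left: "cinner (c *\<^sub>C x) (y::'k::complex_hilbert_space) = cnj c * cinner x y"
  by (metis cinner_commute cinner_scaleC_right complex_cnj_mult)

lemma Im_cinner: "Im (cinner x (y::'k::complex_hilbert_space)) = inner (\<i> *\<^sub>C x) y"
  by (simp add: cinner_scaleC_left flip: Re_cinner)

lemma norm_scaleC_ii: "norm (\<i> *\<^sub>C (x::'k::complex_hilbert_space)) = norm x"
proof -
  have "cinner (\<i> *\<^sub>C x) (\<i> *\<^sub>C x) = cinner x x"
    by (simp add: cinner_scaleC_left cinner_scaleC_right)
  then show ?thesis
    by (metis Re_cinner norm_eq_sqrt_inner)
qed

text \<open>Real and imaginary part are bounded separately by the real Cauchy-Schwarz inequality,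
  whence the constant 2 that reappears in all bounds on integrands.\<close>

lemma norm_cinner_le: "norm (cinner x (y::'k::complex_hilbert_space)) \<le> 2 * norm x * norm y"
proof -
  have "norm (cinner x y) \<le> \<bar>inner x y\<bar> + \<bar>inner (\<i> *\<^sub>C x) y\<bar>"
    using cmod_le[of "cinner x y"] by (simp add: Re_cinner Im_cinner)
  also have "\<dots> \<le> norm x * norm y + norm (\<i> *\<^sub>C x) * norm y"
    by (intro add_mono Cauchy_Schwarz_ineq2)
  finally show ?thesis by (simp add: norm_scaleC_ii)
qed

lemma bounded_bilinear_cinner:
  "bounded_bilinear (cinner :: 'k::complex_hilbert_space \<Rightarrow> 'k \<Rightarrow> complex)"
proof
  fix a a' b b' :: 'k and r :: real
  show "cinner (a + a') b = cinner a b + cinner a' b" by (rule cinner_add_left)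
  show "cinner a (b + b') = cinner a b + cinner a b'" by (rule cinner_add_right)
  show "cinner (r *\<^sub>R a) b = r *\<^sub>R cinner a b"
    using cinner_scaleC_left[of "complex_of_real r" a b] by (simp add: scaleC_of_real scaleR_conv_of_real)
  show "cinner a (r *\<^sub>R b) = r *\<^sub>R cinner a b"
    using cinner_scaleC_right[of a "complex_of_real r" b] by (simp add: scaleC_of_real scaleR_conv_of_real)
  show "\<exists>K. \<forall>a b::'k. norm (cinner a b) \<le> norm a * norm b * K"
    by (intro exI[of _ 2] allI order_trans[OF norm_cinner_le]) simp
qed

interpretation cinner: bounded_bilinear "cinner :: 'k::complex_hilbert_space \<Rightarrow> 'k \<Rightarrow> complex"
  by (rule bounded_bilinear_cinner)

text \<open>The representing vector is the minimiser of \<open>\<parallel>y\<parallel>\<^sup>2 - 2 \<phi> y\<close>.\<close>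

lemma riesz_representation:
  fixes \<phi> :: "'a::{real_inner, banach} \<Rightarrow> real"
  assumes "bounded_linear \<phi>"
  shows "\<exists>z. \<forall>y. \<phi> y = inner z y"
proof -
  interpret \<phi>: bounded_linear \<phi> by fact
  define J where "J y = (norm y)\<^sup>2 - 2 * \<phi> y" for y
  obtain K where K: "\<And>y. norm (\<phi> y) \<le> norm y * K" using \<phi>.bounded by blast
  have J_ge: "J y \<ge> - K\<^sup>2" for y
  proof -
    have "\<phi> y \<le> norm y * K" using K[of y] by simp
    moreover have "0 \<le> (norm y - K)\<^sup>2" by simp
    ultimately show ?thesis by (simp add: J_def power2_diff)
  qed
  define m where "m = Inf (range J)"
  have bdd: "bdd_below (range J)" using J_ge by (auto intro!: bdd_belowI)
  have m_le: "m \<le> J y" for y unfolding m_def using bdd by (auto intro!: cInf_lower)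
  have "\<exists>y. J y < m + 1 / (real n + 1)" for n
  proof -
    have "m < m + 1 / (real n + 1)" by simp
    then show ?thesis unfolding m_def using cInf_lessD[of "range J"] by auto
  qed
  then obtain y where y: "\<And>n. J (y n) < m + 1 / (real n + 1)" by metis
  \<comment> \<open>Parallelogram law; the linear part of \<open>J\<close> cancels. As
    \<open>J\<close> at the midpoint is at least \<open>m\<close>, a minimising sequence is
    Cauchy.\<close>
  have par: "(norm (a - b))\<^sup>2 = 2 * J a + 2 * J b - 4 * J ((1/2) *\<^sub>R (a + b))" for a b
    unfolding J_def power2_norm_eq_inner
    by (simp add: \<phi>.scaleR \<phi>.add inner_add_left inner_add_right inner_diff_left inner_diff_right
        inner_commute algebra_simps)
  have dist_y: "(norm (y i - y j))\<^sup>2 \<le> 2 / (real i + 1) + 2 / (real j + 1)" for i j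
    using par[of "y i" "y j"] y[of i] y[of j] m_le[of "(1/2) *\<^sub>R (y i + y j)"] by auto
  have "Cauchy y"
  proof (rule metric_CauchyI)
    fix e :: real assume "e > 0"
    then obtain M :: nat where M: "4 / e\<^sup>2 < real M" using reals_Archimedean2 by blast
    have "dist (y i) (y j) < e" if "i \<ge> M" "j \<ge> M" for i j
    proof -
      have "real M > 0" using M \<open>e > 0\<close> by (smt (verit) divide_pos_pos zero_less_power)
      have "2 / (real i + 1) \<le> 2 / (real M + 1)" "2 / (real j + 1) \<le> 2 / (real M + 1)"
        using that by (auto intro!: divide_left_mono)
      then have "(norm (y i - y j))\<^sup>2 \<le> 4 / (real M + 1)" using dist_y[of i j] by simp
      also have "\<dots> < 4 / real M" using \<open>real M > 0\<close> by (intro divide_strict_left_mono) auto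
      also have "\<dots> < e\<^sup>2" using M \<open>e > 0\<close> \<open>real M > 0\<close> by (simp add: field_simps)
      finally show ?thesis unfolding dist_norm using \<open>e > 0\<close> by (simp add: power_less_imp_less_base)
    qed
    then show "\<exists>M. \<forall>i\<ge>M. \<forall>j\<ge>M. dist (y i) (y j) < e" by blast
  qed
  then obtain z where z: "y \<longlonglongrightarrow> z" using Cauchy_convergent convergent_def by blast
  have "(\<lambda>n. J (y n)) \<longlonglongrightarrow> J z"
    unfolding J_def by (intro tendsto_intros z \<phi>.tendsto)
  moreover have "(\<lambda>n. m + 1 / (real n + 1)) \<longlonglongrightarrow> m + 0"
    by (intro tendsto_intros LIMSEQ_Suc[OF lim_1_over_n, simplified add.commute])
      (use LIMSEQ_Suc[OF lim_1_over_n] in \<open>simp add: add.commute\<close>)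
  ultimately have Jz: "J z \<le> m"
    using LIMSEQ_le[of "\<lambda>n. J (y n)" "J z" "\<lambda>n. m + 1 / (real n + 1)" "m + 0"] y less_imp_le by auto
  have "\<phi> x = inner z x" for x
  proof (cases "x = 0")
    case False
    define c where "c = inner z x - \<phi> x"
    define N where "N = inner x x"
    have N: "N > 0" using False by (simp add: N_def)
    have "J (z + q *\<^sub>R x) = J z + 2 * q * c + q\<^sup>2 * N" for q
      unfolding J_def power2_norm_eq_inner c_def N_def
      by (simp add: \<phi>.scaleR \<phi>.add inner_add_left inner_add_right inner_commute power2_eq_square
          algebra_simps)
    \<comment> \<open>The chosen \<open>q\<close> minimises this quadratic polynomial in
      \<open>q\<close>; the gain \<open>c\<^sup>2 / N\<close> must vanish because \<open>z\<close>
      is already a minimiser.\<close>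
    then have "J (z + (- c / N) *\<^sub>R x) = J z + 2 * (- c / N) * c + (- c / N)\<^sup>2 * N" .
    also have "\<dots> = J z - c\<^sup>2 / N" using N by (simp add: field_simps power2_eq_square)
    finally have "c\<^sup>2 / N \<le> 0" using m_le[of "z + (- c / N) *\<^sub>R x"] Jz by linarith
    then have "c = 0" using N by (simp add: divide_le_0_iff)
    then show ?thesis by (simp add: c_def)
  qed simp
  then show ?thesis by blast
qed

text \<open>Riesz in the underlying real Hilbert space yields the adjoint for the real part of the
  inner product. Complex linearity of \<open>A\<close> carries the identity over to the imaginary
  part, which is minus the real part after multiplying the second argument by the imaginary
  unit.\<close>

lemma bounded_ops_adjoint:
  fixes A :: "'k::complex_hilbert_space \<Rightarrow>\<^sub>L 'k"
  assumes "A \<in> bounded_ops"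
  shows "\<exists>A' :: 'k \<Rightarrow>\<^sub>L 'k. \<forall>x y. cinner (A' x) y = cinner x (A y)"
proof -
  have "\<exists>z. \<forall>y. inner x (blinfun_apply A y) = inner z y" for x
    by (rule riesz_representation) (intro bounded_linear_compose[OF bounded_linear_inner_right] blinfun.bounded_linear_right)
  then obtain D where D: "\<And>x y. inner x (blinfun_apply A y) = inner (D x) y" by metis
  have eqI: "u = v" if "\<And>y. inner u y = inner v y" for u v :: 'k
    using that[of "u - v"] by (metis inner_diff_left inner_eq_zero_iff right_minus_eq)
  have "bounded_linear D"
  proof (rule bounded_linear_intro)
    show "D (x + y) = D x + D y" for x y
      by (rule eqI) (simp add: inner_add_left flip: D)
    show "D (r *\<^sub>R x) = r *\<^sub>R D x" for r x
      by (rule eqI) (simp flip: D)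
    show "norm (D x) \<le> norm x * norm A" for x
    proof -
      have "norm (D x) * norm (D x) = inner x (A (D x))"
        by (simp add: D flip: power2_eq_square power2_norm_eq_inner)
      also have "\<dots> \<le> norm x * norm (A (D x))" using Cauchy_Schwarz_ineq2[of x "A (D x)"] by linarith
      also have "\<dots> \<le> norm x * (norm A * norm (D x))" by (intro mult_left_mono norm_blinfun) auto
      finally have "norm (D x) * norm (D x) \<le> (norm x * norm A) * norm (D x)" by (simp add: mult.assoc)
      then show ?thesis
        by (metis less_eq_real_def mult_nonneg_nonneg mult_right_le_imp_le norm_ge_zero)
    qed
  qed
  moreover have "cinner (D x) y = cinner x (A y)" for x y
  proof (rule complex_eqI)
    show "Re (cinner (D x) y) = Re (cinner x (A y))" by (simp add: Re_cinner D)
    have "Im (cinner u v) = - Re (cinner u (\<i> *\<^sub>C v))" for u v :: 'k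
      by (simp add: cinner_scaleC_right)
    moreover have "A (\<i> *\<^sub>C y) = \<i> *\<^sub>C A y" using assms by (simp add: bounded_ops_def)
    ultimately show "Im (cinner (D x) y) = Im (cinner x (A y))"
      by (metis D Re_cinner)
  qed
  ultimately show ?thesis
    by (intro exI[of _ "Blinfun D"]) (simp add: bounded_linear_Blinfun_apply)
qed

section \<open>The operator exponential\<close>

lemma norm_blinfun_compose_le: "norm F \<le> a \<Longrightarrow> norm G \<le> b \<Longrightarrow> norm (F o\<^sub>L G) \<le> a * b"
  by (meson norm_blinfun_compose order_trans mult_mono norm_ge_zero)

lemma bounded_ops_compose: "S \<in> bounded_ops \<Longrightarrow> T \<in> bounded_ops \<Longrightarrow> S o\<^sub>L T \<in> bounded_ops"
  by (simp add: bounded_ops_def)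

definition blinfun_power :: "('k::banach \<Rightarrow>\<^sub>L 'k) \<Rightarrow> nat \<Rightarrow> ('k \<Rightarrow>\<^sub>L 'k)" where
  "blinfun_power T n = ((\<lambda>S. T o\<^sub>L S) ^^ n) id_blinfun"

lemma blinfun_power_simps [simp]:
  "blinfun_power T 0 = id_blinfun" "blinfun_power T (Suc n) = T o\<^sub>L blinfun_power T n"
  by (simp_all add: blinfun_power_def)

lemma norm_blinfun_power_le: "norm (blinfun_power T n) \<le> norm T ^ n"
  by (induction n) (auto intro: norm_blinfun_id_le norm_blinfun_compose_le)

lemma blinfun_power_scaleR: "blinfun_power (x *\<^sub>R T) n = x ^ n *\<^sub>R blinfun_power T n"
  by (induction n) (auto intro!: blinfun_eqI simp: blinfun.bilinear_simps)

lemma blinfun_exp_sums: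
  "(\<lambda>n. (x ^ n / fact n) *\<^sub>R blinfun_power T n) sums blinfun_exp (x *\<^sub>R T)" (is ?s)
  and norm_blinfun_exp_le: "norm (blinfun_exp (x *\<^sub>R T)) \<le> exp (\<bar>x\<bar> * norm T)" (is ?n)
proof -
  have e: "(\<lambda>n. (\<bar>x\<bar> * norm T) ^ n / fact n) sums exp (\<bar>x\<bar> * norm T)"
    using exp_converges[of "\<bar>x\<bar> * norm T"] by (simp add: divide_inverse mult.commute)
  have le: "norm ((x ^ n / fact n) *\<^sub>R blinfun_power T n) \<le> (\<bar>x\<bar> * norm T) ^ n / fact n" for n
    using mult_left_mono[OF norm_blinfun_power_le, of "\<bar>x\<bar> ^ n / fact n" T n]
    by (simp add: power_mult_distrib power_abs)
  have eq: "blinfun_exp (x *\<^sub>R T) = (\<Sum>n. (x ^ n / fact n) *\<^sub>R blinfun_power T n)"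
    unfolding blinfun_exp_def blinfun_power_def[symmetric] blinfun_power_scaleR by (simp add: divide_inverse mult.commute)
  show ?s unfolding eq
    by (rule summable_sums, rule summable_comparison_test'[OF sums_summable[OF e]]) (rule le)
  show ?n unfolding eq
    using norm_suminf_le[OF le sums_summable[OF e]] sums_unique[OF e] by simp
qed

lemma blinfun_exp_0 [simp]: "blinfun_exp 0 = id_blinfun"
proof -
  have "(\<lambda>n. (0 ^ n / fact n) *\<^sub>R blinfun_power (0 :: 'a \<Rightarrow>\<^sub>L 'a) n) = (\<lambda>n. if n = 0 then id_blinfun else 0)"
    by (auto simp: power_0_left)
  then show ?thesis
    using sums_unique2[OF blinfun_exp_sums[of 0 "0 :: 'a \<Rightarrow>\<^sub>L 'a"]] sums_single[of 0 "\<lambda>_. id_blinfun :: 'a \<Rightarrow>\<^sub>L 'a"]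
    by auto
qed

text \<open>Termwise differentiation on a ball around 0 that contains \<open>x\<close>. The
  Weierstrass test is applied once, to the series itself; the differentiated series is
  \<open>T\<close> times the same series.\<close>

lemma has_vector_derivative_blinfun_exp:
  "((\<lambda>x. blinfun_exp (x *\<^sub>R T)) has_vector_derivative (T o\<^sub>L blinfun_exp (x *\<^sub>R T))) (at x)"
proof -
  define R where "R = \<bar>x\<bar> + 1"
  define S where "S = ball (0::real) R"
  let ?E = "\<lambda>x. blinfun_exp (x *\<^sub>R T)"
  let ?f = "\<lambda>n x. (x ^ n / fact n) *\<^sub>R blinfun_power T n"
  have xS: "x \<in> S" by (simp add: S_def R_def)
  have lim: "uniform_limit S (\<lambda>n x. \<Sum>i<n. ?f i x) (\<lambda>x. suminf (\<lambda>i. ?f i x)) sequentially"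
  proof (rule Weierstrass_m_test)
    show "norm (?f n y) \<le> inverse (fact n) * (R * norm T) ^ n" if "y \<in> S" for n y
    proof -
      have "norm (?f n y) = \<bar>y\<bar> ^ n * norm (blinfun_power T n) / fact n"
        by (simp add: power_abs)
      also have "\<dots> \<le> R ^ n * norm T ^ n / fact n"
        using that by (intro divide_right_mono mult_mono power_mono norm_blinfun_power_le)
          (auto simp: S_def dist_norm R_def)
      finally show ?thesis by (simp add: power_mult_distrib divide_inverse mult.commute)
    qed
    show "summable (\<lambda>n. inverse (fact n) * (R * norm T) ^ n)" by (rule summable_exp)
  qed
  have E: "suminf (\<lambda>i. ?f i y) = ?E y" for y by (rule sums_unique[OF blinfun_exp_sums, symmetric])
  define f' where "f' n y h = h *\<^sub>R ((of_nat n * y ^ (n - 1) / fact n) *\<^sub>R blinfun_power T n)" for n :: nat and y h :: real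
  \<comment> \<open>Differentiation shifts the series by one: the derivative of the partial sum of
    length \<open>Suc n\<close> is \<open>T\<close> times the partial sum of length
    \<open>n\<close>. Hence the derivatives converge uniformly too, from \<open>Suc N\<close> on if
    the series does so from \<open>N\<close> on.\<close>
  have f'_sum: "(\<Sum>i<Suc n. f' i y h) = h *\<^sub>R (T o\<^sub>L (\<Sum>i<n. ?f i y))" for n y h
  proof -
    have "(\<Sum>i<Suc n. f' i y h) = (\<Sum>i<n. f' (Suc i) y h)"
      by (subst sum.lessThan_Suc_shift) (simp add: f'_def)
    also have "\<dots> = (\<Sum>i<n. h *\<^sub>R (T o\<^sub>L ?f i y))"
    proof (intro sum.cong refl)
      fix i
      have "of_nat (Suc i) * y ^ (Suc i - 1) / fact (Suc i) = y ^ i / fact i"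
        by (simp add: field_simps del: of_nat_Suc)
      then show "f' (Suc i) y h = h *\<^sub>R (T o\<^sub>L ?f i y)"
        unfolding f'_def by (simp only: blinfun_power_simps blinfun_compose.scaleR_right)
    qed
    finally show ?thesis by (simp add: blinfun_compose.sum_right scaleR_sum_right)
  qed
  have "\<exists>g. \<forall>x\<in>S. (\<lambda>n. ?f n x) sums (g x) \<and>
      (g has_derivative (\<lambda>h. h *\<^sub>R (T o\<^sub>L ?E x))) (at x within S)"
  proof (rule has_derivative_series[where f' = f'])
    show "convex S" by (simp add: S_def)
    show "(?f n has_derivative f' n y) (at y within S)" for n y
      unfolding f'_def by (auto intro!: derivative_eq_intros ext simp: field_simps)
    show "x \<in> S" by (rule xS)
    show "(\<lambda>n. ?f n x) sums ?E x" by (rule blinfun_exp_sums)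
    fix e :: real assume "e > 0"
    \<comment> \<open>Adding 1 keeps the divisor positive when \<open>T = 0\<close>.\<close>
    then have "e / (norm T + 1) > 0" by (simp add: add_nonneg_pos)
    then obtain N where N: "\<And>n y. n \<ge> N \<Longrightarrow> y \<in> S \<Longrightarrow> dist (\<Sum>i<n. ?f i y) (?E y) < e / (norm T + 1)"
      using lim unfolding uniform_limit_iff eventually_sequentially E by meson
    show "\<forall>\<^sub>F n in sequentially. \<forall>y\<in>S. \<forall>h. norm ((\<Sum>i<n. f' i y h) - h *\<^sub>R (T o\<^sub>L ?E y)) \<le> e * norm h"
      unfolding eventually_sequentially
    proof (intro exI[of _ "Suc N"] allI impI ballI)
      fix n y h assume n: "Suc N \<le> n" and y: "y \<in> S"
      then obtain k where k: "n = Suc k" "k \<ge> N" by (cases n) auto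
      have "norm ((\<Sum>i<n. f' i y h) - h *\<^sub>R (T o\<^sub>L ?E y)) = \<bar>h\<bar> * norm (T o\<^sub>L ((\<Sum>i<k. ?f i y) - ?E y))"
        unfolding k(1) f'_sum by (simp add: blinfun_compose.diff_right flip: scaleR_diff_right)
      also have "\<dots> \<le> \<bar>h\<bar> * (norm T * (e / (norm T + 1)))"
        using N[OF k(2) y] by (intro mult_left_mono norm_blinfun_compose_le) (auto simp: dist_norm)
      also have "\<dots> \<le> \<bar>h\<bar> * e"
      proof (intro mult_left_mono)
        have "norm T + 1 > 0" by (simp add: add_nonneg_pos)
        then show "norm T * (e / (norm T + 1)) \<le> e" using \<open>e > 0\<close> by (simp add: field_simps)
      qed simp
      finally show "norm ((\<Sum>i<n. f' i y h) - h *\<^sub>R (T o\<^sub>L ?E y)) \<le> e * norm h" by (simp add: mult.commute)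
    qed
  qed
  then obtain g where g: "\<And>y. y \<in> S \<Longrightarrow> (\<lambda>n. ?f n y) sums (g y)"
    "(g has_derivative (\<lambda>h. h *\<^sub>R (T o\<^sub>L ?E x))) (at x within S)" using xS by blast
  have "g y = ?E y" if "y \<in> S" for y by (rule sums_unique2[OF g(1)[OF that] blinfun_exp_sums])
  then have "(?E has_derivative (\<lambda>h. h *\<^sub>R (T o\<^sub>L ?E x))) (at x within S)"
    using has_derivative_transform[OF xS _ g(2)] by auto
  then show ?thesis
    unfolding has_vector_derivative_def using at_within_open[OF xS] by (simp add: S_def)
qed

lemma continuous_on_blinfun_exp: "continuous_on S (\<lambda>x. blinfun_exp (x *\<^sub>R T))"
  by (intro continuous_at_imp_continuous_on ballI
      has_vector_derivative_continuous[OF has_vector_derivative_blinfun_exp])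

text \<open>Evaluation at a vector turns the exponential series into a convergent series of vectors,
  and multiplication by a complex scalar is continuous, so complex linearity passes from the powers
  of \<open>B\<close> to the sum.\<close>

lemma blinfun_exp_in_bounded_ops:
  fixes B :: "'k::complex_hilbert_space \<Rightarrow>\<^sub>L 'k"
  assumes "B \<in> bounded_ops"
  shows "blinfun_exp (x *\<^sub>R B) \<in> bounded_ops"
proof -
  have scaleC_bl: "bounded_linear (\<lambda>y::'k. c *\<^sub>C y)" for c
  proof (rule bounded_linear_intro)
    show "c *\<^sub>C (r *\<^sub>R y) = r *\<^sub>R (c *\<^sub>C y)" for r and y :: 'k
      by (simp add: scaleC_scaleC mult.commute flip: scaleC_of_real)
    show "norm (c *\<^sub>C y) \<le> norm y * cmod c" for y :: 'k
    proof -
      have "cinner (c *\<^sub>C y) (c *\<^sub>C y) = of_real ((cmod c)\<^sup>2) * cinner y y"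
        by (simp add: cinner_scaleC_left cinner_scaleC_right complex_norm_square[symmetric] mult.assoc[symmetric] del: of_real_power)
      then have "inner (c *\<^sub>C y) (c *\<^sub>C y) = (cmod c)\<^sup>2 * inner y y"
        by (simp only: Re_cinner[symmetric] times_complex.sel Re_complex_of_real Im_complex_of_real mult_zero_left diff_zero)
      then show ?thesis by (simp add: norm_eq_sqrt_inner real_sqrt_mult)
    qed
  qed (rule scaleC_add_right)
  have pow: "blinfun_power B n \<in> bounded_ops" for n
    using assms by (induction n) (auto simp: bounded_ops_def)
  have s: "(\<lambda>n. (x ^ n / fact n) *\<^sub>R blinfun_power B n y) sums blinfun_exp (x *\<^sub>R B) y" for y
    using bounded_linear.sums[OF blinfun.bounded_linear_left blinfun_exp_sums[of x B]]
    by (simp add: blinfun.bilinear_simps)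
  have "blinfun_exp (x *\<^sub>R B) (c *\<^sub>C y) = c *\<^sub>C blinfun_exp (x *\<^sub>R B) y" for c y
  proof (rule sums_unique2[OF s])
    have "(\<lambda>n. c *\<^sub>C ((x ^ n / fact n) *\<^sub>R blinfun_power B n y)) sums (c *\<^sub>C blinfun_exp (x *\<^sub>R B) y)"
      by (rule bounded_linear.sums[OF scaleC_bl s])
    moreover have "c *\<^sub>C (q *\<^sub>R y) = q *\<^sub>R (c *\<^sub>C y)" for q and y :: 'k
      using linear_simps(5)[OF scaleC_bl] .
    ultimately show "(\<lambda>n. (x ^ n / fact n) *\<^sub>R blinfun_power B n (c *\<^sub>C y)) sums (c *\<^sub>C blinfun_exp (x *\<^sub>R B) y)"
      using pow by (simp add: bounded_ops_def)
  qed
  then show ?thesis by (simp add: bounded_ops_def)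
qed

text \<open>The fundamental theorem of calculus for the exponential. Testing with two vectors makes
  the integrand scalar, so that no operator-valued integral has to be formed.\<close>

lemma has_bochner_integral_cinner_blinfun_exp:
  fixes a y :: "'k::complex_hilbert_space"
  assumes "c \<le> t"
  shows "has_bochner_integral lborel
     (\<lambda>r. indicator {c..t} r *\<^sub>R cinner a (B (blinfun_exp ((r - c) *\<^sub>R B) y)))
     (cinner a (blinfun_exp ((t - c) *\<^sub>R B) y) - cinner a y)"
proof -
  have d: "((\<lambda>r. cinner a (blinfun_exp ((r - c) *\<^sub>R B) y)) has_vector_derivative
      cinner a (B (blinfun_exp ((r - c) *\<^sub>R B) y))) (at r within S)" for r S
  proof -
    have "((\<lambda>r. blinfun_exp ((r - c) *\<^sub>R B)) has_vector_derivative
        (B o\<^sub>L blinfun_exp ((r - c) *\<^sub>R B))) (at r)"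
      using vector_diff_chain_at[of "\<lambda>r. r - c" 1 r, OF _ has_vector_derivative_blinfun_exp[of B "r - c"]]
        has_vector_derivative_diff_const[THEN iffD2, OF has_vector_derivative_id]
      by (simp add: o_def)
    moreover have "bounded_linear (\<lambda>S. cinner a (blinfun_apply S y))"
      by (rule bounded_linear_compose[OF cinner.bounded_linear_right blinfun.bounded_linear_left])
    ultimately show ?thesis
      using bounded_linear.has_vector_derivative has_vector_derivative_at_within by fastforce
  qed
  have "has_bochner_integral lborel
     (\<lambda>r. indicator {c..t} r *\<^sub>R cinner a (B (blinfun_exp ((r - c) *\<^sub>R B) y)))
     (cinner a (blinfun_exp ((t - c) *\<^sub>R B) y) - cinner a (blinfun_exp ((c - c) *\<^sub>R B) y))"
    using assms
    by (intro has_bochner_integral_FTC_Icc[where F = "\<lambda>r. cinner a (blinfun_exp ((r - c) *\<^sub>R B) y)"] d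
      cinner.continuous_on blinfun.continuous_on continuous_intros
      continuous_on_compose2[OF continuous_on_blinfun_exp[of UNIV], of _ "\<lambda>r. r - c"]) auto
  then show ?thesis by simp
qed


section \<open>Measurability on the space of finite sequences\<close>

interpretation lborel: product_sigma_finite "\<lambda>_::nat. lborel :: real measure"
  by standard

lemma space_lebesgue_n: "space (lebesgue_n n) = {..<n} \<rightarrow>\<^sub>E UNIV"
  by (simp add: lebesgue_n_def space_PiM)

lemma sigma_finite_lebesgue_n: "sigma_finite_measure (lebesgue_n n)"
  unfolding lebesgue_n_def by (rule lborel.sigma_finite) simp

section \<open>Measurable maps from and to lists, split by length\<close>

lemma exists_coords: "\<exists>x \<in> space (lebesgue_n (length xs)). coords (length xs) x = xs"
  by (rule bexI[of _ "\<lambda>i\<in>{..<length xs}. xs ! i"])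
     (auto simp: space_lebesgue_n coords_def intro!: nth_equalityI)

text \<open>The sigma-algebra of \<open>config_measure\<close> is the final one for the maps
  \<open>coords n\<close>, and every list lies in the range of one of them.\<close>

lemma measurable_from_config:
  assumes "\<And>n. (\<lambda>x. f (coords n x)) \<in> measurable (lebesgue_n n) N"
  shows "f \<in> measurable config_measure N"
proof (rule measurableI)
  fix xs :: "real list"
  show "f xs \<in> space N"
    using exists_coords[of xs] measurable_space[OF assms] by force
next
  fix A assume "A \<in> sets N"
  then have "{x \<in> space (lebesgue_n n). coords n x \<in> f -` A} \<in> sets (lebesgue_n n)" for n
    using measurable_sets[OF assms, of A n] by (simp add: vimage_def Int_def conj_commute)
  then show "f -` A \<inter> space config_measure \<in> sets config_measure"
    by (simp add: sets_config_measure)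
qed

lemma measurable_length_config [measurable]: "length \<in> measurable config_measure (count_space UNIV)"
  by (rule measurable_from_config) simp

text \<open>\<open>!\<close> is total: past the end its value is unspecified but depends on
  \<open>i - length xs\<close> only. It is thus constant on lists of a given length, and each
  coordinate map is measurable on all lists.\<close>

lemma nth_beyond: "length xs \<le> i \<Longrightarrow> xs ! i = [] ! (i - length xs)"
proof (induction xs arbitrary: i)
  case (Cons x xs)
  then show ?case by (cases i) auto
qed simp

lemma measurable_nth_config [measurable]: "(\<lambda>xs. xs ! i) \<in> borel_measurable config_measure"
proof (rule measurable_from_config)
  fix n
  have eq: "coords n x ! i = (if i < n then x i else [] ! (i - n))" for x
    using nth_beyond[of "coords n x" i] by (auto simp: coords_def)
  have "(\<lambda>x. x i) \<in> borel_measurable (lebesgue_n n)" if "i < n"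
    using measurable_component_singleton[of i "{..<n}" "\<lambda>_. lborel"] that by (simp add: lebesgue_n_def)
  then show "(\<lambda>x. coords n x ! i) \<in> borel_measurable (lebesgue_n n)"
    unfolding eq by (cases "i < n") auto
qed

lemma measurable_nth_config' [measurable (raw)]:
  assumes "a \<in> measurable M config_measure" "i \<in> measurable M (count_space UNIV)"
  shows "(\<lambda>x. a x ! i x) \<in> borel_measurable M"
  by (rule measurable_compose_countable[OF _ assms(2)]) (use assms(1) in measurable)

text \<open>On each of the countably many sets where the length of \<open>g x\<close> is
  \<open>n\<close>, the map factors through \<open>coords n\<close>.\<close>

lemma measurable_to_config:
  assumes [measurable]: "(\<lambda>x. length (g x)) \<in> measurable M (count_space UNIV)"
    "\<And>i. (\<lambda>x. g x ! i) \<in> borel_measurable M"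
  shows "g \<in> measurable M config_measure"
proof -
  have eq: "coords (length (g x)) (\<lambda>i\<in>{..<length (g x)}. g x ! i) = g x" for x
    by (auto simp: coords_def intro!: nth_equalityI)
  have "(\<lambda>x. \<lambda>i\<in>{..<n}. g x ! i) \<in> measurable M (lebesgue_n n)" for n
    unfolding lebesgue_n_def by measurable
  then have "(\<lambda>x. coords n (\<lambda>i\<in>{..<n}. g x ! i)) \<in> measurable M config_measure" for n
    by (rule measurable_compose[OF _ measurable_coords])
  then have "(\<lambda>x. coords (length (g x)) (\<lambda>i\<in>{..<length (g x)}. g x ! i)) \<in> measurable M config_measure"
    by (rule measurable_compose_countable) measurable
  then show ?thesis unfolding eq .
qed

lemma measurable_append_config [measurable (raw)]:
  assumes [measurable]: "a \<in> measurable M config_measure" "b \<in> measurable M config_measure"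
  shows "(\<lambda>x. a x @ b x) \<in> measurable M config_measure"
  by (rule measurable_to_config) (simp_all add: nth_append)

lemma measurable_Cons_config [measurable (raw)]:
  assumes [measurable]: "a \<in> borel_measurable M" "b \<in> measurable M config_measure"
  shows "(\<lambda>x. a x # b x) \<in> measurable M config_measure"
  by (rule measurable_to_config) (simp_all add: nth_Cons')

definition delete_at :: "nat \<Rightarrow> 'a list \<Rightarrow> 'a list" where
  "delete_at i xs = take i xs @ drop (Suc i) xs"

lemma length_delete_at: "length (delete_at i xs) = (if i < length xs then length xs - 1 else length xs)"
  by (auto simp: delete_at_def)

lemma nth_delete_at: "i < length xs \<Longrightarrow> delete_at i xs ! j = (if j < i then xs ! j else xs ! Suc j)"
  by (auto simp: delete_at_def nth_append)

lemma mset_delete_at: "i < length xs \<Longrightarrow> mset xs = add_mset (xs ! i) (mset (delete_at i xs))"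
  unfolding delete_at_def by (subst id_take_nth_drop[of i xs]) simp_all

lemma delete_at_append:
  "delete_at i (xs @ ys) = (if i < length xs then delete_at i xs @ ys else xs @ delete_at (i - length xs) ys)"
  by (auto simp: delete_at_def Suc_diff_le)

lemma measurable_delete_at_config [measurable]: "delete_at i \<in> measurable config_measure config_measure"
proof (rule measurable_to_config)
  have "delete_at i xs ! j = (if i < length xs then if j < i then xs ! j else xs ! Suc j else xs ! j)" for j and xs :: "real list"
    by (simp add: nth_delete_at) (simp add: delete_at_def)
  then show "(\<lambda>xs. delete_at i xs ! j) \<in> borel_measurable config_measure" for j
    by simp
qed (simp add: length_delete_at)

section \<open>Boxes and integrals over configurations\<close>

lemma sets_config_box [measurable]: "config_box n \<in> sets config_measure"
proof -
  have "config_box n = {xs \<in> space config_measure. length xs \<le> n \<and>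
      (\<forall>i\<in>{..<n}. i < length xs \<longrightarrow> - real n \<le> xs ! i \<and> xs ! i \<le> real n)}"
    by (force simp: config_box_def subset_iff in_set_conv_nth)
  also have "\<dots> \<in> sets config_measure" by measurable
  finally show ?thesis .
qed

lemma config_box_mono: "m \<le> n \<Longrightarrow> config_box m \<subseteq> config_box n"
  by (fastforce simp: config_box_def)

lemma append_in_config_box: "xs @ ys \<in> config_box n \<Longrightarrow> xs \<in> config_box n \<and> ys \<in> config_box n"
  by (auto simp: config_box_def)

lemma UN_config_box: "(\<Union>n. config_box n) = UNIV"
  using compactin_config_topology_subset_box[of "{xs}" for xs] by auto

lemma emeasure_config_box: "emeasure config_measure (config_box n) < \<infinity>"
proof -
  have eq: "{x \<in> space (lebesgue_n m). coords m x \<in> config_box n} =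
      (if m \<le> n then {..<m} \<rightarrow>\<^sub>E {- real n..real n} else {})" for m
    by (intro set_eqI) (simp add: space_lebesgue_n config_box_def PiE_iff image_subset_iff Ball_def conj_commute)
  have "emeasure config_measure (config_box n) =
      (\<Sum>m. emeasure (lebesgue_n m) (if m \<le> n then {..<m} \<rightarrow>\<^sub>E {- real n..real n} else {}) / fact m)"
    by (simp add: emeasure_config_measure eq)
  also have "\<dots> = (\<Sum>m\<le>n. (2 * ennreal n) ^ m / fact m)"
    by (subst suminf_finite[of "{..n}"])
      (auto simp: lebesgue_n_def lborel.emeasure_PiM intro!: sum.cong simp flip: ennreal_numeral ennreal_mult)
  also have "\<dots> < \<infinity>"
    by (auto simp: ennreal_divide_eq_top_iff less_top[symmetric] ennreal_sum_less_top ennreal_mult_eq_top_iff power_eq_top_ennreal)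
  finally show ?thesis .
qed

interpretation config: sigma_finite_measure config_measure
proof
  show "\<exists>A. countable A \<and> A \<subseteq> sets config_measure \<and> \<Union> A = space config_measure \<and>
      (\<forall>a\<in>A. emeasure config_measure a \<noteq> \<infinity>)"
    using emeasure_config_box UN_config_box by (intro exI[of _ "range config_box"]) (auto simp: less_top)
qed

text \<open>The empty configuration is an atom of mass 1; it carries the part of a kernel in which
  no point occurs.\<close>

lemma emeasure_config_Nil: "{[]} \<in> sets config_measure" "emeasure config_measure {[]} = 1"
proof -
  have "{[]} = {xs \<in> space config_measure. length xs = 0}" by auto
  also have "\<dots> \<in> sets config_measure" by measurable
  finally show *: "{[]} \<in> sets config_measure" .
  have eq: "{x \<in> space (lebesgue_n n). coords n x \<in> {[]}} = (if n = 0 then space (lebesgue_n n) else {})" for n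
    by (auto simp: coords_def)
  have "emeasure config_measure {[]} = emeasure (lebesgue_n 0) (space (lebesgue_n 0)) / fact 0"
    unfolding emeasure_config_measure[OF *] eq by (subst suminf_finite[of "{0}"]) auto
  then show "emeasure config_measure {[]} = 1"
    by (simp add: lebesgue_n_def PiM_empty)
qed

lemma nn_integral_config_measure:
  assumes "f \<in> borel_measurable config_measure"
  shows "(\<integral>\<^sup>+xs. f xs \<partial>config_measure) = (\<Sum>n. (\<integral>\<^sup>+x. f (coords n x) \<partial>lebesgue_n n) / fact n)"
  using assms
proof induction
  case (cong f g)
  then show ?case by (metis UNIV_I ext space_config_measure)
next
  case (set A)
  have "(\<integral>\<^sup>+x. indicator A (coords n x) \<partial>lebesgue_n n) =
      emeasure (lebesgue_n n) {x \<in> space (lebesgue_n n). coords n x \<in> A}" for n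
  proof -
    have "(\<integral>\<^sup>+x. indicator A (coords n x) \<partial>lebesgue_n n) =
        (\<integral>\<^sup>+x. indicator {x \<in> space (lebesgue_n n). coords n x \<in> A} x \<partial>lebesgue_n n)"
      by (intro nn_integral_cong) (simp add: indicator_def)
    then show ?thesis using set by (simp add: sets_config_measure)
  qed
  then show ?case using set by (simp add: emeasure_config_measure)
next
  case (mult f c)
  have [measurable]: "(\<lambda>x. f (coords n x)) \<in> borel_measurable (lebesgue_n n)" for n
    using mult by (intro measurable_compose[OF measurable_coords])
  show ?case using mult by (simp add: nn_integral_cmult ennreal_times_divide[symmetric])
next
  case (add f g)
  have [measurable]: "(\<lambda>x. f (coords n x)) \<in> borel_measurable (lebesgue_n n)" "(\<lambda>x. g (coords n x)) \<in> borel_measurable (lebesgue_n n)" for n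
    using add by (auto intro!: measurable_compose[OF measurable_coords])
  show ?case using add by (simp add: nn_integral_add add_divide_distrib_ennreal suminf_add)
next
  case (seq F)
  have [measurable]: "(\<lambda>x. F i (coords n x)) \<in> borel_measurable (lebesgue_n n)" for i n
    using seq by (intro measurable_compose[OF measurable_coords])
  have inc: "incseq (\<lambda>i x. F i (coords n x))" for n
    using \<open>incseq F\<close> by (auto simp: incseq_def le_fun_def)
  have "(\<integral>\<^sup>+xs. (SUP i. F i) xs \<partial>config_measure) = (SUP i. \<integral>\<^sup>+xs. F i xs \<partial>config_measure)"
    using nn_integral_monotone_convergence_SUP[of F config_measure] seq by (simp add: image_comp)
  also have "\<dots> = (SUP i. \<Sum>n. (\<integral>\<^sup>+x. F i (coords n x) \<partial>lebesgue_n n) / fact n)"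
    using seq by simp
  also have "\<dots> = (\<Sum>n. SUP i. (\<integral>\<^sup>+x. F i (coords n x) \<partial>lebesgue_n n) / fact n)"
    using inc by (intro ennreal_suminf_SUP_eq[symmetric])
      (auto simp: incseq_def le_fun_def intro!: divide_right_mono_ennreal nn_integral_mono)
  also have "\<dots> = (\<Sum>n. (\<integral>\<^sup>+x. (SUP i. F i) (coords n x) \<partial>lebesgue_n n) / fact n)"
    using nn_integral_monotone_convergence_SUP[OF inc]
    by (simp add: SUP_divide_ennreal[symmetric] image_comp)
  finally show ?case .
qed

section \<open>Test functions\<close>

lemma test_functions_support:
  assumes "f \<in> test_functions"
  obtains n where "\<And>xs. xs \<notin> config_box n \<Longrightarrow> f xs = 0"
  using assms compactin_config_topology_subset_box unfolding test_functions_def by blast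

lemma test_functionsI:
  assumes "symmetric f" "continuous_map config_topology euclidean f" "\<And>xs. xs \<notin> config_box n \<Longrightarrow> f xs = 0"
  shows "f \<in> test_functions"
  using assms compactin_config_box unfolding test_functions_def by blast

lemma test_functions_symmetric: "f \<in> test_functions \<Longrightarrow> mset xs = mset ys \<Longrightarrow> f xs = f ys"
  unfolding test_functions_def symmetric_def by blast

lemma test_functions_bounded:
  assumes "f \<in> test_functions"
  obtains C where "C > 0" "\<And>xs. norm (f xs) \<le> C"
proof -
  obtain n where n: "\<And>xs. xs \<notin> config_box n \<Longrightarrow> f xs = 0" using test_functions_support[OF assms] by blast
  have "compactin euclidean (f ` config_box n)"
    using assms by (intro image_compactin[OF compactin_config_box]) (simp add: test_functions_def)
  then have "bounded (f ` config_box n)" by (simp add: compact_imp_bounded)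
  then obtain C where "C > 0" and "\<And>xs. xs \<in> config_box n \<Longrightarrow> norm (f xs) \<le> C"
    by (auto simp: bounded_pos)
  then have "norm (f xs) \<le> C" for xs using n[of xs] by (cases "xs \<in> config_box n") auto
  with \<open>C > 0\<close> show ?thesis by (rule that)
qed

text \<open>The topology comes from finite products of extensional functions. Extending these by 0
  beyond \<open>n\<close> moves the question to the space of all real sequences, where the product
  sigma-algebra is the Borel one of the product topology.\<close>

lemma test_functions_measurable [measurable_dest]:
  assumes "f \<in> test_functions"
  shows "f \<in> borel_measurable config_measure"
proof (rule borel_measurableI)
  fix U :: "'a set" assume "open U"
  then have "openin config_topology {xs \<in> topspace config_topology. f xs \<in> U}"
    using assms unfolding test_functions_def by (intro openin_continuous_map_preimage) auto
  then have op: "openin (powertop_real {..<n}) {x \<in> {..<n} \<rightarrow>\<^sub>E UNIV. f (coords n x) \<in> U}" for n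
    by (simp add: openin_config_topology)
  have "{x \<in> space (lebesgue_n n). coords n x \<in> f -` U} \<in> sets (lebesgue_n n)" for n
  proof -
    define ext where "ext = (\<lambda>x (i::nat). if i < n then x i else (0::real))"
    let ?V = "{x. f (coords n (restrict x {..<n})) \<in> U}"
    have "continuous_map (product_topology (\<lambda>_. euclidean) UNIV) (powertop_real {..<n}) (\<lambda>x. restrict x {..<n})"
      by (auto simp: continuous_map_componentwise intro: continuous_map_product_projection)
    then have "openin (product_topology (\<lambda>_. euclidean) UNIV) ?V"
      using openin_continuous_map_preimage[OF _ op[of n]] by fastforce
    then have "open ?V" by (simp add: open_fun_def)
    then have V: "?V \<in> sets (PiM UNIV (\<lambda>_. borel))" by (simp add: sets_PiM_equal_borel)
    have "ext \<in> measurable (PiM {..<n} (\<lambda>_. borel)) (PiM UNIV (\<lambda>_. borel))"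
      unfolding ext_def
    proof (intro measurable_PiM_single')
      show "(\<lambda>x. if i < n then x i else 0) \<in> borel_measurable (PiM {..<n} (\<lambda>_. borel))" for i
        by (cases "i < n") auto
    qed auto
    from measurable_sets[OF this V] have "ext -` ?V \<inter> ({..<n} \<rightarrow>\<^sub>E UNIV) \<in> sets (lebesgue_n n)"
      using sets_PiM_cong[of "{..<n}" "{..<n}" "\<lambda>_. lborel" "\<lambda>_. borel :: real measure"]
      by (simp add: lebesgue_n_def space_PiM)
    also have "ext -` ?V \<inter> ({..<n} \<rightarrow>\<^sub>E UNIV) = {x \<in> space (lebesgue_n n). coords n x \<in> f -` U}"
    proof -
      have "coords n (restrict (ext x) {..<n}) = coords n x" for x
        by (simp add: coords_def ext_def)
      then show ?thesis by (simp add: space_lebesgue_n vimage_def Int_def conj_commute)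
    qed
    finally show ?thesis .
  qed
  then show "f -` U \<inter> space config_measure \<in> sets config_measure"
    by (simp add: sets_config_measure)
qed

text \<open>Prepending \<open>r\<close> is continuous from each \<open>n\<close>-dimensional space
  to the next one, and removing an entry from a list does not lead out of a box.\<close>

lemma annihilate_test_functions:
  assumes "f \<in> test_functions"
  shows "annihilate r f \<in> test_functions"
proof -
  obtain n where n: "\<And>xs. xs \<notin> config_box n \<Longrightarrow> f xs = 0" using test_functions_support[OF assms] by blast
  show ?thesis
  proof (rule test_functionsI)
    show "symmetric (annihilate r f)"
      using assms by (auto simp: test_functions_def symmetric_def annihilate_def)
    have "continuous_map config_topology config_topology ((#) r)"
      unfolding continuous_map openin_config_topology topspace_config_topology
    proof (intro conjI allI impI)
      fix U and n :: nat assume U: "\<forall>n. openin (powertop_real {..<n}) {x \<in> {..<n} \<rightarrow>\<^sub>E UNIV. coords n x \<in> U}"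
      define sh where "sh = (\<lambda>x. \<lambda>i\<in>{..<Suc n}. case i of 0 \<Rightarrow> r | Suc j \<Rightarrow> x j)"
      have "continuous_map (powertop_real {..<n}) (powertop_real {..<Suc n}) sh"
        unfolding continuous_map_componentwise sh_def
      proof (intro conjI ballI)
        fix i assume "i \<in> {..<Suc n}"
        then show "continuous_map (powertop_real {..<n}) euclideanreal
            (\<lambda>x. (\<lambda>i\<in>{..<Suc n}. case i of 0 \<Rightarrow> r | Suc j \<Rightarrow> x j) i)"
          by (cases i) (auto intro: continuous_map_product_projection)
      qed auto
      from openin_continuous_map_preimage[OF this U[rule_format, of "Suc n"]]
      have "openin (powertop_real {..<n})
          {x \<in> {..<n} \<rightarrow>\<^sub>E UNIV. sh x \<in> {..<Suc n} \<rightarrow>\<^sub>E UNIV \<and> coords (Suc n) (sh x) \<in> U}"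
        by simp
      also have "{x \<in> {..<n} \<rightarrow>\<^sub>E UNIV. sh x \<in> {..<Suc n} \<rightarrow>\<^sub>E UNIV \<and> coords (Suc n) (sh x) \<in> U} =
          {x \<in> {..<n} \<rightarrow>\<^sub>E UNIV. coords n x \<in> {x \<in> UNIV. r # x \<in> U}}"
      proof -
        have "coords (Suc n) (sh x) = r # coords n x" for x
          by (rule nth_equalityI) (auto simp: coords_def sh_def nth_Cons' nth_append less_Suc_eq split: nat.split)
        then show ?thesis by (auto simp: sh_def)
      qed
      finally show "openin (powertop_real {..<n}) {x \<in> {..<n} \<rightarrow>\<^sub>E UNIV. coords n x \<in> {x \<in> UNIV. r # x \<in> U}}" .
    qed auto
    then have "continuous_map config_topology euclidean (f \<circ> (#) r)"
      by (rule continuous_map_compose) (use assms in \<open>simp add: test_functions_def\<close>)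
    then show "continuous_map config_topology euclidean (annihilate r f)"
      by (simp add: annihilate_def o_def)
    show "annihilate r f xs = 0" if "xs \<notin> config_box n" for xs
      using n[of "r # xs"] that append_in_config_box[of "[r]" xs n] by (auto simp: annihilate_def)
  qed
qed

text \<open>Allows adjoints of the coefficients, and their powers, to be moved onto test functions
  without enlarging the support.\<close>

lemma blinfun_test_functions:
  assumes "f \<in> test_functions"
  shows "(\<lambda>xs. blinfun_apply A (f xs)) \<in> test_functions"
proof -
  obtain n where n: "\<And>xs. xs \<notin> config_box n \<Longrightarrow> f xs = 0" using test_functions_support[OF assms] by blast
  have "continuous_map euclidean euclidean (blinfun_apply A)"
    by (simp add: blinfun.continuous_on continuous_on_id)
  then have "continuous_map config_topology euclidean (blinfun_apply A \<circ> f)"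
    using assms by (intro continuous_map_compose) (auto simp: test_functions_def)
  moreover have "symmetric (\<lambda>xs. blinfun_apply A (f xs))"
    unfolding symmetric_def using test_functions_symmetric[OF assms] by metis
  ultimately show ?thesis
    by (intro test_functionsI[where n=n]) (simp_all add: o_def n)
qed


section \<open>Strongly measurable functions\<close>

text \<open>The everywhere version, for a measure that need not be complete, of the measurability in
  \<open>norm_integrable\<close>. Unlike Borel measurability it passes to sums and products of
  operator-valued functions, whatever the density character of the range.\<close>

definition strongly_measurable :: "'a measure \<Rightarrow> ('a \<Rightarrow> 'b::topological_space) \<Rightarrow> bool" where
  "strongly_measurable M F \<longleftrightarrow>
     (\<exists>S. (\<forall>i::nat. simple_function M (S i)) \<and> (\<forall>x\<in>space M. (\<lambda>i. S i x) \<longlonglongrightarrow> F x))"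

lemma strongly_measurableI:
  "(\<And>i::nat. simple_function M (S i)) \<Longrightarrow> (\<And>x. x \<in> space M \<Longrightarrow> (\<lambda>i. S i x) \<longlonglongrightarrow> F x) \<Longrightarrow>
    strongly_measurable M F"
  unfolding strongly_measurable_def by blast

lemma strongly_measurable_const: "strongly_measurable M (\<lambda>_. c)"
  by (rule strongly_measurableI[of _ "\<lambda>_ _. c"]) auto

lemma strongly_measurable_comp:
  assumes "strongly_measurable N F" "T \<in> measurable M N"
  shows "strongly_measurable M (\<lambda>x. F (T x))"
proof -
  obtain S where S: "\<And>i::nat. simple_function N (S i)" "\<And>x. x \<in> space N \<Longrightarrow> (\<lambda>i. S i x) \<longlonglongrightarrow> F x"
    using assms(1) unfolding strongly_measurable_def by blast
  show ?thesis
  proof (rule strongly_measurableI)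
    show "simple_function M (\<lambda>x. S i (T x))" for i
      using simple_function_comp[OF assms(2) S(1)[of i]] by (simp add: o_def)
    show "(\<lambda>i. S i (T x)) \<longlonglongrightarrow> F (T x)" if "x \<in> space M" for x
      using S(2) measurable_space[OF assms(2) that] by blast
  qed
qed

lemma strongly_measurable_bilinear:
  assumes "bounded_bilinear h" "strongly_measurable M F" "strongly_measurable M G"
  shows "strongly_measurable M (\<lambda>x. h (F x) (G x))"
proof -
  obtain S where S: "\<And>i::nat. simple_function M (S i)" "\<And>x. x \<in> space M \<Longrightarrow> (\<lambda>i. S i x) \<longlonglongrightarrow> F x"
    using assms(2) unfolding strongly_measurable_def by blast
  obtain R where R: "\<And>i::nat. simple_function M (R i)" "\<And>x. x \<in> space M \<Longrightarrow> (\<lambda>i. R i x) \<longlonglongrightarrow> G x"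
    using assms(3) unfolding strongly_measurable_def by blast
  show ?thesis
  proof (rule strongly_measurableI)
    show "simple_function M (\<lambda>x. h (S i x) (R i x))" for i
      by (rule simple_function_compose2[OF S(1) R(1)])
    show "(\<lambda>i. h (S i x) (R i x)) \<longlonglongrightarrow> h (F x) (G x)" if "x \<in> space M" for x
      by (intro bounded_bilinear.tendsto[OF assms(1)] S R that)
  qed
qed

lemma strongly_measurable_add:
  fixes F G :: "'a \<Rightarrow> 'b::real_normed_vector"
  assumes "strongly_measurable M F" "strongly_measurable M G"
  shows "strongly_measurable M (\<lambda>x. F x + G x)"
proof -
  obtain S where S: "\<And>i::nat. simple_function M (S i)" "\<And>x. x \<in> space M \<Longrightarrow> (\<lambda>i. S i x) \<longlonglongrightarrow> F x"
    using assms(1) unfolding strongly_measurable_def by blast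
  obtain R where R: "\<And>i::nat. simple_function M (R i)" "\<And>x. x \<in> space M \<Longrightarrow> (\<lambda>i. R i x) \<longlonglongrightarrow> G x"
    using assms(2) unfolding strongly_measurable_def by blast
  show ?thesis
  proof (rule strongly_measurableI)
    show "simple_function M (\<lambda>x. S i x + R i x)" for i
      by (rule simple_function_compose2[OF S(1) R(1)])
    show "(\<lambda>i. S i x + R i x) \<longlonglongrightarrow> F x + G x" if "x \<in> space M" for x
      by (intro tendsto_add S R that)
  qed
qed

lemma strongly_measurable_sum:
  fixes F :: "'i \<Rightarrow> 'a \<Rightarrow> 'b::real_normed_vector"
  assumes "\<And>i. i \<in> I \<Longrightarrow> strongly_measurable M (F i)"
  shows "strongly_measurable M (\<lambda>x. \<Sum>i\<in>I. F i x)"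
  using assms
  by (induction I rule: infinite_finite_induct) (auto intro: strongly_measurable_const strongly_measurable_add)

lemma strongly_measurable_If:
  assumes "strongly_measurable M F" "strongly_measurable M G" "{x \<in> space M. P x} \<in> sets M"
  shows "strongly_measurable M (\<lambda>x. if P x then F x else G x)"
proof -
  obtain S where S: "\<And>i::nat. simple_function M (S i)" "\<And>x. x \<in> space M \<Longrightarrow> (\<lambda>i. S i x) \<longlonglongrightarrow> F x"
    using assms(1) unfolding strongly_measurable_def by blast
  obtain R where R: "\<And>i::nat. simple_function M (R i)" "\<And>x. x \<in> space M \<Longrightarrow> (\<lambda>i. R i x) \<longlonglongrightarrow> G x"
    using assms(2) unfolding strongly_measurable_def by blast
  show ?thesis
    by (rule strongly_measurableI[of _ "\<lambda>i x. if P x then S i x else R i x"])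
       (auto intro!: simple_function_If S R assms)
qed

text \<open>Simple functions approximate the separably valued \<open>h\<close>, and \<open>c\<close>
  carries the approximation to its possibly non-separable target. This is how operator exponentials
  enter, with a real parameter as \<open>h\<close>.\<close>

lemma strongly_measurable_continuous:
  fixes h :: "'a \<Rightarrow> 'b::{metric_space, second_countable_topology}"
  assumes "continuous_on UNIV c" "h \<in> borel_measurable M"
  shows "strongly_measurable M (\<lambda>x. c (h x))"
proof -
  obtain S where S: "\<And>i. simple_function M (S i)" "\<And>x. x \<in> space M \<Longrightarrow> (\<lambda>i. S i x) \<longlonglongrightarrow> h x"
    using borel_measurable_implies_sequence_metric[OF assms(2)] by blast
  show ?thesis
  proof (rule strongly_measurableI)
    show "simple_function M (\<lambda>x. c (S i x))" for i
      by (rule simple_function_compose1[OF S(1)])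
    show "(\<lambda>i. c (S i x)) \<longlonglongrightarrow> c (h x)" if "x \<in> space M" for x
      using assms(1) S(2)[OF that] by (intro continuous_on_tendsto_compose[OF assms(1)]) auto
  qed
qed

text \<open>Using infinitely many cases at once would give infinitely many values. The
  \<open>i\<close>-th approximation therefore respects only the cases below \<open>i\<close>; at
  each point it is the right one for all large \<open>i\<close>.\<close>

lemma strongly_measurable_countable_cases:
  fixes F :: "nat \<Rightarrow> 'a \<Rightarrow> 'b::topological_space"
  assumes "\<And>k. strongly_measurable M (F k)" and [measurable]: "h \<in> measurable M (count_space UNIV)"
  shows "strongly_measurable M (\<lambda>x. F (h x) x)"
proof -
  have "\<forall>k. \<exists>S. (\<forall>i::nat. simple_function M (S i)) \<and> (\<forall>x\<in>space M. (\<lambda>i. S i x) \<longlonglongrightarrow> F k x)"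
    using assms(1) unfolding strongly_measurable_def by blast
  then obtain S where S: "\<And>k i::nat. simple_function M (S k i)"
    "\<And>k x. x \<in> space M \<Longrightarrow> (\<lambda>i. S k i x) \<longlonglongrightarrow> F k x"
    by metis
  have *: "simple_function M (\<lambda>x. if h x < j then S (h x) i x else undefined)" for i j
  proof (induction j)
    case (Suc j)
    have "simple_function M (\<lambda>x. if h x = j then S j i x else if h x < j then S (h x) i x else undefined)"
      by (intro simple_function_If S Suc) measurable
    also have "(\<lambda>x. if h x = j then S j i x else if h x < j then S (h x) i x else undefined) =
        (\<lambda>x. if h x < Suc j then S (h x) i x else undefined)"
      by (auto simp: less_Suc_eq)
    finally show ?case .
  qed simp
  show ?thesis
  proof (rule strongly_measurableI[OF *])
    fix x assume "x \<in> space M"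
    then show "(\<lambda>i. if h x < i then S (h x) i x else undefined) \<longlonglongrightarrow> F (h x) x"
      by (rule Lim_transform_eventually[OF S(2)])
         (auto simp: eventually_sequentially intro!: exI[of _ "Suc (h x)"])
  qed
qed

lemma borel_measurable_norm_strongly_measurable:
  assumes "strongly_measurable M F"
  shows "(\<lambda>x. norm (F x)) \<in> borel_measurable M"
proof -
  obtain S where S: "\<And>i::nat. simple_function M (S i)" "\<And>x. x \<in> space M \<Longrightarrow> (\<lambda>i. S i x) \<longlonglongrightarrow> F x"
    using assms unfolding strongly_measurable_def by blast
  show ?thesis
  proof (rule borel_measurable_LIMSEQ_metric)
    show "(\<lambda>x. norm (S i x)) \<in> borel_measurable M" for i
      by (rule borel_measurable_simple_function) (rule simple_function_compose1[OF S(1)])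
    show "(\<lambda>i. norm (S i x)) \<longlonglongrightarrow> norm (F x)" if "x \<in> space M" for x
      by (rule tendsto_norm[OF S(2)[OF that]])
  qed
qed

text \<open>Here separability of the vector spaces enters: a simple operator-valued function applied
  to a vector function is a finite sum of continuous maps on measurable sets, and limits of Borel
  functions are Borel.\<close>

lemma borel_measurable_strongly_measurable_apply:
  fixes F :: "'a \<Rightarrow> ('b::{real_normed_vector, second_countable_topology} \<Rightarrow>\<^sub>L 'c::{real_normed_vector, second_countable_topology})"
  assumes "strongly_measurable M F" and [measurable]: "b \<in> borel_measurable M"
  shows "(\<lambda>x. blinfun_apply (F x) (b x)) \<in> borel_measurable M"
proof -
  obtain S where S: "\<And>i::nat. simple_function M (S i)" "\<And>x. x \<in> space M \<Longrightarrow> (\<lambda>i. S i x) \<longlonglongrightarrow> F x"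
    using assms unfolding strongly_measurable_def by blast
  show ?thesis
  proof (rule borel_measurable_LIMSEQ_metric)
    show "(\<lambda>i. blinfun_apply (S i x) (b x)) \<longlonglongrightarrow> blinfun_apply (F x) (b x)" if "x \<in> space M" for x
      by (intro blinfun.tendsto S that tendsto_const)
    fix i
    let ?R = "S i ` space M"
    have fin: "finite ?R" using S(1)[of i] by (simp add: simple_function_def)
    have m: "(\<lambda>x. indicator (S i -` {c} \<inter> space M) x *\<^sub>R blinfun_apply c (b x)) \<in> borel_measurable M" for c
    proof -
      have [measurable]: "S i -` {c} \<inter> space M \<in> sets M"
        by (rule simple_functionD[OF S(1)])
      have [measurable]: "blinfun_apply c \<in> borel_measurable borel"
        by (intro borel_measurable_continuous_onI continuous_intros)
      show ?thesis by measurable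
    qed
    have "blinfun_apply (S i x) (b x) = (\<Sum>c\<in>?R. indicator (S i -` {c} \<inter> space M) x *\<^sub>R blinfun_apply c (b x))"
      if "x \<in> space M" for x
    proof -
      have "(\<Sum>c\<in>?R. indicator (S i -` {c} \<inter> space M) x *\<^sub>R blinfun_apply c (b x)) =
          (\<Sum>c\<in>?R. if c = S i x then blinfun_apply c (b x) else 0)"
        using that by (intro sum.cong) (auto simp: indicator_def)
      then show ?thesis using fin that by (simp add: sum.delta)
    qed
    then show "(\<lambda>x. blinfun_apply (S i x) (b x)) \<in> borel_measurable M"
      by (subst measurable_cong) (auto intro!: borel_measurable_sum m)
  qed
qed

lemma borel_measurable_cinner [measurable (raw)]:
  fixes a b :: "'a \<Rightarrow> 'k::{complex_hilbert_space, second_countable_topology}"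
  assumes "a \<in> borel_measurable M" "b \<in> borel_measurable M"
  shows "(\<lambda>x. cinner (a x) (b x)) \<in> borel_measurable M"
  by (rule borel_measurable_continuous_Pair[OF assms])
     (intro cinner.continuous_on continuous_intros)

section \<open>Completed measures and their representatives\<close>

lemma norm_integrable_completionI:
  assumes "strongly_measurable M F" "integrable M (\<lambda>x. norm (F x))"
  shows "norm_integrable (completion M) F"
proof -
  obtain S where S: "\<And>i::nat. simple_function M (S i)" "\<And>x. x \<in> space M \<Longrightarrow> (\<lambda>i. S i x) \<longlonglongrightarrow> F x"
    using assms unfolding strongly_measurable_def by blast
  have "AE x in completion M. (\<lambda>i. S i x) \<longlonglongrightarrow> F x" by (rule AE_I2) (simp add: S)
  moreover have "integrable (completion M) (\<lambda>x. norm (F x))"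
    using assms by (subst integrable_completion) auto
  ultimately show ?thesis
    unfolding norm_integrable_def using S(1) simple_function_completion by blast
qed

text \<open>Provides a representative for the measure before completion, to which Fubini's theorem
  for product measures applies.\<close>

lemma norm_integrable_completionD:
  fixes F :: "'a \<Rightarrow> 'b::real_normed_vector"
  assumes "norm_integrable (completion M) F"
  shows "\<exists>F'. strongly_measurable M F' \<and> (AE x in M. F x = F' x) \<and> integrable M (\<lambda>x. norm (F' x))"
proof -
  obtain S where S: "\<And>i::nat. simple_function (completion M) (S i)"
    "AE x in completion M. (\<lambda>i. S i x) \<longlonglongrightarrow> F x" and int: "integrable (completion M) (\<lambda>x. norm (F x))"
    using assms unfolding norm_integrable_def by blast
  have "\<forall>i. \<exists>R. simple_function M R \<and> (AE x in M. S i x = R x)"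
    using completion_ex_simple_function S(1) by blast
  then obtain R where R: "\<And>i. simple_function M (R i)" "\<And>i. AE x in M. S i x = R i x" by metis
  have "AE x in M. (\<lambda>i. R i x) \<longlonglongrightarrow> F x"
  proof -
    have "AE x in M. (\<lambda>i. S i x) \<longlonglongrightarrow> F x" using S(2) AE_completion_iff by blast
    moreover have "AE x in M. \<forall>i. S i x = R i x" using R(2) by (simp add: AE_all_countable)
    ultimately show ?thesis by eventually_elim simp
  qed
  then obtain N where N: "{x \<in> space M. \<not> (\<lambda>i. R i x) \<longlonglongrightarrow> F x} \<subseteq> N" "N \<in> sets M" "emeasure M N = 0"
    by (rule AE_E) auto
  \<comment> \<open>Setting the function to 0 on a measurable null set that contains all exceptional
    points makes the convergence hold everywhere.\<close>
  define F' where "F' x = (if x \<in> space M - N then F x else 0)" for x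
  have sm: "strongly_measurable M F'"
  proof (rule strongly_measurableI)
    show "simple_function M (\<lambda>x. if x \<in> space M - N then R i x else 0)" for i
      using N(2) by (intro simple_function_If R) auto
    show "(\<lambda>i. if x \<in> space M - N then R i x else 0) \<longlonglongrightarrow> F' x" if "x \<in> space M" for x
      using N(1) that by (auto simp: F'_def)
  qed
  have ae: "AE x in M. F x = F' x"
  proof -
    have "AE x in M. x \<notin> N" using N by (intro AE_not_in) (simp add: null_sets_def)
    moreover have "AE x in M. x \<in> space M" by (rule AE_I2)
    ultimately show ?thesis by eventually_elim (simp add: F'_def)
  qed
  have mF': "(\<lambda>x. norm (F' x)) \<in> borel_measurable M"
    by (rule borel_measurable_norm_strongly_measurable[OF sm])
  have "integrable (completion M) (\<lambda>x. norm (F' x))"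
    using int by (rule integrable_cong_AE_imp)
      (use mF' ae in \<open>auto simp: AE_completion_iff intro: measurable_completion\<close>)
  then have "integrable M (\<lambda>x. norm (F' x))" using mF' by (simp add: integrable_completion)
  with sm ae show ?thesis by blast
qed


section \<open>The recursion for the explicit kernel\<close>

definition good_word :: "real \<Rightarrow> real \<Rightarrow> (real \<times> 'b) list \<Rightarrow> bool" where
  "good_word s t L \<longleftrightarrow> distinct (map fst L) \<and> set (map fst L) \<subseteq> {s<..<t}"

definition word_kernel ::
  "('k::banach \<Rightarrow>\<^sub>L 'k) \<Rightarrow> real \<Rightarrow> real \<Rightarrow> (real \<times> ('k \<Rightarrow>\<^sub>L 'k)) list \<Rightarrow> ('k \<Rightarrow>\<^sub>L 'k)" where
  "word_kernel B s t L = (if good_word s t L then ordered_product B s (sort_key fst L) t else 0)"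

definition word :: "'b \<Rightarrow> 'b \<Rightarrow> 'b \<Rightarrow> real list \<Rightarrow> real list \<Rightarrow> real list \<Rightarrow> (real \<times> 'b) list" where
  "word A1 A0 Am1 \<sigma> \<tau> \<upsilon> = map (\<lambda>r. (r, A1)) \<sigma> @ map (\<lambda>r. (r, A0)) \<tau> @ map (\<lambda>r. (r, Am1)) \<upsilon>"

lemma map_fst_word: "map fst (word A1 A0 Am1 \<sigma> \<tau> \<upsilon>) = \<sigma> @ \<tau> @ \<upsilon>"
  by (simp add: word_def o_def)

lemma word_eq_Nil: "word A1 A0 Am1 \<sigma> \<tau> \<upsilon> = [] \<longleftrightarrow> \<sigma> = [] \<and> \<tau> = [] \<and> \<upsilon> = []"
  by (simp add: word_def)

lemma explicit_kernel_eq_word_kernel: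
  "explicit_kernel A1 A0 Am1 B s t \<sigma> \<tau> \<upsilon> = word_kernel B s t (word A1 A0 Am1 \<sigma> \<tau> \<upsilon>)"
  unfolding explicit_kernel_def word_kernel_def good_word_def map_fst_word by (simp add: word_def)

lemma good_word_mset: "mset L = mset L' \<Longrightarrow> good_word s t L \<longleftrightarrow> good_word s t L'"
  unfolding good_word_def by (metis mset_eq_imp_distinct_iff mset_eq_setD mset_map)

lemma sort_key_fst_eq:
  assumes "distinct (map fst L)" "mset L = mset L'" "sorted (map fst L')"
  shows "sort_key fst L = L'"
  using assms by (intro sort_key_inj_key_eq) (auto simp: distinct_map)

text \<open>For distinct times the sorted word depends on the multiset alone. This gives the
  symmetry of the kernel in each of its three variables.\<close>

lemma word_kernel_mset:
  assumes "mset L = mset L'" shows "word_kernel B s t L = word_kernel B s t L'"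
proof -
  have "sort_key fst L = sort_key fst L'" if "good_word s t L"
    using that assms by (intro sort_key_fst_eq) (auto simp: good_word_def)
  then show ?thesis
    using good_word_mset[OF assms] by (simp add: word_kernel_def)
qed

text \<open>The definition splits off the earliest time. The equation multiplies from the left and
  so calls for the latest one.\<close>

lemma ordered_product_snoc:
  "ordered_product B s (cs @ [(r, C)]) t = blinfun_exp ((t - r) *\<^sub>R B) o\<^sub>L C o\<^sub>L ordered_product B s cs r"
  by (induction B s cs t rule: ordered_product.induct) (auto intro!: blinfun_eqI)

lemma good_word_delete_at:
  assumes "i < length L" "s < fst (L ! i)" "fst (L ! i) < t" "good_word s (fst (L ! i)) (delete_at i L)"
  shows "good_word s t L"
proof -
  have "good_word s t (L ! i # delete_at i L)"
    using assms(2-) unfolding good_word_def by (fastforce simp: subset_iff)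
  then show ?thesis
    using mset_delete_at[OF assms(1)] good_word_mset[of L "L ! i # delete_at i L"] by simp
qed

lemma nth_in_delete_at:
  assumes "i < length L" "j < length L" "i \<noteq> j"
  shows "L ! j \<in> set (delete_at i L)"
proof (cases "j < i")
  case True
  then have "L ! j = delete_at i L ! j" "j < length (delete_at i L)"
    using assms by (auto simp: nth_delete_at length_delete_at)
  then show ?thesis by (metis nth_mem)
next
  case False
  then have "L ! j = delete_at i L ! (j - 1)" "j - 1 < length (delete_at i L)"
    using assms by (auto simp: nth_delete_at length_delete_at)
  then show ?thesis by (metis nth_mem)
qed

lemma good_word_last:
  assumes "good_word s t L" "L \<noteq> []"
  obtains i where "i < length L" "s < fst (L ! i)" "fst (L ! i) < t"
    "good_word s (fst (L ! i)) (delete_at i L)"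
proof -
  have "Max (set (map fst L)) \<in> set (map fst L)" using assms(2) by (intro Max_in) auto
  then obtain i where i: "i < length L" "fst (L ! i) = Max (set (map fst L))"
    by (metis in_set_conv_nth length_map nth_map)
  have m: "mset L = mset (L ! i # delete_at i L)" using mset_delete_at[OF i(1)] by simp
  have g: "good_word s t (L ! i # delete_at i L)" using assms(1) good_word_mset[OF m] by simp
  have "fst x < fst (L ! i)" if "x \<in> set (delete_at i L)" for x
  proof -
    have "x \<in> set L" using that m by (metis list.set_intros(2) set_mset_mset)
    then have "fst x \<le> fst (L ! i)" unfolding i(2) by (intro Max_ge) auto
    moreover have "fst (L ! i) \<notin> fst ` set (delete_at i L)" using g by (simp add: good_word_def)
    then have "fst x \<noteq> fst (L ! i)" using that by (metis image_eqI)
    ultimately show ?thesis by simp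
  qed
  then have "good_word s (fst (L ! i)) (delete_at i L)"
    using g by (auto simp: good_word_def)
  moreover have "s < fst (L ! i)" "fst (L ! i) < t" using g by (auto simp: good_word_def)
  ultimately show ?thesis using that i(1) by blast
qed

lemma word_kernel_last:
  assumes "i < length L" "s < fst (L ! i)" "fst (L ! i) < t" "good_word s (fst (L ! i)) (delete_at i L)"
  shows "word_kernel B s t L =
    blinfun_exp ((t - fst (L ! i)) *\<^sub>R B) o\<^sub>L snd (L ! i) o\<^sub>L word_kernel B s (fst (L ! i)) (delete_at i L)"
proof -
  have g: "good_word s t L" by (rule good_word_delete_at[OF assms])
  have "sort_key fst L = sort_key fst (delete_at i L) @ [L ! i]"
  proof (rule sort_key_fst_eq)
    show "mset L = mset (sort_key fst (delete_at i L) @ [L ! i])"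
      using mset_delete_at[OF assms(1)] by simp
    show "sorted (map fst (sort_key fst (delete_at i L) @ [L ! i]))"
      using assms(4) by (auto simp: sorted_append good_word_def less_imp_le)
  qed (use g in \<open>simp add: good_word_def\<close>)
  moreover have "L ! i = (fst (L ! i), snd (L ! i))" by simp
  ultimately have "ordered_product B s (sort_key fst L) t =
      blinfun_exp ((t - fst (L ! i)) *\<^sub>R B) o\<^sub>L snd (L ! i) o\<^sub>L
        ordered_product B s (sort_key fst (delete_at i L)) (fst (L ! i))"
    by (metis ordered_product_snoc)
  then show ?thesis using g assms(4) by (simp add: word_kernel_def)
qed

text \<open>
  At most one summand is nonzero, the one belonging to the largest coordinate. The identity also
  holds on the exceptional null set, where all terms vanish.
\<close>

lemma word_kernel_rec:
  "word_kernel B s t L = (if L = [] then blinfun_exp ((t - s) *\<^sub>R B) else 0) +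
     (\<Sum>i<length L. if s < fst (L ! i) \<and> fst (L ! i) < t
        then blinfun_exp ((t - fst (L ! i)) *\<^sub>R B) o\<^sub>L snd (L ! i) o\<^sub>L
          word_kernel B s (fst (L ! i)) (delete_at i L) else 0)" (is "_ = ?e + sum ?g _")
proof (cases "good_word s t L \<and> L \<noteq> []")
  case True
  then obtain i where i: "i < length L" "s < fst (L ! i)" "fst (L ! i) < t"
    "good_word s (fst (L ! i)) (delete_at i L)" using good_word_last by blast
  have "?g j = 0" if "j < length L" "j \<noteq> i" for j
  proof -
    have "\<not> good_word s (fst (L ! j)) (delete_at j L)"
    proof
      assume j: "good_word s (fst (L ! j)) (delete_at j L)"
      \<comment> \<open>Each of the two points remains after deletion of the other one, so each
        would have to be strictly earlier than the other.\<close>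
      have "fst (L ! i) < fst (L ! j)" "fst (L ! j) < fst (L ! i)"
        using nth_in_delete_at[of j L i] nth_in_delete_at[of i L j] i j that by (auto simp: good_word_def)
      then show False by simp
    qed
    then show ?thesis by (simp add: word_kernel_def)
  qed
  then have "sum ?g {..<length L} = ?g i"
    using i(1) by (subst sum.remove[of _ i]) (auto intro!: sum.neutral)
  then show ?thesis using word_kernel_last[OF i, of B] i True by simp
next
  case False
  show ?thesis
  proof (cases "L = []")
    case True
    then show ?thesis by (simp add: word_kernel_def good_word_def)
  next
    case ne: False
    then have ng: "\<not> good_word s t L" using False by simp
    then have "?g i = 0" if "i < length L" for i
      using good_word_delete_at[OF that] by (auto simp: word_kernel_def)
    then show ?thesis using ng ne by (simp add: word_kernel_def)
  qed
qed

lemma sum_length_append: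
  fixes g :: "nat \<Rightarrow> 'a::comm_monoid_add"
  shows "(\<Sum>i<length (xs @ ys). g i) = (\<Sum>i<length xs. g i) + (\<Sum>i<length ys. g (length xs + i))"
proof -
  have "{..<length (xs @ ys)} = {..<length xs} \<union> (+) (length xs) ` {..<length ys}"
    by (auto simp: image_iff intro: nat_diff_split[THEN iffD1] add_diff_inverse_nat[symmetric] exI bexI)
  moreover have "sum g ({..<length xs} \<union> (+) (length xs) ` {..<length ys}) =
      sum g {..<length xs} + sum g ((+) (length xs) ` {..<length ys})"
    by (rule sum.union_disjoint) auto
  ultimately show ?thesis
    by (simp add: sum.reindex)
qed

text \<open>The summand is arbitrary because the decomposition is used twice: for operators in the
  recursion, and for scalars after testing with \<open>f\<close> and \<open>g\<close>.\<close>

lemma sum_word: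
  fixes \<Phi> :: "real \<Rightarrow> 'b \<Rightarrow> (real \<times> 'b) list \<Rightarrow> 'a::comm_monoid_add"
  shows "(\<Sum>i<length (word A1 A0 Am1 \<sigma> \<tau> \<upsilon>). \<Phi> (fst (word A1 A0 Am1 \<sigma> \<tau> \<upsilon> ! i))
      (snd (word A1 A0 Am1 \<sigma> \<tau> \<upsilon> ! i)) (delete_at i (word A1 A0 Am1 \<sigma> \<tau> \<upsilon>))) =
    (\<Sum>i<length \<sigma>. \<Phi> (\<sigma> ! i) A1 (word A1 A0 Am1 (delete_at i \<sigma>) \<tau> \<upsilon>)) +
    (\<Sum>i<length \<tau>. \<Phi> (\<tau> ! i) A0 (word A1 A0 Am1 \<sigma> (delete_at i \<tau>) \<upsilon>)) +
    (\<Sum>i<length \<upsilon>. \<Phi> (\<upsilon> ! i) Am1 (word A1 A0 Am1 \<sigma> \<tau> (delete_at i \<upsilon>)))"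
proof -
  have del_map: "delete_at i (map f xs) = map f (delete_at i xs)" for i and f :: "real \<Rightarrow> real \<times> 'b" and xs
    by (simp add: delete_at_def take_map drop_map)
  show ?thesis
    unfolding word_def sum_length_append
    by (simp add: nth_append delete_at_append del_map add.assoc)
qed

lemma explicit_kernel_rec:
  "explicit_kernel A1 A0 Am1 B s t \<sigma> \<tau> \<upsilon> =
     (if \<sigma> = [] \<and> \<tau> = [] \<and> \<upsilon> = [] then blinfun_exp ((t - s) *\<^sub>R B) else 0) +
     ((\<Sum>i<length \<sigma>. if s < \<sigma> ! i \<and> \<sigma> ! i < t then blinfun_exp ((t - \<sigma> ! i) *\<^sub>R B) o\<^sub>L A1 o\<^sub>L
        explicit_kernel A1 A0 Am1 B s (\<sigma> ! i) (delete_at i \<sigma>) \<tau> \<upsilon> else 0) +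
     (\<Sum>i<length \<tau>. if s < \<tau> ! i \<and> \<tau> ! i < t then blinfun_exp ((t - \<tau> ! i) *\<^sub>R B) o\<^sub>L A0 o\<^sub>L
        explicit_kernel A1 A0 Am1 B s (\<tau> ! i) \<sigma> (delete_at i \<tau>) \<upsilon> else 0) +
     (\<Sum>i<length \<upsilon>. if s < \<upsilon> ! i \<and> \<upsilon> ! i < t then blinfun_exp ((t - \<upsilon> ! i) *\<^sub>R B) o\<^sub>L Am1 o\<^sub>L
        explicit_kernel A1 A0 Am1 B s (\<upsilon> ! i) \<sigma> \<tau> (delete_at i \<upsilon>) else 0))"
  unfolding explicit_kernel_eq_word_kernel
  by (subst word_kernel_rec,
      subst sum_word[where \<Phi> = "\<lambda>r C L. if s < r \<and> r < t then blinfun_exp ((t - r) *\<^sub>R B) o\<^sub>L C o\<^sub>L word_kernel B s r L else 0"])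
     (simp add: word_eq_Nil)

text \<open>As a function of the upper time, each summand of the recursion is an exponential
  switched on at a time \<open>c\<close>. Integrating its derivative returns its value at
  \<open>t\<close> minus its initial value; the initial values are the identity for the empty word
  (\<open>c = s\<close>) and the jump terms (\<open>c\<close> a coordinate).\<close>

lemma has_bochner_integral_word_kernel:
  fixes B :: "'k::complex_hilbert_space \<Rightarrow>\<^sub>L 'k"
  assumes "s \<le> t"
  shows "has_bochner_integral lborel
    (\<lambda>r. indicator {s<..<t} r *\<^sub>R cinner a (B (word_kernel B s r L b)))
    (cinner a (word_kernel B s t L b) - (if L = [] then cinner a b else 0) -
      (\<Sum>i<length L. if s < fst (L ! i) \<and> fst (L ! i) < t
         then cinner a (snd (L ! i) (word_kernel B s (fst (L ! i)) (delete_at i L) b)) else 0))"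
proof -
  let ?c = "\<lambda>i. fst (L ! i)"
  define y where "y i = snd (L ! i) (word_kernel B s (?c i) (delete_at i L) b)" for i
  have exp_int: "has_bochner_integral lborel
      (\<lambda>r. indicator {s<..<t} r *\<^sub>R (if c < r then cinner a (B (blinfun_exp ((r - c) *\<^sub>R B) z)) else 0))
      (cinner a (blinfun_exp ((t - c) *\<^sub>R B) z) - cinner a z)" if "s \<le> c" "c \<le> t" for c z
  proof (rule has_bochner_integral_cong_AE[THEN iffD1, OF _ _ _ has_bochner_integral_cinner_blinfun_exp[OF that(2), of a B z]])
    show m: "(\<lambda>r. indicator {c..t} r *\<^sub>R cinner a (B (blinfun_exp ((r - c) *\<^sub>R B) z))) \<in> borel_measurable lborel"
      using has_bochner_integral_cinner_blinfun_exp[OF that(2), of a B z] by (rule borel_measurable_has_bochner_integral)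
    have ae: "AE r in lborel. r \<noteq> c \<and> r \<noteq> t" using AE_lborel_singleton[of c] AE_lborel_singleton[of t] by eventually_elim simp
    have "(\<lambda>r. indicator {s<..<t} r *\<^sub>R (if c < r then cinner a (B (blinfun_exp ((r - c) *\<^sub>R B) z)) else 0)) =
       (\<lambda>r. indicator {c<..<t} r *\<^sub>R (indicator {c..t} r *\<^sub>R cinner a (B (blinfun_exp ((r - c) *\<^sub>R B) z))))"
      using that by (auto simp: indicator_def)
    also have "\<dots> \<in> borel_measurable lborel"
      by (intro borel_measurable_scaleR m) measurable
    finally show "(\<lambda>r. indicator {s<..<t} r *\<^sub>R (if c < r then cinner a (B (blinfun_exp ((r - c) *\<^sub>R B) z)) else 0)) \<in> borel_measurable lborel" .
    show "AE r in lborel. indicator {c..t} r *\<^sub>R cinner a (B (blinfun_exp ((r - c) *\<^sub>R B) z)) =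
       indicator {s<..<t} r *\<^sub>R (if c < r then cinner a (B (blinfun_exp ((r - c) *\<^sub>R B) z)) else 0)"
      using ae by eventually_elim (use that in \<open>auto simp: indicator_def\<close>)
  qed
  have t1: "has_bochner_integral lborel
      (\<lambda>r. if L = [] then indicator {s<..<t} r *\<^sub>R (if s < r then cinner a (B (blinfun_exp ((r - s) *\<^sub>R B) b)) else 0) else 0)
      (if L = [] then cinner a (blinfun_exp ((t - s) *\<^sub>R B) b) - cinner a b else 0)"
    using exp_int[of s b] assms by auto
  \<comment> \<open>Since \<open>?c i < r\<close> and \<open>r < t\<close> imply
    \<open>?c i < t\<close>, the outer condition is free of \<open>r\<close> and each summand can be
    integrated separately.\<close>
  have t2: "has_bochner_integral lborel
      (\<lambda>r. if s < ?c i \<and> ?c i < t then indicator {s<..<t} r *\<^sub>R (if ?c i < r then cinner a (B (blinfun_exp ((r - ?c i) *\<^sub>R B) (y i))) else 0) else 0)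
      (if s < ?c i \<and> ?c i < t then cinner a (blinfun_exp ((t - ?c i) *\<^sub>R B) (y i)) - cinner a (y i) else 0)" for i
    using exp_int[of "?c i" "y i"] by auto
  have apply_rec: "word_kernel B s r L b = (if L = [] then blinfun_exp ((r - s) *\<^sub>R B) b else 0) +
     (\<Sum>i<length L. if s < ?c i \<and> ?c i < r then blinfun_exp ((r - ?c i) *\<^sub>R B) (y i) else 0)" for r
    unfolding y_def by (subst word_kernel_rec)
      (auto simp: blinfun.add_left blinfun.sum_left if_distrib[of "\<lambda>T. blinfun_apply T b"] cong: if_cong intro!: sum.cong)
  have "has_bochner_integral lborel
    (\<lambda>r. (if L = [] then indicator {s<..<t} r *\<^sub>R (if s < r then cinner a (B (blinfun_exp ((r - s) *\<^sub>R B) b)) else 0) else 0) +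
     (\<Sum>i<length L. if s < ?c i \<and> ?c i < t then indicator {s<..<t} r *\<^sub>R (if ?c i < r then cinner a (B (blinfun_exp ((r - ?c i) *\<^sub>R B) (y i))) else 0) else 0))
    ((if L = [] then cinner a (blinfun_exp ((t - s) *\<^sub>R B) b) - cinner a b else 0) +
     (\<Sum>i<length L. if s < ?c i \<and> ?c i < t then cinner a (blinfun_exp ((t - ?c i) *\<^sub>R B) (y i)) - cinner a (y i) else 0))" (is "has_bochner_integral _ ?f ?v")
    by (intro has_bochner_integral_add has_bochner_integral_sum t1 t2)
  also have "?f = (\<lambda>r. indicator {s<..<t} r *\<^sub>R cinner a (B (word_kernel B s r L b)))"
  proof
    fix r
    show "?f r = indicator {s<..<t} r *\<^sub>R cinner a (B (word_kernel B s r L b))"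
    proof (cases "s < r \<and> r < t")
      case True
      then show ?thesis
        unfolding apply_rec
        by (auto simp: blinfun.add_right cinner.add_right blinfun.sum_right cinner.sum_right cinner.zero_right intro!: sum.cong)
    next
      case False
      then show ?thesis by (auto simp: indicator_def intro!: sum.neutral)
    qed
  qed
  also have "?v = cinner a (word_kernel B s t L b) - (if L = [] then cinner a b else 0) -
      (\<Sum>i<length L. if s < ?c i \<and> ?c i < t then cinner a (y i) else 0)"
    unfolding apply_rec cinner.add_right cinner.sum_right
    by (auto simp: cinner.zero_right simp flip: sum_subtractf intro!: sum.cong)
  finally show ?thesis unfolding y_def .
qed


section \<open>Admissibility of the explicit kernel\<close>

abbreviation config3_measure :: "(real list \<times> real list \<times> real list) measure" where
  "config3_measure \<equiv> config_measure \<Otimes>\<^sub>M config_measure \<Otimes>\<^sub>M config_measure"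

abbreviation config4_measure :: "(real list \<times> real list \<times> real list \<times> real list) measure" where
  "config4_measure \<equiv> config_measure \<Otimes>\<^sub>M config3_measure"

interpretation config2: pair_sigma_finite config_measure config_measure ..
interpretation config3: pair_sigma_finite config_measure "config_measure \<Otimes>\<^sub>M config_measure" ..
interpretation config4: pair_sigma_finite config_measure config3_measure ..
interpretation time3: pair_sigma_finite "lborel :: real measure" config3_measure ..
interpretation time4: pair_sigma_finite "lborel :: real measure" config4_measure ..

lemma sum_lessThan_If:
  fixes f :: "nat \<Rightarrow> 'a::comm_monoid_add"
  assumes "l \<le> N"
  shows "(\<Sum>i<l. f i) = (\<Sum>i<N. if i < l then f i else 0)"
  using assms by (intro sum.mono_neutral_cong_left) auto

text \<open>Measurability of sorting never has to be discussed: by induction on the total number of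
  points, the recursion builds the kernel from comparisons, deletions and exponentials.\<close>

lemma strongly_measurable_explicit_kernel:
  "strongly_measurable (lborel \<Otimes>\<^sub>M config3_measure)
     (\<lambda>(t, \<sigma>, \<tau>, \<upsilon>). explicit_kernel A1 A0 Am1 B s t \<sigma> \<tau> \<upsilon>)"
proof -
  let ?M = "(lborel :: real measure) \<Otimes>\<^sub>M config3_measure"
  let ?K = "explicit_kernel A1 A0 Am1 B s"
  define size where "size x = (case x of (t::real, \<sigma>::real list, \<tau>::real list, \<upsilon>::real list) \<Rightarrow> length \<sigma> + length \<tau> + length \<upsilon>)" for x
  \<comment> \<open>On configurations with exactly \<open>N\<close> points the recursion expresses
    \<open>G (Suc N)\<close> by \<open>G N\<close> in a fixed number of summands; the missing ones
    are padded with 0.\<close>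
  define G where "G N x = (if size x = N then case x of (t, \<sigma>, \<tau>, \<upsilon>) \<Rightarrow> ?K t \<sigma> \<tau> \<upsilon> else 0)" for N x
  have size_m [measurable]: "size \<in> measurable ?M (count_space UNIV)"
    unfolding size_def by measurable
  have exp_m: "strongly_measurable ?M (\<lambda>x. blinfun_exp ((fst x - r x) *\<^sub>R B))" if [measurable]: "r \<in> borel_measurable ?M" for r
    by (rule strongly_measurable_continuous[OF continuous_on_blinfun_exp]) measurable
  have G_m: "strongly_measurable ?M (G N)" for N
  proof (induction N)
    case 0
    have "strongly_measurable ?M (\<lambda>x. if size x = 0 then blinfun_exp ((fst x - s) *\<^sub>R B) else 0)"
      by (intro strongly_measurable_If exp_m strongly_measurable_const) measurable
    moreover have "G 0 = (\<lambda>x. if size x = 0 then blinfun_exp ((fst x - s) *\<^sub>R B) else 0)"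
      by (auto simp: G_def size_def explicit_kernel_def fun_eq_iff)
    ultimately show ?case by simp
  next
    case (Suc N)
    have step: "strongly_measurable ?M (\<lambda>x. if P x \<and> s < r x \<and> r x < fst x then blinfun_exp ((fst x - r x) *\<^sub>R B) o\<^sub>L C o\<^sub>L G N (T x) else 0)"
      if [measurable]: "r \<in> borel_measurable ?M" "T \<in> measurable ?M ?M" "Measurable.pred ?M P" for r T C P
      by (intro strongly_measurable_If strongly_measurable_const strongly_measurable_bilinear[OF bounded_bilinear_blinfun_compose]
          exp_m strongly_measurable_comp[OF Suc]) measurable
    define g1 where "g1 i x = (if i < length (fst (snd x)) \<and> s < fst (snd x) ! i \<and> fst (snd x) ! i < fst x
      then blinfun_exp ((fst x - fst (snd x) ! i) *\<^sub>R B) o\<^sub>L A1 o\<^sub>L G N (fst (snd x) ! i, delete_at i (fst (snd x)), snd (snd x)) else 0)"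
      for i and x :: "real \<times> real list \<times> real list \<times> real list"
    define g2 where "g2 i x = (if i < length (fst (snd (snd x))) \<and> s < fst (snd (snd x)) ! i \<and> fst (snd (snd x)) ! i < fst x
      then blinfun_exp ((fst x - fst (snd (snd x)) ! i) *\<^sub>R B) o\<^sub>L A0 o\<^sub>L G N (fst (snd (snd x)) ! i, fst (snd x), delete_at i (fst (snd (snd x))), snd (snd (snd x))) else 0)"
      for i and x :: "real \<times> real list \<times> real list \<times> real list"
    define g3 where "g3 i x = (if i < length (snd (snd (snd x))) \<and> s < snd (snd (snd x)) ! i \<and> snd (snd (snd x)) ! i < fst x
      then blinfun_exp ((fst x - snd (snd (snd x)) ! i) *\<^sub>R B) o\<^sub>L Am1 o\<^sub>L G N (snd (snd (snd x)) ! i, fst (snd x), fst (snd (snd x)), delete_at i (snd (snd (snd x)))) else 0)"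
      for i and x :: "real \<times> real list \<times> real list \<times> real list"
    have "strongly_measurable ?M (g1 i)" for i unfolding g1_def by (rule step; measurable)
    moreover have "strongly_measurable ?M (g2 i)" for i unfolding g2_def by (rule step; measurable)
    moreover have "strongly_measurable ?M (g3 i)" for i unfolding g3_def by (rule step; measurable)
    ultimately have "strongly_measurable ?M (\<lambda>x. if size x = Suc N then (\<Sum>i<Suc N. g1 i x) + (\<Sum>i<Suc N. g2 i x) + (\<Sum>i<Suc N. g3 i x) else 0)"
      by (intro strongly_measurable_If strongly_measurable_const strongly_measurable_add strongly_measurable_sum) measurable
    moreover have "G (Suc N) = (\<lambda>x. if size x = Suc N then (\<Sum>i<Suc N. g1 i x) + (\<Sum>i<Suc N. g2 i x) + (\<Sum>i<Suc N. g3 i x) else 0)"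
    proof
      fix x :: "real \<times> real list \<times> real list \<times> real list"
      obtain t \<sigma> \<tau> \<upsilon> where x: "x = (t, \<sigma>, \<tau>, \<upsilon>)" by (cases x)
      show "G (Suc N) x = (if size x = Suc N then (\<Sum>i<Suc N. g1 i x) + (\<Sum>i<Suc N. g2 i x) + (\<Sum>i<Suc N. g3 i x) else 0)"
      proof (cases "size x = Suc N")
        case True
        then have len: "length \<sigma> + length \<tau> + length \<upsilon> = Suc N" by (simp add: x size_def)
        have e1: "(\<Sum>i<Suc N. g1 i x) = (\<Sum>i<length \<sigma>. if s < \<sigma> ! i \<and> \<sigma> ! i < t then blinfun_exp ((t - \<sigma> ! i) *\<^sub>R B) o\<^sub>L A1 o\<^sub>L
            ?K (\<sigma> ! i) (delete_at i \<sigma>) \<tau> \<upsilon> else 0)"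
          using len by (subst sum_lessThan_If[of "length \<sigma>" "Suc N"])
            (auto simp: g1_def x G_def size_def length_delete_at intro!: sum.cong)
        have e2: "(\<Sum>i<Suc N. g2 i x) = (\<Sum>i<length \<tau>. if s < \<tau> ! i \<and> \<tau> ! i < t then blinfun_exp ((t - \<tau> ! i) *\<^sub>R B) o\<^sub>L A0 o\<^sub>L
            ?K (\<tau> ! i) \<sigma> (delete_at i \<tau>) \<upsilon> else 0)"
          using len by (subst sum_lessThan_If[of "length \<tau>" "Suc N"])
            (auto simp: g2_def x G_def size_def length_delete_at intro!: sum.cong)
        have e3: "(\<Sum>i<Suc N. g3 i x) = (\<Sum>i<length \<upsilon>. if s < \<upsilon> ! i \<and> \<upsilon> ! i < t then blinfun_exp ((t - \<upsilon> ! i) *\<^sub>R B) o\<^sub>L Am1 o\<^sub>L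
            ?K (\<upsilon> ! i) \<sigma> \<tau> (delete_at i \<upsilon>) else 0)"
          using len by (subst sum_lessThan_If[of "length \<upsilon>" "Suc N"])
            (auto simp: g3_def x G_def size_def length_delete_at intro!: sum.cong)
        have "G (Suc N) x = ?K t \<sigma> \<tau> \<upsilon>" using True by (simp add: G_def x)
        also have "\<dots> = (\<Sum>i<Suc N. g1 i x) + (\<Sum>i<Suc N. g2 i x) + (\<Sum>i<Suc N. g3 i x)"
          unfolding e1 e2 e3 using len by (subst explicit_kernel_rec) auto
        finally show ?thesis using True by simp
      qed (simp add: G_def)
    qed
    ultimately show ?case by simp
  qed
  have "strongly_measurable ?M (\<lambda>x. G (size x) x)"
    by (rule strongly_measurable_countable_cases[OF G_m size_m])
  then show ?thesis by (simp add: G_def case_prod_unfold)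
qed

lemma strongly_measurable_explicit_kernel':
  assumes "T \<in> measurable M (lborel \<Otimes>\<^sub>M config3_measure)"
  shows "strongly_measurable M (\<lambda>x. case T x of (t, \<sigma>, \<tau>, \<upsilon>) \<Rightarrow> explicit_kernel A1 A0 Am1 B s t \<sigma> \<tau> \<upsilon>)"
  by (rule strongly_measurable_comp[OF strongly_measurable_explicit_kernel assms])

text \<open>The lengths of the time intervals add up to \<open>t - s\<close>, so the exponential
  bounds multiply to a single one.\<close>

lemma norm_ordered_product_le:
  assumes "sorted (map fst cs)" "\<And>r C. (r, C) \<in> set cs \<Longrightarrow> s \<le> r \<and> r \<le> t \<and> norm C \<le> a" "s \<le> t"
  shows "norm (ordered_product B s cs t) \<le> a ^ length cs * exp ((t - s) * norm B)"
  using assms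
proof (induction B s cs t rule: ordered_product.induct)
  case (1 B s t)
  then show ?case using norm_blinfun_exp_le[of "t - s" B] by simp
next
  case (2 B s r C cs t)
  have r: "s \<le> r" "r \<le> t" "norm C \<le> a" using 2(3)[of r C] by auto
  have "norm (ordered_product B r cs t) \<le> a ^ length cs * exp ((t - r) * norm B)"
  proof (rule 2(1))
    fix r' C' assume "(r', C') \<in> set cs"
    then show "r \<le> r' \<and> r' \<le> t \<and> norm C' \<le> a"
      using 2(2) 2(3)[of r' C'] by force
  qed (use 2 r in auto)
  then have "norm (ordered_product B s ((r, C) # cs) t) \<le>
      a ^ length cs * exp ((t - r) * norm B) * a * exp (\<bar>r - s\<bar> * norm B)"
    using r norm_blinfun_exp_le[of "r - s" B] by (auto intro!: norm_blinfun_compose_le)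
  also have "\<dots> = a ^ length ((r, C) # cs) * exp ((t - s) * norm B)"
    using r by (simp add: exp_add[symmetric] algebra_simps)
  finally show ?case .
qed

lemma explicit_kernel_bounded:
  obtains C where "C > 0" "\<And>t \<sigma> \<tau> \<upsilon>. s \<le> t \<Longrightarrow> t \<le> s + T \<Longrightarrow> length \<sigma> \<le> n \<Longrightarrow> length \<tau> \<le> n \<Longrightarrow> length \<upsilon> \<le> n \<Longrightarrow>
    norm (explicit_kernel A1 A0 Am1 B s t \<sigma> \<tau> \<upsilon>) \<le> C"
proof -
  \<comment> \<open>The summand 1 makes the powers of \<open>a\<close> increasing, so that words of
    all lengths up to \<open>3 * n\<close> share one bound.\<close>
  define a where "a = 1 + norm A1 + norm A0 + norm Am1"
  have a: "a \<ge> 1" "norm A1 \<le> a" "norm A0 \<le> a" "norm Am1 \<le> a" by (auto simp: a_def)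
  define C where "C = a ^ (3 * n) * exp (T * norm B)"
  have "norm (explicit_kernel A1 A0 Am1 B s t \<sigma> \<tau> \<upsilon>) \<le> C"
    if t: "s \<le> t" "t \<le> s + T" and len: "length \<sigma> \<le> n" "length \<tau> \<le> n" "length \<upsilon> \<le> n" for t \<sigma> \<tau> \<upsilon>
  proof (cases "good_word s t (word A1 A0 Am1 \<sigma> \<tau> \<upsilon>)")
    case True
    let ?cs = "sort_key fst (word A1 A0 Am1 \<sigma> \<tau> \<upsilon>)"
    have "norm (ordered_product B s ?cs t) \<le> a ^ length ?cs * exp ((t - s) * norm B)"
    proof (rule norm_ordered_product_le)
      fix r D assume "(r, D) \<in> set ?cs"
      then have rD: "(r, D) \<in> set (word A1 A0 Am1 \<sigma> \<tau> \<upsilon>)" by simp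
      then have "r \<in> set (map fst (word A1 A0 Am1 \<sigma> \<tau> \<upsilon>))" by force
      then have "s < r \<and> r < t" using True by (auto simp: good_word_def)
      then show "s \<le> r \<and> r \<le> t \<and> norm D \<le> a" using rD a by (auto simp: word_def)
    qed (use t in auto)
    also have "\<dots> \<le> a ^ (3 * n) * exp (T * norm B)"
      using a t len by (intro mult_mono power_increasing) (auto simp: word_def intro: mult_right_mono)
    finally show ?thesis using True by (simp add: explicit_kernel_eq_word_kernel word_kernel_def C_def)
  next
    case False
    then show ?thesis using a by (simp add: explicit_kernel_eq_word_kernel word_kernel_def C_def)
  qed
  moreover have "C > 0" using a by (simp add: C_def)
  ultimately show ?thesis using that by blast
qed

lemma scaleC_zero: "c *\<^sub>C (0::'k::complex_hilbert_space) = 0"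
  using scaleC_add_right[of c "0::'k" 0] by simp

lemma ordered_product_in_bounded_ops:
  assumes "B \<in> bounded_ops" "\<And>r C. (r, C) \<in> set cs \<Longrightarrow> C \<in> bounded_ops"
  shows "ordered_product B s cs t \<in> (bounded_ops :: ('k::complex_hilbert_space \<Rightarrow>\<^sub>L 'k) set)"
  using assms
  by (induction B s cs t rule: ordered_product.induct)
     (auto intro!: bounded_ops_compose blinfun_exp_in_bounded_ops)

lemma explicit_kernel_in_bounded_ops:
  fixes A1 A0 Am1 B :: "'k::complex_hilbert_space \<Rightarrow>\<^sub>L 'k"
  assumes "A1 \<in> bounded_ops" "A0 \<in> bounded_ops" "Am1 \<in> bounded_ops" "B \<in> bounded_ops"
  shows "explicit_kernel A1 A0 Am1 B s t \<sigma> \<tau> \<upsilon> \<in> bounded_ops"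
proof -
  have "0 \<in> (bounded_ops :: ('k \<Rightarrow>\<^sub>L 'k) set)" by (simp add: bounded_ops_def scaleC_zero)
  then show ?thesis
    unfolding explicit_kernel_eq_word_kernel word_kernel_def
    using assms by (auto intro!: ordered_product_in_bounded_ops simp: word_def)
qed

lemma integrable_bounded_times:
  fixes F :: "'a \<Rightarrow> 'b::{banach, second_countable_topology}"
  assumes "F \<in> borel_measurable M" "A \<in> sets M" "emeasure M A < \<infinity>"
    "\<And>x. x \<in> A \<Longrightarrow> norm (F x) \<le> C" "\<And>x. x \<notin> A \<Longrightarrow> F x = 0"
  shows "integrable M F"
  by (rule integrableI_bounded_set[of A _ _ C]) (use assms in auto)

lemma config3_box:
  "config_box n \<times> config_box n \<times> config_box n \<in> sets config3_measure"
  "emeasure config3_measure (config_box n \<times> config_box n \<times> config_box n) < \<infinity>"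
  using emeasure_config_box[of n]
  by (auto simp: config.emeasure_pair_measure_Times config2.emeasure_pair_measure_Times ennreal_mult_less_top)

lemma config4_box:
  "config_box n \<times> config_box n \<times> config_box n \<times> config_box n \<in> sets config4_measure"
  "emeasure config4_measure (config_box n \<times> config_box n \<times> config_box n \<times> config_box n) < \<infinity>"
  using emeasure_config_box[of n] config3_box[of n]
  by (auto simp: config3.emeasure_pair_measure_Times ennreal_mult_less_top)

text \<open>On a box the number of points and the time are bounded, hence so is the kernel, and the
  box has finite measure. Symmetry holds because permuting one variable leaves the multiset of the
  word unchanged.\<close>

lemma explicit_kernel_admissible:
  fixes A1 A0 Am1 B :: "'k::{complex_hilbert_space, second_countable_topology} \<Rightarrow>\<^sub>L 'k"
  assumes "A1 \<in> bounded_ops" "A0 \<in> bounded_ops" "Am1 \<in> bounded_ops" "B \<in> bounded_ops"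
  shows "admissible s (explicit_kernel A1 A0 Am1 B s)"
  unfolding admissible_def
proof (intro conjI allI impI)
  let ?K = "explicit_kernel A1 A0 Am1 B s"
  fix t assume t: "s \<le> t"
  show "?K t \<sigma> \<tau> \<upsilon> \<in> bounded_ops" for \<sigma> \<tau> \<upsilon> by (rule explicit_kernel_in_bounded_ops[OF assms])
  show "symmetric (\<lambda>\<sigma>. ?K t \<sigma> \<tau> \<upsilon>)" for \<tau> \<upsilon>
    unfolding symmetric_def explicit_kernel_eq_word_kernel word_def by (auto intro!: word_kernel_mset)
  show "symmetric (\<lambda>\<tau>. ?K t \<sigma> \<tau> \<upsilon>)" for \<sigma> \<upsilon>
    unfolding symmetric_def explicit_kernel_eq_word_kernel word_def by (auto intro!: word_kernel_mset)
  show "symmetric (\<lambda>\<upsilon>. ?K t \<sigma> \<tau> \<upsilon>)" for \<sigma> \<tau>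
    unfolding symmetric_def explicit_kernel_eq_word_kernel word_def by (auto intro!: word_kernel_mset)
  show "locally_integrable_kernel (?K t)"
    unfolding locally_integrable_kernel_def locally_integrable_def
  proof
    fix n
    let ?D = "config_box n \<times> config_box n \<times> config_box n"
    obtain C where C: "C > 0" "\<And>t' \<sigma> \<tau> \<upsilon>. s \<le> t' \<Longrightarrow> t' \<le> s + (t - s) \<Longrightarrow> length \<sigma> \<le> n \<Longrightarrow> length \<tau> \<le> n \<Longrightarrow> length \<upsilon> \<le> n \<Longrightarrow>
      norm (?K t' \<sigma> \<tau> \<upsilon>) \<le> C"
      using explicit_kernel_bounded[where s=s and T="t - s" and n=n and ?A1.0=A1 and ?A0.0=A0 and ?Am1.0=Am1 and B=B] by metis
    let ?F = "\<lambda>x. indicator ?D x *\<^sub>R (case x of (\<sigma>, \<tau>, \<upsilon>) \<Rightarrow> ?K t \<sigma> \<tau> \<upsilon>)"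
    have "strongly_measurable config3_measure (\<lambda>x. if x \<in> ?D then (case (t, x) of (t, \<sigma>, \<tau>, \<upsilon>) \<Rightarrow> ?K t \<sigma> \<tau> \<upsilon>) else 0)"
      using config3_box[of n] by (intro strongly_measurable_If strongly_measurable_const strongly_measurable_explicit_kernel') auto
    also have "(\<lambda>x. if x \<in> ?D then (case (t, x) of (t, \<sigma>, \<tau>, \<upsilon>) \<Rightarrow> ?K t \<sigma> \<tau> \<upsilon>) else 0) = ?F"
      by (auto simp: indicator_def)
    finally have m: "strongly_measurable config3_measure ?F" .
    show "norm_integrable (completion config3_measure) ?F"
    proof (rule norm_integrable_completionI[OF m])
      show "integrable config3_measure (\<lambda>x. norm (?F x))"
        by (rule integrable_bounded_times[OF borel_measurable_norm_strongly_measurable[OF m] config3_box[of n], where C = C])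
           (use C(2)[of t] t in \<open>auto simp: config_box_def\<close>)
    qed
  qed
next
  let ?K = "explicit_kernel A1 A0 Am1 B s"
  show "locally_integrable (completion (lborel \<Otimes>\<^sub>M config3_measure))
     (\<lambda>n. {s..s + real n} \<times> config_box n \<times> config_box n \<times> config_box n) (\<lambda>(t, \<sigma>, \<tau>, \<upsilon>). ?K t \<sigma> \<tau> \<upsilon>)"
    unfolding locally_integrable_def
  proof
    fix n
    let ?D = "{s..s + real n} \<times> config_box n \<times> config_box n \<times> config_box n"
    have D: "?D \<in> sets (lborel \<Otimes>\<^sub>M config3_measure)" "emeasure (lborel \<Otimes>\<^sub>M config3_measure) ?D < \<infinity>"
      using config3_box[of n]
      by (auto simp: config3.emeasure_pair_measure_Times ennreal_mult_less_top)
    obtain C where C: "C > 0" "\<And>t' \<sigma> \<tau> \<upsilon>. s \<le> t' \<Longrightarrow> t' \<le> s + real n \<Longrightarrow> length \<sigma> \<le> n \<Longrightarrow> length \<tau> \<le> n \<Longrightarrow> length \<upsilon> \<le> n \<Longrightarrow>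
      norm (?K t' \<sigma> \<tau> \<upsilon>) \<le> C"
      using explicit_kernel_bounded[where s=s and T="real n" and n=n and ?A1.0=A1 and ?A0.0=A0 and ?Am1.0=Am1 and B=B] by metis
    let ?F = "\<lambda>x. indicator ?D x *\<^sub>R (case x of (t, \<sigma>, \<tau>, \<upsilon>) \<Rightarrow> ?K t \<sigma> \<tau> \<upsilon>)"
    have "strongly_measurable (lborel \<Otimes>\<^sub>M config3_measure) (\<lambda>x. if x \<in> ?D then (case x of (t, \<sigma>, \<tau>, \<upsilon>) \<Rightarrow> ?K t \<sigma> \<tau> \<upsilon>) else 0)"
    proof (intro strongly_measurable_If strongly_measurable_const strongly_measurable_explicit_kernel)
      show "{x \<in> space (lborel \<Otimes>\<^sub>M config3_measure). x \<in> ?D} \<in> sets (lborel \<Otimes>\<^sub>M config3_measure)"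
        using D(1) by (rule back_subst[where P = "\<lambda>A. A \<in> sets (lborel \<Otimes>\<^sub>M config3_measure)"]) (auto simp: space_pair_measure)
    qed
    also have "(\<lambda>x. if x \<in> ?D then (case x of (t, \<sigma>, \<tau>, \<upsilon>) \<Rightarrow> ?K t \<sigma> \<tau> \<upsilon>) else 0) = ?F"
      by (auto simp: indicator_def)
    finally have m: "strongly_measurable (lborel \<Otimes>\<^sub>M config3_measure) ?F" .
    show "norm_integrable (completion (lborel \<Otimes>\<^sub>M config3_measure)) ?F"
    proof (rule norm_integrable_completionI[OF m])
      show "integrable (lborel \<Otimes>\<^sub>M config3_measure) (\<lambda>x. norm (?F x))"
        by (rule integrable_bounded_times[OF borel_measurable_norm_strongly_measurable[OF m] D, where C = C])
           (use C(2) in \<open>auto simp: config_box_def\<close>)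
    qed
  qed
qed


section \<open>Splitting off one point of a configuration\<close>

definition insert_coord :: "nat \<Rightarrow> nat \<Rightarrow> real \<times> (nat \<Rightarrow> real) \<Rightarrow> nat \<Rightarrow> real" where
  "insert_coord n i p = (\<lambda>j\<in>{..<Suc n}. if j < i then snd p j else if j = i then fst p else snd p (j - 1))"

lemma measurable_insert_coord:
  assumes "i \<le> n"
  shows "insert_coord n i \<in> measurable (lborel \<Otimes>\<^sub>M lebesgue_n n) (lebesgue_n (Suc n))"
  unfolding lebesgue_n_def insert_coord_def
proof (rule measurable_restrict)
  fix j assume "j \<in> {..<Suc n}"
  then have "j < i \<and> j < n \<or> j = i \<or> \<not> j < i \<and> j \<noteq> i \<and> j - 1 < n" using assms by auto
  then show "(\<lambda>p. if j < i then snd p j else if j = i then fst p else snd p (j - 1))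
      \<in> measurable (lborel \<Otimes>\<^sub>M Pi\<^sub>M {..<n} (\<lambda>_. lborel)) lborel"
    by (elim disjE) auto
qed

text \<open>Insertion only relabels coordinates: a product box pulls back to a product box, with the
  same factors in another order, and boxes determine the product measure.\<close>

lemma distr_insert_coord:
  assumes "i \<le> n"
  shows "distr (lborel \<Otimes>\<^sub>M lebesgue_n n) (lebesgue_n (Suc n)) (insert_coord n i) = lebesgue_n (Suc n)"
    (is "?P = _")
proof -
  interpret L: sigma_finite_measure "lebesgue_n n" by (rule sigma_finite_lebesgue_n)
  \<comment> \<open>\<open>?sk\<close> enumerates the indices below \<open>Suc n\<close> other than
    \<open>i\<close>; it tells where the old coordinates go.\<close>
  let ?sk = "\<lambda>j. if j < i then j else Suc j"
  have "?P = Pi\<^sub>M {..<Suc n} (\<lambda>_. lborel)"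
  proof (rule lborel.PiM_eqI)
    show "sets ?P = sets (Pi\<^sub>M {..<Suc n} (\<lambda>_. lborel))" by (simp add: lebesgue_n_def)
    fix A :: "nat \<Rightarrow> real set" assume A: "\<And>j. j \<in> {..<Suc n} \<Longrightarrow> A j \<in> sets lborel"
    have box: "Pi\<^sub>E {..<Suc n} A \<in> sets (lebesgue_n (Suc n))"
      unfolding lebesgue_n_def using A by (intro sets_PiM_I_finite) auto
    have "insert_coord n i -` Pi\<^sub>E {..<Suc n} A \<inter> space (lborel \<Otimes>\<^sub>M lebesgue_n n) =
        A i \<times> Pi\<^sub>E {..<n} (\<lambda>j. A (?sk j))"
    proof (intro set_eqI)
      fix p :: "real \<times> (nat \<Rightarrow> real)"
      obtain r x where p: "p = (r, x)" by (cases p)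
      have "(\<forall>j<Suc n. (if j < i then x j else if j = i then r else x (j - 1)) \<in> A j) \<longleftrightarrow>
          r \<in> A i \<and> (\<forall>j<n. x j \<in> A (?sk j))" (is "?l \<longleftrightarrow> ?r")
      proof
        assume l: ?l
        have "r \<in> A i" using l assms by (auto dest!: spec[of _ i])
        moreover have "x j \<in> A (?sk j)" if "j < n" for j
          using l[rule_format, of "?sk j"] that by (auto split: if_splits)
        ultimately show ?r by blast
      next
        assume r: ?r
        show ?l
        proof (intro allI impI)
          fix j assume j: "j < Suc n"
          consider "j < i" | "j = i" | "i < j" by linarith
          then show "(if j < i then x j else if j = i then r else x (j - 1)) \<in> A j"
          proof cases
            case 1
            then have "j < n" using assms by simp
            then show ?thesis using r[THEN conjunct2, rule_format, of j] 1 by simp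
          next
            case 2
            then show ?thesis using r by simp
          next
            case 3
            then have "j - 1 < n" "\<not> j - 1 < i" "Suc (j - 1) = j" using j by auto
            then show ?thesis using r[THEN conjunct2, rule_format, of "j - 1"] 3 by simp
          qed
        qed
      qed
      moreover have "insert_coord n i p \<in> Pi\<^sub>E {..<Suc n} A \<longleftrightarrow>
          (\<forall>j<Suc n. (if j < i then x j else if j = i then r else x (j - 1)) \<in> A j)"
        unfolding insert_coord_def restrict_PiE_iff by (simp only: p fst_conv snd_conv lessThan_iff Ball_def)
      moreover have "p \<in> A i \<times> Pi\<^sub>E {..<n} (\<lambda>j. A (?sk j)) \<longleftrightarrow>
          r \<in> A i \<and> (\<forall>j<n. x j \<in> A (?sk j)) \<and> x \<in> extensional {..<n}"
        by (simp only: p mem_Times_iff fst_conv snd_conv PiE_iff lessThan_iff Ball_def)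
      moreover have "p \<in> space (lborel \<Otimes>\<^sub>M lebesgue_n n) \<longleftrightarrow> x \<in> extensional {..<n}"
        by (simp add: p space_pair_measure space_lebesgue_n PiE_iff)
      ultimately show "p \<in> insert_coord n i -` Pi\<^sub>E {..<Suc n} A \<inter> space (lborel \<Otimes>\<^sub>M lebesgue_n n) \<longleftrightarrow>
          p \<in> A i \<times> Pi\<^sub>E {..<n} (\<lambda>j. A (?sk j))"
        by (simp only: vimage_eq Int_iff) blast
    qed
    then have "emeasure ?P (Pi\<^sub>E {..<Suc n} A) =
        emeasure (lborel \<Otimes>\<^sub>M lebesgue_n n) (A i \<times> Pi\<^sub>E {..<n} (\<lambda>j. A (?sk j)))"
      using box by (simp add: emeasure_distr[OF measurable_insert_coord[OF assms]])
    also have "\<dots> = emeasure lborel (A i) * emeasure (lebesgue_n n) (Pi\<^sub>E {..<n} (\<lambda>j. A (?sk j)))"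
      using A assms by (intro L.emeasure_pair_measure_Times) (auto simp: lebesgue_n_def intro!: sets_PiM_I_finite)
    also have "emeasure (lebesgue_n n) (Pi\<^sub>E {..<n} (\<lambda>j. A (?sk j))) = (\<Prod>j<n. emeasure lborel (A (?sk j)))"
      unfolding lebesgue_n_def using A by (intro lborel.emeasure_PiM) auto
    also have "(\<Prod>j<n. emeasure lborel (A (?sk j))) = (\<Prod>j\<in>{..<Suc n} - {i}. emeasure lborel (A j))"
    proof (rule prod.reindex_bij_betw)
      show "bij_betw ?sk {..<n} ({..<Suc n} - {i})"
        by (rule bij_betw_byWitness[where f'="\<lambda>j. if j < i then j else j - 1"]) (use assms in auto)
    qed
    also have "emeasure lborel (A i) * \<dots> = (\<Prod>j\<in>{..<Suc n}. emeasure lborel (A j))"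
      using assms by (subst prod.remove[of _ i]) auto
    finally show "emeasure ?P (Pi\<^sub>E {..<Suc n} A) = (\<Prod>j\<in>{..<Suc n}. emeasure lborel (A j))" .
  qed simp
  then show ?thesis by (simp add: lebesgue_n_def)
qed

lemma coords_insert_coord:
  assumes "i \<le> n"
  shows "coords (Suc n) (insert_coord n i (r, x)) ! i = r"
    "delete_at i (coords (Suc n) (insert_coord n i (r, x))) = coords n x"
proof -
  have c: "coords (Suc n) (insert_coord n i (r, x)) ! j =
      (if j < i then x j else if j = i then r else x (j - 1))" if "j < Suc n" for j
    using that nth_map[of j "[0..<Suc n]"] by (simp add: coords_def insert_coord_def del: upt_Suc)
  show "coords (Suc n) (insert_coord n i (r, x)) ! i = r" using c assms by simp
  show "delete_at i (coords (Suc n) (insert_coord n i (r, x))) = coords n x"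
  proof (rule nth_equalityI)
    show "length (delete_at i (coords (Suc n) (insert_coord n i (r, x)))) = length (coords n x)"
      using assms by (simp add: length_delete_at)
    fix j assume "j < length (delete_at i (coords (Suc n) (insert_coord n i (r, x))))"
    then have "j < n" using assms by (simp add: length_delete_at)
    then show "delete_at i (coords (Suc n) (insert_coord n i (r, x))) ! j = coords n x ! j"
      using assms c[of j] c[of "Suc j"] by (simp add: nth_delete_at) (simp add: coords_def)
  qed
qed

text \<open>The factor \<open>1 / (l + 1)\<close> is \<open>fact l / fact (l + 1)\<close>, the ratio
  of the weights of \<open>config_measure\<close> on \<open>l + 1\<close> and on \<open>l\<close>
  points; the condition selects the \<open>l + 1\<close> possible places.\<close>

definition share :: "nat \<Rightarrow> nat \<Rightarrow> real" where
  "share i l = (if i \<le> l then 1 / (real l + 1) else 0)"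

lemma sum_share: "l < N \<Longrightarrow> (\<Sum>i<N. share i l) = 1"
proof -
  assume "l < N"
  then have "(\<Sum>i<N. share i l) = (\<Sum>i\<le>l. 1 / (real l + 1))"
    unfolding share_def by (intro sum.mono_neutral_cong_right) auto
  then show ?thesis by (simp add: field_simps)
qed

lemma divide_fact_ennreal: "(x::ennreal) / fact n = ennreal (1 / fact n) * x"
proof -
  have "(fact n :: ennreal) = ennreal (fact n)"
    by (metis ennreal_of_nat_eq_real_of_nat of_nat_fact)
  then have "inverse (fact n :: ennreal) = ennreal (1 / fact n)"
    by (simp add: inverse_ennreal inverse_eq_divide)
  then show ?thesis
    by (simp add: divide_ennreal_def mult.commute)
qed

text \<open>
  \<open>pick i x\<close> and \<open>del i x\<close> are the \<open>i\<close>-th of the \<open>len x\<close> points of \<open>x\<close> and the configuration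
  without it. The equation is Mecke's formula for the summand number \<open>i\<close>; each of the \<open>l + 1\<close>
  positions at which \<open>r\<close> can be inserted carries the same share.
\<close>

definition mecke :: "'a measure \<Rightarrow> ('a \<Rightarrow> nat) \<Rightarrow> (nat \<Rightarrow> 'a \<Rightarrow> real) \<Rightarrow> (nat \<Rightarrow> 'a \<Rightarrow> 'a) \<Rightarrow> bool" where
  "mecke X len pick del \<longleftrightarrow> sigma_finite_measure X \<and> len \<in> measurable X (count_space UNIV) \<and>
     (\<forall>i. pick i \<in> borel_measurable X) \<and> (\<forall>i. del i \<in> measurable X X) \<and>
     (\<forall>i F. F \<in> borel_measurable (lborel \<Otimes>\<^sub>M X) \<longrightarrow>
        (\<integral>\<^sup>+x. (if i < len x then F (pick i x, del i x) else 0) \<partial>X) =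
        (\<integral>\<^sup>+p. ennreal (share i (len (snd p))) * F p \<partial>(lborel \<Otimes>\<^sub>M X)))"

text \<open>Compared by number of points: a list with \<open>n + 1\<close> points is a list with
  \<open>n\<close> points and a point inserted at place \<open>i\<close>, which preserves Lebesgue
  measure, and the weights differ by the share.\<close>

lemma mecke_config: "mecke config_measure length (\<lambda>i xs. xs ! i) delete_at"
  unfolding mecke_def
proof (intro conjI allI impI)
  fix i and F :: "real \<times> real list \<Rightarrow> ennreal"
  assume F [measurable]: "F \<in> borel_measurable (lborel \<Otimes>\<^sub>M config_measure)"
  interpret T: pair_sigma_finite "lborel :: real measure" config_measure ..
  let ?h = "\<lambda>xs. if i < length xs then F (xs ! i, delete_at i xs) else 0"
  let ?J = "\<lambda>n. \<integral>\<^sup>+x. \<integral>\<^sup>+r. F (r, coords n x) \<partial>lborel \<partial>lebesgue_n n"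
  have h_m: "?h \<in> borel_measurable config_measure" by measurable
  have step: "(\<integral>\<^sup>+y. ?h (coords (Suc n) y) \<partial>lebesgue_n (Suc n)) = (if i \<le> n then ?J n else 0)" for n
  proof (cases "i \<le> n")
    case True
    interpret Q: pair_sigma_finite "lborel :: real measure" "lebesgue_n n"
      using sigma_finite_lebesgue_n by (intro pair_sigma_finite.intro) (auto intro: sigma_finite_lborel)
    have [measurable]: "coords m \<in> measurable (lebesgue_n m) config_measure" for m by (rule measurable_coords)
    have "(\<integral>\<^sup>+y. ?h (coords (Suc n) y) \<partial>lebesgue_n (Suc n)) =
        (\<integral>\<^sup>+y. ?h (coords (Suc n) y) \<partial>distr (lborel \<Otimes>\<^sub>M lebesgue_n n) (lebesgue_n (Suc n)) (insert_coord n i))"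
      by (simp add: distr_insert_coord[OF True])
    also have "\<dots> = (\<integral>\<^sup>+p. ?h (coords (Suc n) (insert_coord n i p)) \<partial>(lborel \<Otimes>\<^sub>M lebesgue_n n))"
      by (rule nn_integral_distr[OF measurable_insert_coord[OF True]]) measurable
    also have "\<dots> = (\<integral>\<^sup>+p. F (fst p, coords n (snd p)) \<partial>(lborel \<Otimes>\<^sub>M lebesgue_n n))"
      using True by (intro nn_integral_cong) (auto simp: coords_insert_coord)
    also have "\<dots> = ?J n"
      by (subst Q.nn_integral_snd[symmetric]) (auto simp: case_prod_unfold)
    finally show ?thesis using True by simp
  qed simp
  have "(\<lambda>n. (\<integral>\<^sup>+y. ?h (coords (Suc n) y) \<partial>lebesgue_n (Suc n)) / fact (Suc n)) sums
      (\<Sum>n. (\<integral>\<^sup>+y. ?h (coords (Suc n) y) \<partial>lebesgue_n (Suc n)) / fact (Suc n))"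
    by (rule summable_sums) auto
  \<comment> \<open>The empty list has no point number \<open>i\<close>, so its term vanishes and
    the series begins at length 1.\<close>
  from sums_unique[OF sums_Suc[OF this]]
  have "(\<integral>\<^sup>+xs. ?h xs \<partial>config_measure) = (\<Sum>n. (\<integral>\<^sup>+y. ?h (coords (Suc n) y) \<partial>lebesgue_n (Suc n)) / fact (Suc n))"
    unfolding nn_integral_config_measure[OF h_m] by simp
  also have "\<dots> = (\<Sum>n. (\<integral>\<^sup>+x. (\<integral>\<^sup>+r. ennreal (share i (length (coords n x))) * F (r, coords n x) \<partial>lborel) \<partial>lebesgue_n n) / fact n)"
  proof (rule suminf_cong)
    fix n
    have [measurable]: "coords n \<in> measurable (lebesgue_n n) config_measure" by (rule measurable_coords)
    have "(\<integral>\<^sup>+x. (\<integral>\<^sup>+r. ennreal (share i (length (coords n x))) * F (r, coords n x) \<partial>lborel) \<partial>lebesgue_n n) =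
        ennreal (share i n) * ?J n"
    proof -
      have [measurable]: "(\<lambda>r. F (r, xs)) \<in> borel_measurable lborel" for xs by measurable
      have "(\<lambda>x. \<integral>\<^sup>+r. F (r, coords n x) \<partial>lborel) \<in> borel_measurable (lebesgue_n n)" by measurable
      then show ?thesis by (simp add: nn_integral_cmult)
    qed
    moreover have "ennreal (1 / fact (Suc n)) * (if i \<le> n then ?J n else 0) =
        ennreal (1 / fact n) * (ennreal (share i n) * ?J n)"
      by (auto simp: share_def mult.assoc[symmetric] field_simps simp flip: ennreal_mult)
    ultimately show "(\<integral>\<^sup>+y. ?h (coords (Suc n) y) \<partial>lebesgue_n (Suc n)) / fact (Suc n) =
        (\<integral>\<^sup>+x. (\<integral>\<^sup>+r. ennreal (share i (length (coords n x))) * F (r, coords n x) \<partial>lborel) \<partial>lebesgue_n n) / fact n"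
      unfolding divide_fact_ennreal step by simp
  qed
  also have "\<dots> = (\<integral>\<^sup>+xs. (\<integral>\<^sup>+r. ennreal (share i (length xs)) * F (r, xs) \<partial>lborel) \<partial>config_measure)"
    by (rule nn_integral_config_measure[symmetric]) measurable
  also have "\<dots> = (\<integral>\<^sup>+p. ennreal (share i (length (snd p))) * F p \<partial>(lborel \<Otimes>\<^sub>M config_measure))"
    by (subst T.nn_integral_snd[symmetric]) (auto simp: case_prod_unfold)
  finally show "(\<integral>\<^sup>+xs. ?h xs \<partial>config_measure) = (\<integral>\<^sup>+p. ennreal (share i (length (snd p))) * F p \<partial>(lborel \<Otimes>\<^sub>M config_measure))" .
qed (rule config.sigma_finite_measure_axioms measurable_length_config measurable_nth_config measurable_delete_at_config)+

text \<open>A spectator factor does not take part: by Tonelli's theorem it is integrated last. In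
  this way one variable of a product of configuration spaces is singled out.\<close>

lemma mecke_pair_right:
  assumes "mecke X len pick del" "sigma_finite_measure N"
  shows "mecke (N \<Otimes>\<^sub>M X) (\<lambda>x. len (snd x)) (\<lambda>i x. pick i (snd x)) (\<lambda>i x. (fst x, del i (snd x)))"
proof -
  have X: "sigma_finite_measure X" and [measurable]: "len \<in> measurable X (count_space UNIV)"
    "\<And>i. pick i \<in> borel_measurable X" "\<And>i. del i \<in> measurable X X"
    and eq: "\<And>i F. F \<in> borel_measurable (lborel \<Otimes>\<^sub>M X) \<Longrightarrow>
        (\<integral>\<^sup>+x. (if i < len x then F (pick i x, del i x) else 0) \<partial>X) =
        (\<integral>\<^sup>+p. ennreal (share i (len (snd p))) * F p \<partial>(lborel \<Otimes>\<^sub>M X))"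
    using assms(1) unfolding mecke_def by auto
  interpret X: sigma_finite_measure X by (rule X)
  interpret N: sigma_finite_measure N by (rule assms(2))
  interpret NX: pair_sigma_finite N X ..
  interpret LN: pair_sigma_finite "lborel :: real measure" N ..
  show ?thesis
    unfolding mecke_def
  proof (intro conjI allI impI)
    fix i and F :: "real \<times> 'b \<times> 'a \<Rightarrow> ennreal"
    assume [measurable]: "F \<in> borel_measurable (lborel \<Otimes>\<^sub>M (N \<Otimes>\<^sub>M X))"
    have "(\<integral>\<^sup>+x. (if i < len (snd x) then F (pick i (snd x), fst x, del i (snd x)) else 0) \<partial>(N \<Otimes>\<^sub>M X)) =
        (\<integral>\<^sup>+n. \<integral>\<^sup>+x. (if i < len x then F (pick i x, n, del i x) else 0) \<partial>X \<partial>N)"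
      by (subst X.nn_integral_fst[symmetric]) (auto cong: if_cong)
    also have "\<dots> = (\<integral>\<^sup>+n. \<integral>\<^sup>+p. ennreal (share i (len (snd p))) * F (fst p, n, snd p) \<partial>(lborel \<Otimes>\<^sub>M X) \<partial>N)"
    proof (rule nn_integral_cong)
      fix n assume [measurable]: "n \<in> space N"
      show "(\<integral>\<^sup>+x. (if i < len x then F (pick i x, n, del i x) else 0) \<partial>X) =
        (\<integral>\<^sup>+p. ennreal (share i (len (snd p))) * F (fst p, n, snd p) \<partial>(lborel \<Otimes>\<^sub>M X))"
        using eq[of "\<lambda>p. F (fst p, n, snd p)" i] by (simp cong: if_cong)
    qed
    also have "\<dots> = (\<integral>\<^sup>+n. \<integral>\<^sup>+r. \<integral>\<^sup>+x. ennreal (share i (len x)) * F (r, n, x) \<partial>X \<partial>lborel \<partial>N)"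
      by (intro nn_integral_cong, subst X.nn_integral_fst[symmetric]) auto
    also have "\<dots> = (\<integral>\<^sup>+r. \<integral>\<^sup>+n. \<integral>\<^sup>+x. ennreal (share i (len x)) * F (r, n, x) \<partial>X \<partial>N \<partial>lborel)"
      by (rule LN.Fubini') measurable
    also have "\<dots> = (\<integral>\<^sup>+r. \<integral>\<^sup>+p. ennreal (share i (len (snd p))) * F (r, p) \<partial>(N \<Otimes>\<^sub>M X) \<partial>lborel)"
      by (intro nn_integral_cong, subst X.nn_integral_fst[symmetric]) auto
    also have "\<dots> = (\<integral>\<^sup>+p. ennreal (share i (len (snd (snd p)))) * F p \<partial>(lborel \<Otimes>\<^sub>M (N \<Otimes>\<^sub>M X)))"
      by (subst NX.nn_integral_fst[symmetric]) auto
    finally show "(\<integral>\<^sup>+x. (if i < len (snd x) then F (pick i (snd x), fst x, del i (snd x)) else 0) \<partial>(N \<Otimes>\<^sub>M X)) =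
      (\<integral>\<^sup>+p. ennreal (share i (len (snd (snd p)))) * F p \<partial>(lborel \<Otimes>\<^sub>M (N \<Otimes>\<^sub>M X)))" .
  next
    show "sigma_finite_measure (N \<Otimes>\<^sub>M X)" by (rule NX.sigma_finite_measure_axioms)
    show "(\<lambda>x. len (snd x)) \<in> measurable (N \<Otimes>\<^sub>M X) (count_space UNIV)" by simp
    show "(\<lambda>x. pick i (snd x)) \<in> borel_measurable (N \<Otimes>\<^sub>M X)" for i by simp
    show "(\<lambda>x. (fst x, del i (snd x))) \<in> measurable (N \<Otimes>\<^sub>M X) (N \<Otimes>\<^sub>M X)" for i by simp
  qed
qed

lemma mecke_pair_left:
  assumes "mecke X len pick del" "sigma_finite_measure N"
  shows "mecke (X \<Otimes>\<^sub>M N) (\<lambda>x. len (fst x)) (\<lambda>i x. pick i (fst x)) (\<lambda>i x. (del i (fst x), snd x))"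
proof -
  have X: "sigma_finite_measure X" and [measurable]: "len \<in> measurable X (count_space UNIV)"
    "\<And>i. pick i \<in> borel_measurable X" "\<And>i. del i \<in> measurable X X"
    and eq: "\<And>i F. F \<in> borel_measurable (lborel \<Otimes>\<^sub>M X) \<Longrightarrow>
        (\<integral>\<^sup>+x. (if i < len x then F (pick i x, del i x) else 0) \<partial>X) =
        (\<integral>\<^sup>+p. ennreal (share i (len (snd p))) * F p \<partial>(lborel \<Otimes>\<^sub>M X))"
    using assms(1) unfolding mecke_def by auto
  interpret X: sigma_finite_measure X by (rule X)
  interpret N: sigma_finite_measure N by (rule assms(2))
  interpret XN: pair_sigma_finite X N ..
  interpret LN: pair_sigma_finite "lborel :: real measure" N ..
  show ?thesis
    unfolding mecke_def
  proof (intro conjI allI impI)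
    fix i and F :: "real \<times> 'a \<times> 'b \<Rightarrow> ennreal"
    assume [measurable]: "F \<in> borel_measurable (lborel \<Otimes>\<^sub>M (X \<Otimes>\<^sub>M N))"
    have "(\<integral>\<^sup>+x. (if i < len (fst x) then F (pick i (fst x), del i (fst x), snd x) else 0) \<partial>(X \<Otimes>\<^sub>M N)) =
        (\<integral>\<^sup>+n. \<integral>\<^sup>+x. (if i < len x then F (pick i x, del i x, n) else 0) \<partial>X \<partial>N)"
      by (subst XN.nn_integral_snd[symmetric]) (auto simp: case_prod_unfold cong: if_cong)
    also have "\<dots> = (\<integral>\<^sup>+n. \<integral>\<^sup>+p. ennreal (share i (len (snd p))) * F (fst p, snd p, n) \<partial>(lborel \<Otimes>\<^sub>M X) \<partial>N)"
    proof (rule nn_integral_cong)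
      fix n assume [measurable]: "n \<in> space N"
      show "(\<integral>\<^sup>+x. (if i < len x then F (pick i x, del i x, n) else 0) \<partial>X) =
        (\<integral>\<^sup>+p. ennreal (share i (len (snd p))) * F (fst p, snd p, n) \<partial>(lborel \<Otimes>\<^sub>M X))"
        using eq[of "\<lambda>p. F (fst p, snd p, n)" i] by (simp cong: if_cong)
    qed
    also have "\<dots> = (\<integral>\<^sup>+n. \<integral>\<^sup>+r. \<integral>\<^sup>+x. ennreal (share i (len x)) * F (r, x, n) \<partial>X \<partial>lborel \<partial>N)"
      by (intro nn_integral_cong, subst X.nn_integral_fst[symmetric]) auto
    also have "\<dots> = (\<integral>\<^sup>+r. \<integral>\<^sup>+n. \<integral>\<^sup>+x. ennreal (share i (len x)) * F (r, x, n) \<partial>X \<partial>N \<partial>lborel)"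
      by (rule LN.Fubini') measurable
    also have "\<dots> = (\<integral>\<^sup>+r. \<integral>\<^sup>+p. ennreal (share i (len (fst p))) * F (r, p) \<partial>(X \<Otimes>\<^sub>M N) \<partial>lborel)"
      by (intro nn_integral_cong, subst XN.nn_integral_snd[symmetric]) (auto simp: case_prod_unfold)
    also have "\<dots> = (\<integral>\<^sup>+p. ennreal (share i (len (fst (snd p)))) * F p \<partial>(lborel \<Otimes>\<^sub>M (X \<Otimes>\<^sub>M N)))"
      by (subst XN.nn_integral_fst[symmetric]) auto
    finally show "(\<integral>\<^sup>+x. (if i < len (fst x) then F (pick i (fst x), del i (fst x), snd x) else 0) \<partial>(X \<Otimes>\<^sub>M N)) =
      (\<integral>\<^sup>+p. ennreal (share i (len (fst (snd p)))) * F p \<partial>(lborel \<Otimes>\<^sub>M (X \<Otimes>\<^sub>M N)))" .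
  next
    show "sigma_finite_measure (X \<Otimes>\<^sub>M N)" by (rule XN.sigma_finite_measure_axioms)
    show "(\<lambda>x. len (fst x)) \<in> measurable (X \<Otimes>\<^sub>M N) (count_space UNIV)" by simp
    show "(\<lambda>x. pick i (fst x)) \<in> borel_measurable (X \<Otimes>\<^sub>M N)" for i by simp
    show "(\<lambda>x. (del i (fst x), snd x)) \<in> measurable (X \<Otimes>\<^sub>M N) (X \<Otimes>\<^sub>M N)" for i by simp
  qed
qed

text \<open>Read as an identity of measures, the formula for nonnegative functions says that
  \<open>X\<close>, restricted to at least \<open>i + 1\<close> points and mapped by picking point
  \<open>i\<close>, has the share as density. Hence it also holds for Bochner integrals. The bound
  \<open>N\<close> makes the sum over \<open>i\<close> finite, and the shares add up to 1 wherever
  \<open>F\<close> can be nonzero.\<close>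

lemma mecke_integral:
  fixes F :: "real \<times> 'a \<Rightarrow> 'b::{banach, second_countable_topology}"
  assumes "mecke X len pick del" and F: "integrable (lborel \<Otimes>\<^sub>M X) F"
    and N: "\<And>r x. len x \<ge> N \<Longrightarrow> F (r, x) = 0"
  shows "\<And>i. integrable X (\<lambda>x. if i < len x then F (pick i x, del i x) else 0)" (is "\<And>i. ?int i")
    and "(\<Sum>i<N. \<integral>x. (if i < len x then F (pick i x, del i x) else 0) \<partial>X) = integral\<^sup>L (lborel \<Otimes>\<^sub>M X) F"
proof -
  have [measurable]: "len \<in> measurable X (count_space UNIV)"
    "\<And>i. pick i \<in> borel_measurable X" "\<And>i. del i \<in> measurable X X"
    and eq: "\<And>i F. F \<in> borel_measurable (lborel \<Otimes>\<^sub>M X) \<Longrightarrow>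
        (\<integral>\<^sup>+x. (if i < len x then F (pick i x, del i x) else 0) \<partial>X) =
        (\<integral>\<^sup>+p. ennreal (share i (len (snd p))) * F p \<partial>(lborel \<Otimes>\<^sub>M X))"
    using assms(1) unfolding mecke_def by auto
  have Fm [measurable]: "F \<in> borel_measurable (lborel \<Otimes>\<^sub>M X)" using F by simp
  define w where "w i x = (if i < len x then 1 else 0 :: real)" for i x
  have [measurable]: "w i \<in> borel_measurable X" for i unfolding w_def by measurable
  let ?\<theta> = "\<lambda>i x. (pick i x, del i x)"
  let ?w' = "\<lambda>i p. share i (len (snd p))"
  have w'0: "?w' i p \<ge> 0" for i p by (simp add: share_def)
  have w'1: "?w' i p \<le> 1" for i p by (simp add: share_def)
  have th_m: "?\<theta> i \<in> measurable (density X (\<lambda>x. ennreal (w i x))) (lborel \<Otimes>\<^sub>M X)" for i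
    by simp
  have distr: "distr (density X (\<lambda>x. ennreal (w i x))) (lborel \<Otimes>\<^sub>M X) (?\<theta> i) =
      density (lborel \<Otimes>\<^sub>M X) (\<lambda>p. ennreal (?w' i p))" (is "?D = ?E") for i
  proof (rule measure_eqI)
    fix A assume "A \<in> sets ?D"
    then have A [measurable]: "A \<in> sets (lborel \<Otimes>\<^sub>M X)" by simp
    have "emeasure ?D A = emeasure (density X (\<lambda>x. ennreal (w i x))) (?\<theta> i -` A \<inter> space X)"
      by (subst emeasure_distr[OF th_m A]) simp
    also have "\<dots> = (\<integral>\<^sup>+x. ennreal (w i x) * indicator (?\<theta> i -` A \<inter> space X) x \<partial>X)"
      by (rule emeasure_density) (auto intro!: measurable_sets[OF _ A])
    also have "\<dots> = (\<integral>\<^sup>+x. (if i < len x then indicator A (?\<theta> i x) else 0) \<partial>X)"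
      by (intro nn_integral_cong) (auto simp: w_def indicator_def)
    also have "\<dots> = (\<integral>\<^sup>+p. ennreal (?w' i p) * indicator A p \<partial>(lborel \<Otimes>\<^sub>M X))"
      by (rule eq) measurable
    also have "\<dots> = emeasure ?E A" by (rule emeasure_density[symmetric, OF _ A]) measurable
    finally show "emeasure ?D A = emeasure ?E A" .
  qed simp
  have if_eq: "(\<lambda>x. if i < len x then F (?\<theta> i x) else 0) = (\<lambda>x. w i x *\<^sub>R F (?\<theta> i x))" for i
    by (auto simp: w_def)
  have int_w': "integrable (lborel \<Otimes>\<^sub>M X) (\<lambda>p. ?w' i p *\<^sub>R F p)" for i
    using F by (rule Bochner_Integration.integrable_bound)
      (auto simp: abs_of_nonneg[OF w'0] intro!: mult_left_le_one_le w'0 w'1)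
  have intE: "integrable (density (lborel \<Otimes>\<^sub>M X) (\<lambda>p. ennreal (?w' i p))) F" for i
    using int_w' by (subst integrable_density) (auto simp: w'0)
  show "?int i" for i
  proof -
    have "integrable (density X (\<lambda>x. ennreal (w i x))) (\<lambda>x. F (?\<theta> i x))"
      using intE[of i] unfolding distr[symmetric] by (subst (asm) integrable_distr_eq[OF th_m]) auto
    then show ?thesis
      unfolding if_eq by (subst (asm) integrable_density) (auto simp: w_def)
  qed
  have each: "(\<integral>x. (if i < len x then F (?\<theta> i x) else 0) \<partial>X) = (\<integral>p. ?w' i p *\<^sub>R F p \<partial>(lborel \<Otimes>\<^sub>M X))" for i
  proof -
    have "(\<integral>x. (if i < len x then F (?\<theta> i x) else 0) \<partial>X) = (\<integral>x. F (?\<theta> i x) \<partial>density X (\<lambda>x. ennreal (w i x)))"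
      unfolding if_eq by (subst integral_density) (auto simp: w_def)
    also have "\<dots> = integral\<^sup>L (density (lborel \<Otimes>\<^sub>M X) (\<lambda>p. ennreal (?w' i p))) F"
      unfolding distr[symmetric] by (rule integral_distr[symmetric, OF th_m Fm])
    also have "\<dots> = (\<integral>p. ?w' i p *\<^sub>R F p \<partial>(lborel \<Otimes>\<^sub>M X))"
      by (subst integral_density) (auto simp: w'0)
    finally show ?thesis .
  qed
  have "(\<Sum>i<N. \<integral>x. (if i < len x then F (?\<theta> i x) else 0) \<partial>X) = (\<integral>p. (\<Sum>i<N. ?w' i p *\<^sub>R F p) \<partial>(lborel \<Otimes>\<^sub>M X))"
    unfolding each by (subst Bochner_Integration.integral_sum) (auto intro: int_w')
  also have "\<dots> = integral\<^sup>L (lborel \<Otimes>\<^sub>M X) F"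
  proof (rule Bochner_Integration.integral_cong[OF refl])
    fix p
    show "(\<Sum>i<N. ?w' i p *\<^sub>R F p) = F p"
      using sum_share[of "len (snd p)" N] N[of "snd p" "fst p"]
      by (cases "len (snd p) < N") (simp_all flip: scaleR_sum_left)
  qed
  finally show "(\<Sum>i<N. \<integral>x. (if i < len x then F (?\<theta> i x) else 0) \<partial>X) = integral\<^sup>L (lborel \<Otimes>\<^sub>M X) F" .
qed

text \<open>One instance for each kernel variable \<sigma>, \<tau>, \<upsilon>; the variable
  \<omega>, in which the kernel is diagonal, is always a spectator.\<close>

lemma mecke_config4:
  "mecke config4_measure (\<lambda>x. length (fst (snd x))) (\<lambda>i x. fst (snd x) ! i)
     (\<lambda>i x. (fst x, delete_at i (fst (snd x)), snd (snd x)))"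
  "mecke config4_measure (\<lambda>x. length (fst (snd (snd x)))) (\<lambda>i x. fst (snd (snd x)) ! i)
     (\<lambda>i x. (fst x, fst (snd x), delete_at i (fst (snd (snd x))), snd (snd (snd x))))"
  "mecke config4_measure (\<lambda>x. length (snd (snd (snd x)))) (\<lambda>i x. snd (snd (snd x)) ! i)
     (\<lambda>i x. (fst x, fst (snd x), fst (snd (snd x)), delete_at i (snd (snd (snd x)))))"
  using mecke_pair_right[OF mecke_pair_left[OF mecke_config config2.sigma_finite_measure_axioms] config.sigma_finite_measure_axioms]
    mecke_pair_right[OF mecke_pair_right[OF mecke_pair_left[OF mecke_config config.sigma_finite_measure_axioms]
      config.sigma_finite_measure_axioms] config.sigma_finite_measure_axioms]
    mecke_pair_right[OF mecke_pair_right[OF mecke_pair_right[OF mecke_config config.sigma_finite_measure_axioms]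
      config.sigma_finite_measure_axioms] config.sigma_finite_measure_axioms]
  by simp_all


section \<open>The explicit kernel solves the equation\<close>

lemma borel_measurable_explicit_integrand:
  fixes A1 A0 Am1 B C :: "'k::{complex_hilbert_space, second_countable_topology} \<Rightarrow>\<^sub>L 'k"
  assumes f [measurable]: "(\<lambda>(r, xs). f r xs) \<in> borel_measurable (lborel \<Otimes>\<^sub>M config_measure)"
    and g [measurable]: "(\<lambda>(r, xs). g r xs) \<in> borel_measurable (lborel \<Otimes>\<^sub>M config_measure)"
  shows "(\<lambda>(r, \<omega>, \<sigma>, \<tau>, \<upsilon>). cinner (f r (\<omega> @ \<sigma> @ \<tau>)) (C (explicit_kernel A1 A0 Am1 B s r \<sigma> \<tau> \<upsilon> (g r (\<omega> @ \<tau> @ \<upsilon>)))))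
    \<in> borel_measurable (lborel \<Otimes>\<^sub>M config4_measure)"
proof -
  let ?M = "(lborel :: real measure) \<Otimes>\<^sub>M config4_measure"
  have T: "(\<lambda>x. (fst x, fst (snd (snd x)), fst (snd (snd (snd x))), snd (snd (snd (snd x))))) \<in>
      measurable ?M (lborel \<Otimes>\<^sub>M config3_measure)" by measurable
  have K: "strongly_measurable ?M (\<lambda>x. explicit_kernel A1 A0 Am1 B s (fst x) (fst (snd (snd x))) (fst (snd (snd (snd x)))) (snd (snd (snd (snd x)))))"
    using strongly_measurable_explicit_kernel'[OF T] by (simp add: case_prod_unfold)
  have [measurable]: "blinfun_apply C \<in> borel_measurable borel"
    by (intro borel_measurable_continuous_onI continuous_intros)
  have [measurable]: "(\<lambda>x. f (fst x) (fst (snd x) @ fst (snd (snd x)) @ fst (snd (snd (snd x))))) \<in> borel_measurable ?M"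
    using measurable_compose[of "\<lambda>x. (fst x, fst (snd x) @ fst (snd (snd x)) @ fst (snd (snd (snd x))))" ?M, OF _ f]
    by simp
  have [measurable]: "(\<lambda>x. g (fst x) (fst (snd x) @ fst (snd (snd (snd x))) @ snd (snd (snd (snd x))))) \<in> borel_measurable ?M"
    using measurable_compose[of "\<lambda>x. (fst x, fst (snd x) @ fst (snd (snd (snd x))) @ snd (snd (snd (snd x))))" ?M, OF _ g]
    by simp
  note [measurable] = borel_measurable_strongly_measurable_apply[OF K]
  show ?thesis unfolding case_prod_unfold by measurable
qed

text \<open>The test functions may depend on \<open>r\<close> and the coefficient \<open>C\<close>
  is free, so that one lemma covers the terms with \<open>a(r)\<close>, the term with
  \<open>B\<close> and, for \<open>C\<close> the identity, the left-hand side. The integrand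
  vanishes unless all four variables lie in the box, where it is bounded.\<close>

lemma explicit_integrand:
  fixes A1 A0 Am1 B C :: "'k::{complex_hilbert_space, second_countable_topology} \<Rightarrow>\<^sub>L 'k"
  assumes f: "(\<lambda>(r, xs). f r xs) \<in> borel_measurable (lborel \<Otimes>\<^sub>M config_measure)"
    and g: "(\<lambda>(r, xs). g r xs) \<in> borel_measurable (lborel \<Otimes>\<^sub>M config_measure)"
    and f_le: "\<And>r xs. norm (f r xs) \<le> Cf" and g_le: "\<And>r xs. norm (g r xs) \<le> Cg"
    and f_0: "\<And>r. \<forall>xs. xs \<notin> config_box n \<longrightarrow> f r xs = 0" and g_0: "\<And>r. \<forall>xs. xs \<notin> config_box n \<longrightarrow> g r xs = 0"
    and "s \<le> t"
  defines "H \<equiv> \<lambda>r (\<omega>, \<sigma>, \<tau>, \<upsilon>). cinner (f r (\<omega> @ \<sigma> @ \<tau>)) (C (explicit_kernel A1 A0 Am1 B s r \<sigma> \<tau> \<upsilon> (g r (\<omega> @ \<tau> @ \<upsilon>))))"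
  shows "integrable (lborel \<Otimes>\<^sub>M config4_measure) (\<lambda>(r, x). indicator {s<..<t} r *\<^sub>R H r x)" (is ?int)
    and "(LINT r:{s..t}|lebesgue. kernel_form (kernel_lmult C (explicit_kernel A1 A0 Am1 B s r)) (f r) (g r)) =
      (\<integral>(r, x). indicator {s<..<t} r *\<^sub>R H r x \<partial>(lborel \<Otimes>\<^sub>M config4_measure))" (is ?eq)
    and "\<And>r. s \<le> r \<Longrightarrow> integrable config4_measure (H r)"
    and "\<And>r. kernel_form (kernel_lmult C (explicit_kernel A1 A0 Am1 B s r)) (f r) (g r) = (\<integral>x. H r x \<partial>config4_measure)"
proof -
  let ?M = "(lborel :: real measure) \<Otimes>\<^sub>M config4_measure"
  let ?box = "config_box n \<times> config_box n \<times> config_box n \<times> config_box n"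
  have H_m: "(\<lambda>(r, x). H r x) \<in> borel_measurable ?M"
    using borel_measurable_explicit_integrand[OF f g, of C A1 A0 Am1 B s] by (simp add: H_def case_prod_unfold)
  have H_m': "H r \<in> borel_measurable config4_measure" for r
    using measurable_compose[OF measurable_Pair1' H_m, of r] by simp
  have bound: "\<exists>D. \<forall>r\<in>{s..T}. \<forall>x. norm (H r x) \<le> D" for T
  proof -
    obtain CK where CK: "CK > 0" "\<And>r \<sigma> \<tau> \<upsilon>. s \<le> r \<Longrightarrow> r \<le> s + (T - s) \<Longrightarrow> length \<sigma> \<le> n \<Longrightarrow> length \<tau> \<le> n \<Longrightarrow> length \<upsilon> \<le> n \<Longrightarrow>
        norm (explicit_kernel A1 A0 Am1 B s r \<sigma> \<tau> \<upsilon>) \<le> CK"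
      using explicit_kernel_bounded[where s=s and T="T - s" and n=n and ?A1.0=A1 and ?A0.0=A0 and ?Am1.0=Am1 and B=B] by metis
    have Cf0: "Cf \<ge> 0" and Cg0: "Cg \<ge> 0" using f_le[of 0 "[]"] g_le[of 0 "[]"] norm_ge_zero order_trans by blast+
    have "norm (H r x) \<le> 2 * Cf * (norm C * (CK * Cg))" if r: "r \<in> {s..T}" for r x
    proof -
      obtain \<omega> \<sigma> \<tau> \<upsilon> where x: "x = (\<omega>, \<sigma>, \<tau>, \<upsilon>)" by (cases x)
      let ?a = "f r (\<omega> @ \<sigma> @ \<tau>)" and ?b = "g r (\<omega> @ \<tau> @ \<upsilon>)"
      show ?thesis
      proof (cases "?a = 0 \<or> ?b = 0")
        case True
        then show ?thesis using Cf0 Cg0 CK by (auto simp: H_def x cinner.zero_left cinner.zero_right)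
      next
        case False
        then have "\<omega> @ \<sigma> @ \<tau> \<in> config_box n" "\<omega> @ \<tau> @ \<upsilon> \<in> config_box n" using f_0 g_0 by blast+
        then have "norm (explicit_kernel A1 A0 Am1 B s r \<sigma> \<tau> \<upsilon>) \<le> CK"
          using r by (intro CK) (auto simp: config_box_def)
        then have "norm (C (explicit_kernel A1 A0 Am1 B s r \<sigma> \<tau> \<upsilon> ?b)) \<le> norm C * (CK * Cg)"
          using g_le[of r "\<omega> @ \<tau> @ \<upsilon>"] CK(1)
          by (intro order_trans[OF norm_blinfun] mult_left_mono order_trans[OF norm_blinfun] mult_mono) auto
        then have "2 * norm ?a * norm (C (explicit_kernel A1 A0 Am1 B s r \<sigma> \<tau> \<upsilon> ?b)) \<le> 2 * Cf * (norm C * (CK * Cg))"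
          using f_le Cf0 by (intro mult_mono) auto
        moreover have "norm (H r x) \<le> 2 * norm ?a * norm (C (explicit_kernel A1 A0 Am1 B s r \<sigma> \<tau> \<upsilon> ?b))"
          unfolding H_def x prod.case by (rule norm_cinner_le)
        ultimately show ?thesis by linarith
      qed
    qed
    then show ?thesis by blast
  qed
  have H_0: "H r x = 0" if "x \<notin> ?box" for r x
  proof -
    obtain \<omega> \<sigma> \<tau> \<upsilon> where x: "x = (\<omega>, \<sigma>, \<tau>, \<upsilon>)" by (cases x)
    have "\<omega> @ \<sigma> @ \<tau> \<notin> config_box n \<or> \<omega> @ \<tau> @ \<upsilon> \<notin> config_box n"
      using that append_in_config_box unfolding x by blast
    then show ?thesis using f_0 g_0 by (auto simp: H_def x cinner.zero_left cinner.zero_right)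
  qed
  show H_int: "integrable config4_measure (H r)" if "s \<le> r" for r
  proof -
    obtain D where "\<forall>r'\<in>{s..r}. \<forall>x. norm (H r' x) \<le> D" using bound by blast
    then show ?thesis using that H_0 by (intro integrable_bounded_times[OF H_m' config4_box[of n], where C = D]) auto
  qed
  show form: "kernel_form (kernel_lmult C (explicit_kernel A1 A0 Am1 B s r)) (f r) (g r) = (\<integral>x. H r x \<partial>config4_measure)" for r
  proof -
    have "kernel_form (kernel_lmult C (explicit_kernel A1 A0 Am1 B s r)) (f r) (g r) = integral\<^sup>L (completion config4_measure) (H r)"
      by (simp add: kernel_form_def kernel_lmult_def H_def)
    then show ?thesis using integral_completion[OF H_m'] by simp
  qed
  have box: "{s..t} \<times> ?box \<in> sets ?M" "emeasure ?M ({s..t} \<times> ?box) < \<infinity>"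
    using config4_box[of n] \<open>s \<le> t\<close> by (auto simp: config4.emeasure_pair_measure_Times ennreal_mult_less_top)
  obtain D where D: "\<forall>r\<in>{s..t}. \<forall>x. norm (H r x) \<le> D" using bound by blast
  have m: "(\<lambda>(r, x). indicator {s<..<t} r *\<^sub>R H r x) \<in> borel_measurable ?M"
    using H_m by (simp add: case_prod_unfold)
  show int: ?int
  proof (rule integrable_bounded_times[OF m box, where C = D])
    have "0 \<le> D" using D \<open>s \<le> t\<close> norm_ge_zero order_trans by (metis atLeastAtMost_iff order_refl)
    then show "norm (case p of (r, x) \<Rightarrow> indicator {s<..<t} r *\<^sub>R H r x) \<le> D" for p
      using D by (cases p) (simp add: indicator_def)
    show "(case p of (r, x) \<Rightarrow> indicator {s<..<t} r *\<^sub>R H r x) = 0" if "p \<notin> {s..t} \<times> ?box" for p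
    proof -
      obtain r x where p: "p = (r, x)" by (cases p)
      then have "r \<notin> {s<..<t} \<or> x \<notin> ?box" using that by auto
      then show ?thesis
      proof
        assume "r \<notin> {s<..<t}"
        then have "indicator {s<..<t} r = (0::real)" by (rule indicator_simps(2))
        then show ?thesis by (simp only: p prod.case scaleR_zero_left)
      next
        assume "x \<notin> ?box"
        then have "H r x = 0" by (rule H_0)
        then show ?thesis by (simp only: p prod.case scaleR_zero_right)
      qed
    qed
  qed
  let ?h = "\<lambda>r. \<integral>x. H r x \<partial>config4_measure"
  have h_m: "?h \<in> borel_measurable lborel"
    using config4.borel_measurable_lebesgue_integral[OF H_m] by simp
  have "(LINT r:{s..t}|lebesgue. ?h r) = (\<integral>r. indicator {s..t} r *\<^sub>R ?h r \<partial>lborel)"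
    unfolding set_lebesgue_integral_def using h_m by (intro integral_completion) auto
  \<comment> \<open>The endpoints are null. The open interval matches the strict inequalities in the
    recursion of the kernel.\<close>
  also have "\<dots> = (\<integral>r. indicator {s<..<t} r *\<^sub>R ?h r \<partial>lborel)"
  proof (rule integral_cong_AE)
    show "AE r in lborel. indicator {s..t} r *\<^sub>R ?h r = indicator {s<..<t} r *\<^sub>R ?h r"
      using AE_lborel_singleton[of s] AE_lborel_singleton[of t] by eventually_elim (auto simp: indicator_def)
  qed (use h_m in auto)
  also have "\<dots> = (\<integral>r. (\<integral>x. indicator {s<..<t} r *\<^sub>R H r x \<partial>config4_measure) \<partial>lborel)"
    by simp
  also have "\<dots> = (\<integral>(r, x). indicator {s<..<t} r *\<^sub>R H r x \<partial>?M)"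
    by (rule time4.integral_fst[OF int])
  finally show ?eq unfolding form .
qed

lemma test_functions_annihilate_measurable:
  assumes "f \<in> test_functions"
  shows "(\<lambda>(r, xs). annihilate r f xs) \<in> borel_measurable (lborel \<Otimes>\<^sub>M config_measure)"
proof -
  note [measurable] = test_functions_measurable[OF assms]
  show ?thesis unfolding annihilate_def by measurable
qed

text \<open>Makes the range of summation independent of the configuration; lists that are too long
  do no harm because the test functions vanish there.\<close>

lemma sum_length_If:
  fixes \<phi> :: "nat \<Rightarrow> 'a::comm_monoid_add"
  assumes "length xs \<le> N \<or> (\<forall>i. \<phi> i = 0)"
  shows "(\<Sum>i<length xs. \<phi> i) = (\<Sum>i<N. if i < length xs then \<phi> i else 0)"
  using assms
proof
  assume "\<forall>i. \<phi> i = 0"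
  then show ?thesis by (simp add: sum.neutral)
qed (rule sum_lessThan_If)

text \<open>The triple of empty configurations has mass 1, so integrating out the kernel variables
  leaves \<open>h\<close>. This produces the inhomogeneous term of the equation.\<close>

lemma integral_only_Nil:
  assumes "integrable config_measure h"
  shows "has_bochner_integral config4_measure
    (\<lambda>(\<omega>, \<sigma>, \<tau>, \<upsilon>). if \<sigma> = [] \<and> \<tau> = [] \<and> \<upsilon> = [] then h \<omega> else 0) (integral\<^sup>L config_measure (h :: _ \<Rightarrow> complex))"
proof -
  let ?N = "{([], [], [])} :: (real list \<times> real list \<times> real list) set"
  have N: "?N = {[]} \<times> {[]} \<times> {[]}" by auto
  have Nm [measurable]: "?N \<in> sets config3_measure" unfolding N by (intro pair_measureI emeasure_config_Nil(1))
  have em: "emeasure config3_measure ?N = 1"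
    unfolding N
    by (simp only: config2.emeasure_pair_measure_Times[OF emeasure_config_Nil(1) pair_measureI[OF emeasure_config_Nil(1,1)]]
        config.emeasure_pair_measure_Times[OF emeasure_config_Nil(1,1)] emeasure_config_Nil(2) mult_1)
  let ?G = "\<lambda>(\<omega>, y). indicator ?N y *\<^sub>R h \<omega>"
  have hm [measurable]: "h \<in> borel_measurable config_measure" using assms by simp
  have meas: "measure config3_measure ?N = 1" by (simp add: measure_def em)
  have intN: "integrable config3_measure (indicator ?N :: _ \<Rightarrow> real)"
    using Nm em by (intro integrable_real_indicator) auto
  have int: "integrable config4_measure ?G"
  proof (rule config4.Fubini_integrable)
    show "integrable config_measure (\<lambda>\<omega>. \<integral>y. norm (?G (\<omega>, y)) \<partial>config3_measure)"
      using assms meas by simp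
    show "AE \<omega> in config_measure. integrable config3_measure (\<lambda>y. ?G (\<omega>, y))"
      using intN by (intro AE_I2) simp
  qed measurable
  have "(\<integral>x. ?G x \<partial>config4_measure) = (\<integral>\<omega>. (\<integral>y. ?G (\<omega>, y) \<partial>config3_measure) \<partial>config_measure)"
    by (rule config4.integral_fst'[OF int, symmetric])
  also have "\<dots> = integral\<^sup>L config_measure h" using meas intN by simp
  finally have "has_bochner_integral config4_measure ?G (integral\<^sup>L config_measure h)"
    using int by (simp add: has_bochner_integral_iff)
  moreover have "?G = (\<lambda>(\<omega>, \<sigma>, \<tau>, \<upsilon>). if \<sigma> = [] \<and> \<tau> = [] \<and> \<upsilon> = [] then h \<omega> else 0)"
    by (auto simp: indicator_def fun_eq_iff)
  ultimately show ?thesis by simp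
qed

lemma explicit_kernel_solves:
  fixes A1 A0 Am1 B :: "'k::{complex_hilbert_space, second_countable_topology} \<Rightarrow>\<^sub>L 'k"
  shows "solves_equation A1 A0 Am1 B s (explicit_kernel A1 A0 Am1 B s)"
  unfolding solves_equation_def
proof (intro allI impI ballI)
  fix t f g assume t: "s \<le> t" and f: "f \<in> (test_functions :: (real list \<Rightarrow> 'k) set)" and g: "g \<in> (test_functions :: (real list \<Rightarrow> 'k) set)"
  let ?K = "explicit_kernel A1 A0 Am1 B s"
  obtain Cf where Cf: "\<And>xs. norm (f xs) \<le> Cf" using test_functions_bounded[OF f] by blast
  obtain Cg where Cg: "\<And>xs. norm (g xs) \<le> Cg" using test_functions_bounded[OF g] by blast
  obtain n1 n2 where "\<And>xs. xs \<notin> config_box n1 \<Longrightarrow> f xs = 0" "\<And>xs. xs \<notin> config_box n2 \<Longrightarrow> g xs = 0"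
    using test_functions_support[OF f] test_functions_support[OF g] by metis
  then obtain n where f0: "\<forall>xs. xs \<notin> config_box n \<longrightarrow> f xs = 0" and g0: "\<forall>xs. xs \<notin> config_box n \<longrightarrow> g xs = 0"
    using config_box_mono[of n1 "max n1 n2"] config_box_mono[of n2 "max n1 n2"] by (metis max.cobounded1 max.cobounded2 subsetD)
  have fa0: "\<forall>xs. xs \<notin> config_box n \<longrightarrow> annihilate r f xs = 0"
    and ga0: "\<forall>xs. xs \<notin> config_box n \<longrightarrow> annihilate r g xs = 0" for r
    using f0 g0 append_in_config_box[of "[r]" _ n] by (auto simp: annihilate_def)
  note [measurable] = test_functions_measurable[OF f] test_functions_measurable[OF g]
  have fm: "(\<lambda>(r::real, xs). f xs) \<in> borel_measurable (lborel \<Otimes>\<^sub>M config_measure)" by measurable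
  have gm: "(\<lambda>(r::real, xs). g xs) \<in> borel_measurable (lborel \<Otimes>\<^sub>M config_measure)" by measurable
  note fam = test_functions_annihilate_measurable[OF f] and gam = test_functions_annihilate_measurable[OF g]
  have Cfa: "norm (annihilate r f xs) \<le> Cf" and Cga: "norm (annihilate r g xs) \<le> Cg" for r xs
    by (auto simp: annihilate_def Cf Cg)
  define F1 where "F1 = (\<lambda>(r, x). indicator {s<..<t} r *\<^sub>R (case x of (\<omega>, \<sigma>, \<tau>, \<upsilon>) \<Rightarrow>
      cinner (annihilate r f (\<omega> @ \<sigma> @ \<tau>)) (A1 (?K r \<sigma> \<tau> \<upsilon> (g (\<omega> @ \<tau> @ \<upsilon>))))))"
  define F2 where "F2 = (\<lambda>(r, x). indicator {s<..<t} r *\<^sub>R (case x of (\<omega>, \<sigma>, \<tau>, \<upsilon>) \<Rightarrow>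
      cinner (annihilate r f (\<omega> @ \<sigma> @ \<tau>)) (A0 (?K r \<sigma> \<tau> \<upsilon> (annihilate r g (\<omega> @ \<tau> @ \<upsilon>))))))"
  define F3 where "F3 = (\<lambda>(r, x). indicator {s<..<t} r *\<^sub>R (case x of (\<omega>, \<sigma>, \<tau>, \<upsilon>) \<Rightarrow>
      cinner (f (\<omega> @ \<sigma> @ \<tau>)) (Am1 (?K r \<sigma> \<tau> \<upsilon> (annihilate r g (\<omega> @ \<tau> @ \<upsilon>))))))"
  define F4 where "F4 = (\<lambda>(r, x). indicator {s<..<t} r *\<^sub>R (case x of (\<omega>, \<sigma>, \<tau>, \<upsilon>) \<Rightarrow>
      cinner (f (\<omega> @ \<sigma> @ \<tau>)) (B (?K r \<sigma> \<tau> \<upsilon> (g (\<omega> @ \<tau> @ \<upsilon>))))))"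
  note I1 = explicit_integrand[OF fam gm Cfa Cg fa0 g0 t, where C = A1 and ?A1.0 = A1 and ?A0.0 = A0 and ?Am1.0 = Am1 and B = B, folded F1_def]
  note I2 = explicit_integrand[OF fam gam Cfa Cga fa0 ga0 t, where C = A0 and ?A1.0 = A1 and ?A0.0 = A0 and ?Am1.0 = Am1 and B = B, folded F2_def]
  note I3 = explicit_integrand[OF fm gam Cf Cga f0 ga0 t, where C = Am1 and ?A1.0 = A1 and ?A0.0 = A0 and ?Am1.0 = Am1 and B = B, folded F3_def]
  note I4 = explicit_integrand[OF fm gm Cf Cg f0 g0 t, where C = B and ?A1.0 = A1 and ?A0.0 = A0 and ?Am1.0 = Am1 and B = B, folded F4_def]
  note I0 = explicit_integrand[OF fm gm Cf Cg f0 g0 t, where C = id_blinfun and ?A1.0 = A1 and ?A0.0 = A0 and ?Am1.0 = Am1 and B = B]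
  \<comment> \<open>A list in \<open>config_box n\<close> has at most \<open>n\<close> points, so
    everything vanishes from \<open>Suc n\<close> points on.\<close>
  define N where "N = Suc n"
  have long: "f xs = 0" "g xs = 0" "annihilate r f xs = 0" "annihilate r g xs = 0" if "n < length xs" for xs r
    using that f0 g0 fa0[of r] ga0[of r] by (auto simp: config_box_def)
  have N1: "F1 (r, x) = 0" if "N \<le> length (fst (snd x))" for r x
    using that long by (cases x) (auto simp: F1_def N_def cinner.zero_left)
  have N2: "F2 (r, x) = 0" if "N \<le> length (fst (snd (snd x)))" for r x
    using that long by (cases x) (auto simp: F2_def N_def cinner.zero_left)
  have N3: "F3 (r, x) = 0" if "N \<le> length (snd (snd (snd x)))" for r x
    using that long by (cases x) (auto simp: F3_def N_def cinner.zero_right)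
  define S1 where "S1 i x = (if i < length (fst (snd x)) then F1 (fst (snd x) ! i, fst x, delete_at i (fst (snd x)), snd (snd x)) else 0)" for i x
  define S2 where "S2 i x = (if i < length (fst (snd (snd x))) then F2 (fst (snd (snd x)) ! i, fst x, fst (snd x), delete_at i (fst (snd (snd x))), snd (snd (snd x))) else 0)" for i x
  define S3 where "S3 i x = (if i < length (snd (snd (snd x))) then F3 (snd (snd (snd x)) ! i, fst x, fst (snd x), fst (snd (snd x)), delete_at i (snd (snd (snd x)))) else 0)" for i x
  note M1 = mecke_integral[OF mecke_config4(1) I1(1) N1, folded S1_def]
  note M2 = mecke_integral[OF mecke_config4(2) I2(1) N2, folded S2_def]
  note M3 = mecke_integral[OF mecke_config4(3) I3(1) N3, folded S3_def]
  define Z :: "real list \<times> real list \<times> real list \<times> real list \<Rightarrow> complex" where "Z = (\<lambda>(\<omega>, \<sigma>, \<tau>, \<upsilon>). if \<sigma> = [] \<and> \<tau> = [] \<and> \<upsilon> = [] then cinner (f \<omega>) (g \<omega>) else 0)"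
  have Z: "has_bochner_integral config4_measure Z (test_inner f g)"
    unfolding Z_def test_inner_def
  proof (rule integral_only_Nil, rule integrable_bounded_times[OF _ sets_config_box emeasure_config_box, of _ n "2 * Cf * Cg"])
    show "(\<lambda>\<omega>. cinner (f \<omega>) (g \<omega>)) \<in> borel_measurable config_measure" by measurable
    show "norm (cinner (f x) (g x)) \<le> 2 * Cf * Cg" for x
      using Cf[of x] Cg[of x] order_trans[OF norm_ge_zero Cf[of x]]
      by (intro order_trans[OF norm_cinner_le] mult_mono) auto
    show "cinner (f x) (g x) = 0" if "x \<notin> config_box n" for x using f0 that by (simp add: cinner.zero_left)
  qed
  \<comment> \<open>In the term with \<open>B\<close> no point of the configuration is involved:
    \<open>r\<close> runs freely, and Fubini's theorem takes the place of Mecke's formula.\<close>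
  have F4s: "integrable config4_measure (\<lambda>x. \<integral>r. F4 (r, x) \<partial>lborel)"
    "(\<integral>x. \<integral>r. F4 (r, x) \<partial>lborel \<partial>config4_measure) = integral\<^sup>L (lborel \<Otimes>\<^sub>M config4_measure) F4"
    using time4.integrable_snd[of "\<lambda>r x. F4 (r, x)"] time4.integral_snd[of "\<lambda>r x. F4 (r, x)"] I4(1) by simp_all
  have pointwise: "(case x of (\<omega>, \<sigma>, \<tau>, \<upsilon>) \<Rightarrow> cinner (f (\<omega> @ \<sigma> @ \<tau>)) (id_blinfun (?K t \<sigma> \<tau> \<upsilon> (g (\<omega> @ \<tau> @ \<upsilon>))))) =
      Z x + (\<Sum>i<N. S1 i x) + (\<Sum>i<N. S2 i x) + (\<Sum>i<N. S3 i x) + (\<integral>r. F4 (r, x) \<partial>lborel)" for x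
  proof -
    obtain \<omega> \<sigma> \<tau> \<upsilon> where x: "x = (\<omega>, \<sigma>, \<tau>, \<upsilon>)" by (cases x)
    let ?a = "f (\<omega> @ \<sigma> @ \<tau>)" and ?b = "g (\<omega> @ \<tau> @ \<upsilon>)"
    let ?\<Phi> = "\<lambda>r C L. if s < r \<and> r < t then cinner ?a (blinfun_apply C (word_kernel B s r L ?b)) else 0"
    have 0: "?\<Phi> r C L = 0" if "?a = 0 \<or> ?b = 0" for r C L
      using that by (auto simp: cinner.zero_left cinner.zero_right)
    \<comment> \<open>Either a test function kills the integrand, or the sums up to \<open>N\<close>
      reach every point of the three lists.\<close>
    have ab: "(?a = 0 \<or> ?b = 0) \<or> length \<sigma> \<le> N \<and> length \<tau> \<le> N \<and> length \<upsilon> \<le> N"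
      using long[of "\<omega> @ \<sigma> @ \<tau>"] long[of "\<omega> @ \<tau> @ \<upsilon>"] unfolding N_def by fastforce
    \<comment> \<open>Putting the deleted point back restores the argument up to order. A point of
      \<sigma> occurs in the argument of \<open>f\<close> only, a point of \<upsilon> in that of
      \<open>g\<close> only, a point of \<tau> in both; this decides where \<open>a(r)\<close>
      appears in the three terms.\<close>
    have fsym: "annihilate r f xs = f ys" if "mset ys = add_mset r (mset xs)" for r xs ys
      unfolding annihilate_def using that by (intro test_functions_symmetric[OF f]) simp
    have gsym: "annihilate r g xs = g ys" if "mset ys = add_mset r (mset xs)" for r xs ys
      unfolding annihilate_def using that by (intro test_functions_symmetric[OF g]) simp
    have s1: "(\<Sum>i<length \<sigma>. ?\<Phi> (\<sigma> ! i) A1 (word A1 A0 Am1 (delete_at i \<sigma>) \<tau> \<upsilon>)) = (\<Sum>i<N. S1 i x)"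
    proof (subst sum_length_If[where N = N])
      show "(\<Sum>i<N. if i < length \<sigma> then ?\<Phi> (\<sigma> ! i) A1 (word A1 A0 Am1 (delete_at i \<sigma>) \<tau> \<upsilon>) else 0) = (\<Sum>i<N. S1 i x)"
      proof (rule sum.cong[OF refl])
        fix i
        have "annihilate (\<sigma> ! i) f (\<omega> @ delete_at i \<sigma> @ \<tau>) = ?a" if "i < length \<sigma>"
          using mset_delete_at[OF that] by (intro fsym) simp
        then show "(if i < length \<sigma> then ?\<Phi> (\<sigma> ! i) A1 (word A1 A0 Am1 (delete_at i \<sigma>) \<tau> \<upsilon>) else 0) = S1 i x"
          by (simp add: S1_def F1_def x explicit_kernel_eq_word_kernel indicator_def)
      qed
    qed (use ab 0 in blast)
    have s2: "(\<Sum>i<length \<tau>. ?\<Phi> (\<tau> ! i) A0 (word A1 A0 Am1 \<sigma> (delete_at i \<tau>) \<upsilon>)) = (\<Sum>i<N. S2 i x)"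
    proof (subst sum_length_If[where N = N])
      show "(\<Sum>i<N. if i < length \<tau> then ?\<Phi> (\<tau> ! i) A0 (word A1 A0 Am1 \<sigma> (delete_at i \<tau>) \<upsilon>) else 0) = (\<Sum>i<N. S2 i x)"
      proof (rule sum.cong[OF refl])
        fix i
        have "annihilate (\<tau> ! i) f (\<omega> @ \<sigma> @ delete_at i \<tau>) = ?a" "annihilate (\<tau> ! i) g (\<omega> @ delete_at i \<tau> @ \<upsilon>) = ?b"
          if "i < length \<tau>"
          using mset_delete_at[OF that] by (auto intro!: fsym gsym)
        then show "(if i < length \<tau> then ?\<Phi> (\<tau> ! i) A0 (word A1 A0 Am1 \<sigma> (delete_at i \<tau>) \<upsilon>) else 0) = S2 i x"
          by (simp add: S2_def F2_def x explicit_kernel_eq_word_kernel indicator_def)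
      qed
    qed (use ab 0 in blast)
    have s3: "(\<Sum>i<length \<upsilon>. ?\<Phi> (\<upsilon> ! i) Am1 (word A1 A0 Am1 \<sigma> \<tau> (delete_at i \<upsilon>))) = (\<Sum>i<N. S3 i x)"
    proof (subst sum_length_If[where N = N])
      show "(\<Sum>i<N. if i < length \<upsilon> then ?\<Phi> (\<upsilon> ! i) Am1 (word A1 A0 Am1 \<sigma> \<tau> (delete_at i \<upsilon>)) else 0) = (\<Sum>i<N. S3 i x)"
      proof (rule sum.cong[OF refl])
        fix i
        have "annihilate (\<upsilon> ! i) g (\<omega> @ \<tau> @ delete_at i \<upsilon>) = ?b" if "i < length \<upsilon>"
          using mset_delete_at[OF that] by (intro gsym) simp
        then show "(if i < length \<upsilon> then ?\<Phi> (\<upsilon> ! i) Am1 (word A1 A0 Am1 \<sigma> \<tau> (delete_at i \<upsilon>)) else 0) = S3 i x"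
          by (simp add: S3_def F3_def x explicit_kernel_eq_word_kernel indicator_def)
      qed
    qed (use ab 0 in blast)
    have z: "Z x = (if word A1 A0 Am1 \<sigma> \<tau> \<upsilon> = [] then cinner ?a ?b else 0)"
      by (auto simp: Z_def x word_eq_Nil)
    \<comment> \<open>The integrated recursion says that this integral is the kernel at time
      \<open>t\<close> minus its part without points minus all jumps; solving for the kernel gives
      the pointwise identity.\<close>
    have f4: "(\<integral>r. F4 (r, x) \<partial>lborel) = cinner ?a (word_kernel B s t (word A1 A0 Am1 \<sigma> \<tau> \<upsilon>) ?b) - Z x -
        ((\<Sum>i<N. S1 i x) + (\<Sum>i<N. S2 i x) + (\<Sum>i<N. S3 i x))"
      using has_bochner_integral_integral_eq[OF has_bochner_integral_word_kernel[OF t, where a = ?a and b = ?b and L = "word A1 A0 Am1 \<sigma> \<tau> \<upsilon>" and B = B]]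
      unfolding sum_word[where \<Phi> = ?\<Phi>] s1 s2 s3 z by (simp add: F4_def x explicit_kernel_eq_word_kernel)
    show ?thesis unfolding f4 by (simp add: x explicit_kernel_eq_word_kernel)
  qed
  have "kernel_form (?K t) f g = kernel_form (kernel_lmult id_blinfun (?K t)) f g"
    by (simp add: kernel_form_def kernel_lmult_def)
  also have "\<dots> = (\<integral>x. Z x + (\<Sum>i<N. S1 i x) + (\<Sum>i<N. S2 i x) + (\<Sum>i<N. S3 i x) + (\<integral>r. F4 (r, x) \<partial>lborel) \<partial>config4_measure)"
    unfolding I0(4)[where r = t] by (rule Bochner_Integration.integral_cong[OF refl pointwise])
  also have "\<dots> = test_inner f g + integral\<^sup>L (lborel \<Otimes>\<^sub>M config4_measure) F1 + integral\<^sup>L (lborel \<Otimes>\<^sub>M config4_measure) F2 +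
      integral\<^sup>L (lborel \<Otimes>\<^sub>M config4_measure) F3 + integral\<^sup>L (lborel \<Otimes>\<^sub>M config4_measure) F4"
    using Z M1 M2 M3 F4s by (simp add: has_bochner_integral_iff)
  finally show "kernel_form (?K t) f g = test_inner f g
          + (LINT r:{s..t}|lebesgue. kernel_form (kernel_lmult A1 (?K r)) (annihilate r f) g)
          + (LINT r:{s..t}|lebesgue. kernel_form (kernel_lmult A0 (?K r)) (annihilate r f) (annihilate r g))
          + (LINT r:{s..t}|lebesgue. kernel_form (kernel_lmult Am1 (?K r)) f (annihilate r g))
          + (LINT r:{s..t}|lebesgue. kernel_form (kernel_lmult B (?K r)) f g)"
    unfolding I1(2) I2(2) I3(2) I4(2) .
qed


section \<open>Uniqueness\<close>

lemma borel_measurable_completion_AE: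
  fixes f g :: "'a \<Rightarrow> 'b::topological_space"
  assumes "g \<in> borel_measurable M" "AE x in M. f x = g x"
  shows "f \<in> borel_measurable (completion M)"
proof (rule borel_measurableI)
  fix S :: "'b set" assume "open S"
  show "f -` S \<inter> space (completion M) \<in> sets (completion M)"
  proof (rule completion.in_sets_AE)
    show "g -` S \<inter> space M \<in> sets (completion M)"
      using assms(1) \<open>open S\<close> by (intro sets_completionI_sets measurable_sets) auto
    have "AE x in M. x \<in> g -` S \<inter> space M \<longleftrightarrow> x \<in> f -` S \<inter> space (completion M)"
      using assms(2) by eventually_elim auto
    then show "AE x in completion M. x \<in> g -` S \<inter> space M \<longleftrightarrow> x \<in> f -` S \<inter> space (completion M)"
      by (rule AE_completion)
  qed auto
qed

lemma integral_completion_AE: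
  fixes f g :: "'a \<Rightarrow> 'b::{banach, second_countable_topology}"
  assumes "g \<in> borel_measurable M" "AE x in M. f x = g x"
  shows "integral\<^sup>L (completion M) f = integral\<^sup>L M g"
proof -
  have "integral\<^sup>L (completion M) f = integral\<^sup>L (completion M) g"
    using assms by (intro integral_cong_AE borel_measurable_completion_AE[OF assms] measurable_completion AE_completion) auto
  then show ?thesis using integral_completion[OF assms(1)] by simp
qed

text \<open>A function that is not integrable has integral 0 by convention, and \<open>g\<close> is
  nonnegative almost everywhere, so the bound holds in this case too.\<close>

lemma norm_integral_le:
  fixes f :: "'a \<Rightarrow> 'b::{banach, second_countable_topology}"
  assumes "integrable M g" "AE x in M. norm (f x) \<le> g x"
  shows "norm (integral\<^sup>L M f) \<le> integral\<^sup>L M g"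
proof (cases "integrable M f")
  case True
  have "norm (integral\<^sup>L M f) \<le> (\<integral>x. norm (f x) \<partial>M)" by simp
  also have "\<dots> \<le> integral\<^sup>L M g" using True assms by (intro integral_mono_AE) auto
  finally show ?thesis .
next
  case False
  have "AE x in M. 0 \<le> g x" using assms(2) by eventually_elim (meson norm_ge_zero order_trans)
  then show ?thesis using False by (simp add: not_integrable_integral_eq integral_nonneg_AE)
qed

text \<open>The supports of \<open>f\<close> and \<open>g\<close> confine the kernel variables to
  the box, since parts of a list in a box lie in that box. So the form sees only the kernel cut off
  to the box, and there the representative may replace it.\<close>

lemma kernel_form_eq_integral:
  fixes F :: "'k::{complex_hilbert_space, second_countable_topology} kernel"
  assumes f: "f \<in> test_functions" and g: "g \<in> test_functions"
    and f_0: "\<forall>xs. xs \<notin> config_box n \<longrightarrow> f xs = 0" and g_0: "\<forall>xs. xs \<notin> config_box n \<longrightarrow> g xs = 0"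
    and F': "strongly_measurable config3_measure F'"
    and ae: "AE y in config3_measure. indicator (config_box n \<times> config_box n \<times> config_box n) y *\<^sub>R
      (case y of (\<sigma>, \<tau>, \<upsilon>) \<Rightarrow> F \<sigma> \<tau> \<upsilon>) = F' y"
  shows "kernel_form F f g = (\<integral>(\<omega>, \<sigma>, \<tau>, \<upsilon>). cinner (f (\<omega> @ \<sigma> @ \<tau>)) (F' (\<sigma>, \<tau>, \<upsilon>) (g (\<omega> @ \<tau> @ \<upsilon>))) \<partial>config4_measure)"
  unfolding kernel_form_def
proof (rule integral_completion_AE)
  note [measurable] = test_functions_measurable[OF f] test_functions_measurable[OF g]
  have "strongly_measurable config4_measure (\<lambda>x. F' (snd x))"
    by (rule strongly_measurable_comp[OF F']) simp
  note [measurable] = borel_measurable_strongly_measurable_apply[OF this]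
  show "(\<lambda>(\<omega>, \<sigma>, \<tau>, \<upsilon>). cinner (f (\<omega> @ \<sigma> @ \<tau>)) (F' (\<sigma>, \<tau>, \<upsilon>) (g (\<omega> @ \<tau> @ \<upsilon>)))) \<in> borel_measurable config4_measure"
  proof -
    have "(\<lambda>x. cinner (f (fst x @ fst (snd x) @ fst (snd (snd x)))) (F' (snd x) (g (fst x @ fst (snd (snd x)) @ snd (snd (snd x)))))) \<in> borel_measurable config4_measure"
      by measurable
    then show ?thesis by (simp add: case_prod_unfold)
  qed
  have "AE x in config4_measure. indicator (config_box n \<times> config_box n \<times> config_box n) (snd x) *\<^sub>R
      (case snd x of (\<sigma>, \<tau>, \<upsilon>) \<Rightarrow> F \<sigma> \<tau> \<upsilon>) = F' (snd x)"
  \<comment> \<open>The exceptional null set in the kernel variables stays null after taking its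
    product with the whole space of \<omega>.\<close>
  proof -
    obtain A where A: "{y \<in> space config3_measure. \<not> (indicator (config_box n \<times> config_box n \<times> config_box n) y *\<^sub>R
      (case y of (\<sigma>, \<tau>, \<upsilon>) \<Rightarrow> F \<sigma> \<tau> \<upsilon>) = F' y)} \<subseteq> A" "A \<in> sets config3_measure" "emeasure config3_measure A = 0"
      using ae by (rule AE_E) auto
    have "UNIV \<times> A \<in> sets config4_measure"
      using A(2) sets.top[of config_measure] by (intro pair_measureI) auto
    moreover have "emeasure config4_measure (UNIV \<times> A) = 0"
      using A config3.emeasure_pair_measure_Times[of UNIV config_measure A] sets.top[of config_measure] by simp
    ultimately have "AE x in config4_measure. x \<notin> UNIV \<times> A"
      by (intro AE_not_in) (simp add: null_sets_def)
    then show ?thesis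
    proof eventually_elim
      case (elim x)
      then have "snd x \<notin> A" by (simp add: mem_Times_iff)
      moreover have "snd x \<in> space config3_measure" by (simp add: space_pair_measure)
      ultimately show ?case using A(1) by blast
    qed
  qed
  then show "AE x in config4_measure. (case x of (\<omega>, \<sigma>, \<tau>, \<upsilon>) \<Rightarrow> cinner (f (\<omega> @ \<sigma> @ \<tau>)) (F \<sigma> \<tau> \<upsilon> (g (\<omega> @ \<tau> @ \<upsilon>)))) =
      (case x of (\<omega>, \<sigma>, \<tau>, \<upsilon>) \<Rightarrow> cinner (f (\<omega> @ \<sigma> @ \<tau>)) (F' (\<sigma>, \<tau>, \<upsilon>) (g (\<omega> @ \<tau> @ \<upsilon>))))"
  proof eventually_elim
    case (elim x)
    obtain \<omega> \<sigma> \<tau> \<upsilon> where x: "x = (\<omega>, \<sigma>, \<tau>, \<upsilon>)" by (cases x)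
    show ?case
    proof (cases "\<sigma> \<in> config_box n \<and> \<tau> \<in> config_box n \<and> \<upsilon> \<in> config_box n")
      case True
      then show ?thesis using elim by (simp add: x)
    next
      case False
      then have "\<omega> @ \<sigma> @ \<tau> \<notin> config_box n \<or> \<omega> @ \<tau> @ \<upsilon> \<notin> config_box n"
        using append_in_config_box by blast
      then show ?thesis using f_0 g_0 by (auto simp: x cinner.zero_left cinner.zero_right)
    qed
  qed
qed

text \<open>Fixing the box allows one dominating function to serve all test functions at
  once.\<close>

definition test_functions_on :: "nat \<Rightarrow> (real list \<Rightarrow> 'k::complex_hilbert_space) set" where
  "test_functions_on n = {f \<in> test_functions. \<forall>xs. xs \<notin> config_box n \<longrightarrow> f xs = 0}"

text \<open>The dominating function depends on \<open>v\<close> and \<open>n\<close> alone, and the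
  test functions enter through their sup bounds as factors. It therefore dominates the forms at all
  iterates of an operator applied to \<open>f\<close> simultaneously, which is what the iteration
  argument consumes.\<close>

lemma admissible_form_dominated:
  fixes v :: "real \<Rightarrow> 'k::{complex_hilbert_space, second_countable_topology} kernel"
  assumes "admissible s v"
  obtains \<phi> where "integrable lborel \<phi>" "\<And>r. 0 \<le> \<phi> r"
    "\<And>f g. f \<in> test_functions_on n \<Longrightarrow> g \<in> test_functions_on n \<Longrightarrow>
      set_integrable lebesgue {s..s + real n} (\<lambda>r. kernel_form (v r) f g)"
    "\<And>f g Cf Cg. f \<in> test_functions_on n \<Longrightarrow> g \<in> test_functions_on n \<Longrightarrow>
      \<forall>xs. norm (f xs) \<le> Cf \<Longrightarrow> \<forall>xs. norm (g xs) \<le> Cg \<Longrightarrow>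
      AE r in lebesgue. r \<in> {s..s + real n} \<longrightarrow> norm (kernel_form (v r) f g) \<le> Cf * Cg * \<phi> r"
proof -
  let ?M = "(lborel :: real measure) \<Otimes>\<^sub>M config3_measure"
  let ?box = "config_box n \<times> config_box n \<times> config_box n"
  let ?T = "{s..s + real n}"
  have "norm_integrable (completion ?M) (\<lambda>x. indicator (?T \<times> ?box) x *\<^sub>R (case x of (r, \<sigma>, \<tau>, \<upsilon>) \<Rightarrow> v r \<sigma> \<tau> \<upsilon>))"
    using assms by (simp add: admissible_def locally_integrable_def)
  then obtain G where G: "strongly_measurable ?M G" "integrable ?M (\<lambda>x. norm (G x))"
    and Gae: "AE x in ?M. indicator (?T \<times> ?box) x *\<^sub>R (case x of (r, \<sigma>, \<tau>, \<upsilon>) \<Rightarrow> v r \<sigma> \<tau> \<upsilon>) = G x"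
    using norm_integrable_completionD by blast
  have Gr: "strongly_measurable config3_measure (\<lambda>y. G (r, y))" for r
    by (rule strongly_measurable_comp[OF G(1)]) simp
  \<comment> \<open>For almost every time, the slice of the representative represents the kernel at
    that time.\<close>
  have ae1: "AE r in lborel. r \<in> ?T \<longrightarrow> (AE y in config3_measure. indicator ?box y *\<^sub>R (case y of (\<sigma>, \<tau>, \<upsilon>) \<Rightarrow> v r \<sigma> \<tau> \<upsilon>) = G (r, y))"
    using time3.AE_pair[OF Gae]
  proof eventually_elim
    case (elim r)
    show ?case
    proof
      assume "r \<in> ?T"
      then have "indicator (?T \<times> ?box) (r, y) = (indicator ?box y :: real)" for y by (simp add: indicator_times)
      then show "AE y in config3_measure. indicator ?box y *\<^sub>R (case y of (\<sigma>, \<tau>, \<upsilon>) \<Rightarrow> v r \<sigma> \<tau> \<upsilon>) = G (r, y)"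
        using elim by simp
    qed
  qed
  have ae2: "AE r in lborel. integrable config3_measure (\<lambda>y. norm (G (r, y)))"
    using time3.AE_integrable_fst'[OF G(2)] .
  define m where "m = measure config_measure (config_box n)"
  \<comment> \<open>The 2 is the constant of \<open>norm_cinner_le\<close>, and \<open>m\<close> is
    the mass of the box outside which \<omega> makes \<open>f\<close> vanish.\<close>
  define \<phi> where "\<phi> r = 2 * m * (\<integral>y. norm (G (r, y)) \<partial>config3_measure)" for r
  have \<phi>_int: "integrable lborel \<phi>"
    unfolding \<phi>_def using time3.integrable_fst'[OF G(2)] by simp
  have \<phi>_0: "0 \<le> \<phi> r" for r by (simp add: \<phi>_def m_def)
  have main: "(\<exists>k. k \<in> borel_measurable lborel \<and> (AE r in lborel. r \<in> ?T \<longrightarrow> kernel_form (v r) f g = k r)) \<and>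
      (AE r in lborel. r \<in> ?T \<longrightarrow> norm (kernel_form (v r) f g) \<le> Cf * Cg * \<phi> r)"
    if f: "f \<in> test_functions" and g: "g \<in> test_functions"
      and f_0: "\<And>xs. xs \<notin> config_box n \<Longrightarrow> f xs = 0" and g_0: "\<And>xs. xs \<notin> config_box n \<Longrightarrow> g xs = 0"
      and Cf: "\<And>xs. norm (f xs) \<le> Cf" and Cg: "\<And>xs. norm (g xs) \<le> Cg" for f g Cf Cg
  proof -
    note [measurable] = test_functions_measurable[OF f] test_functions_measurable[OF g]
    define H where "H r = (\<lambda>(\<omega>, \<sigma>, \<tau>, \<upsilon>). cinner (f (\<omega> @ \<sigma> @ \<tau>)) (G (r, \<sigma>, \<tau>, \<upsilon>) (g (\<omega> @ \<tau> @ \<upsilon>))))" for r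
    have eq: "AE r in lborel. r \<in> ?T \<longrightarrow> kernel_form (v r) f g = integral\<^sup>L config4_measure (H r)"
      using ae1
    proof eventually_elim
      case (elim r)
      then show ?case
        using kernel_form_eq_integral[OF f g _ _ Gr[of r], where F = "v r" and n = n] f_0 g_0 by (simp add: H_def)
    qed
    have "strongly_measurable (lborel \<Otimes>\<^sub>M config4_measure) (\<lambda>x. G (fst x, snd (snd x)))"
      by (rule strongly_measurable_comp[OF G(1)]) simp
    note [measurable] = borel_measurable_strongly_measurable_apply[OF this]
    have "(\<lambda>x. cinner (f (fst (snd x) @ fst (snd (snd x)) @ fst (snd (snd (snd x)))))
        (G (fst x, snd (snd x)) (g (fst (snd x) @ fst (snd (snd (snd x))) @ snd (snd (snd (snd x)))))))
        \<in> borel_measurable (lborel \<Otimes>\<^sub>M config4_measure)" by measurable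
    then have "(\<lambda>(r, x). H r x) \<in> borel_measurable (lborel \<Otimes>\<^sub>M config4_measure)"
      by (simp add: H_def case_prod_unfold)
    then have meas: "(\<lambda>r. integral\<^sup>L config4_measure (H r)) \<in> borel_measurable lborel"
      using config4.borel_measurable_lebesgue_integral by simp
    have bound: "AE r in lborel. norm (integral\<^sup>L config4_measure (H r)) \<le> Cf * Cg * \<phi> r"
      using ae2
    proof eventually_elim
      case (elim r)
      have Cf0: "0 \<le> Cf" and Cg0: "0 \<le> Cg" using Cf[of "[]"] Cg[of "[]"] norm_ge_zero order_trans by blast+
      let ?D = "\<lambda>(\<omega>, y). (2 * Cf * Cg) * (indicator (config_box n) \<omega> * norm (G (r, y)))"
      have ind: "integrable config_measure (indicator (config_box n) :: _ \<Rightarrow> real)"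
        using emeasure_config_box by (intro integrable_real_indicator) auto
      have Gnm [measurable]: "(\<lambda>y. norm (G (r, y))) \<in> borel_measurable config3_measure"
        by (rule borel_measurable_norm_strongly_measurable[OF Gr])
      have D0: "integrable config4_measure (\<lambda>(\<omega>, y). indicator (config_box n) \<omega> * norm (G (r, y)))"
      proof (rule config4.Fubini_integrable)
        show "integrable config_measure (\<lambda>\<omega>. \<integral>y. norm (case (\<omega>, y) of (\<omega>, y) \<Rightarrow> indicator (config_box n) \<omega> * norm (G (r, y))) \<partial>config3_measure)"
          using ind by (simp add: abs_mult)
        show "AE \<omega> in config_measure. integrable config3_measure (\<lambda>y. case (\<omega>, y) of (\<omega>, y) \<Rightarrow> indicator (config_box n) \<omega> * norm (G (r, y)))"
          using elim by (intro AE_I2) simp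
      qed measurable
      have Dint: "integrable config4_measure ?D" using D0 by (simp add: case_prod_unfold)
      have "(\<integral>x. ?D x \<partial>config4_measure) = (2 * Cf * Cg) * (\<integral>x. (case x of (\<omega>, y) \<Rightarrow> indicator (config_box n) \<omega> * norm (G (r, y))) \<partial>config4_measure)"
        by (simp add: case_prod_unfold)
      also have "(\<integral>x. (case x of (\<omega>, y) \<Rightarrow> indicator (config_box n) \<omega> * norm (G (r, y))) \<partial>config4_measure) =
          m * (\<integral>y. norm (G (r, y)) \<partial>config3_measure)"
        using config4.integral_fst'[OF D0, symmetric] by (simp add: m_def)
      finally have Dval: "(\<integral>x. ?D x \<partial>config4_measure) = Cf * Cg * \<phi> r" by (simp add: \<phi>_def)
      have "norm (H r x) \<le> ?D x" for x
      proof -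
        obtain \<omega> \<sigma> \<tau> \<upsilon> where x: "x = (\<omega>, \<sigma>, \<tau>, \<upsilon>)" by (cases x)
        show ?thesis
        proof (cases "\<omega> \<in> config_box n")
          case True
          have "norm (H r x) \<le> 2 * norm (f (\<omega> @ \<sigma> @ \<tau>)) * norm (G (r, \<sigma>, \<tau>, \<upsilon>) (g (\<omega> @ \<tau> @ \<upsilon>)))"
            unfolding H_def x prod.case by (rule norm_cinner_le)
          also have "\<dots> \<le> 2 * Cf * (norm (G (r, \<sigma>, \<tau>, \<upsilon>)) * Cg)"
            using Cf Cg Cf0 by (intro mult_mono order_trans[OF norm_blinfun] mult_left_mono) auto
          finally show ?thesis using True by (simp add: x mult_ac)
        next
          case False
          then have "\<omega> @ \<sigma> @ \<tau> \<notin> config_box n" using append_in_config_box by blast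
          then show ?thesis using f_0 False by (simp add: H_def x cinner.zero_left)
        qed
      qed
      then show ?case using norm_integral_le[OF Dint, of "H r"] Dval by simp
    qed
    have "AE r in lborel. r \<in> ?T \<longrightarrow> norm (kernel_form (v r) f g) \<le> Cf * Cg * \<phi> r"
      using eq bound by eventually_elim simp
    with meas eq show ?thesis by blast
  qed
  show ?thesis
  proof (rule that[OF \<phi>_int \<phi>_0])
    fix f g :: "real list \<Rightarrow> 'k"
    assume "f \<in> test_functions_on n" "g \<in> test_functions_on n"
    then have fg: "f \<in> test_functions" "g \<in> test_functions"
      "\<And>xs. xs \<notin> config_box n \<Longrightarrow> f xs = 0" "\<And>xs. xs \<notin> config_box n \<Longrightarrow> g xs = 0"
      by (auto simp: test_functions_on_def)
    {
      fix Cf Cg assume "\<forall>xs. norm (f xs) \<le> Cf" "\<forall>xs. norm (g xs) \<le> Cg"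
      then have C: "\<And>xs. norm (f xs) \<le> Cf" "\<And>xs. norm (g xs) \<le> Cg" by auto
      show "AE r in lebesgue. r \<in> ?T \<longrightarrow> norm (kernel_form (v r) f g) \<le> Cf * Cg * \<phi> r"
        using main[OF fg C] AE_completion by blast
    }
    obtain Cf where Cf: "\<And>xs. norm (f xs) \<le> Cf" using test_functions_bounded[OF fg(1)] by blast
    obtain Cg where Cg: "\<And>xs. norm (g xs) \<le> Cg" using test_functions_bounded[OF fg(2)] by blast
    from main[OF fg Cf Cg] obtain k where k: "k \<in> borel_measurable lborel"
      "AE r in lborel. r \<in> ?T \<longrightarrow> kernel_form (v r) f g = k r"
      and b: "AE r in lborel. r \<in> ?T \<longrightarrow> norm (kernel_form (v r) f g) \<le> Cf * Cg * \<phi> r" by blast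
    have "(\<lambda>r. indicator ?T r *\<^sub>R kernel_form (v r) f g) \<in> borel_measurable lebesgue"
    proof (rule borel_measurable_completion_AE)
      show "(\<lambda>r. indicator ?T r *\<^sub>R k r) \<in> borel_measurable lborel" using k(1) by simp
      show "AE r in lborel. indicator ?T r *\<^sub>R kernel_form (v r) f g = indicator ?T r *\<^sub>R k r"
        using k(2) by eventually_elim (auto simp: indicator_def)
    qed
    moreover have "integrable lebesgue (\<lambda>r. Cf * Cg * \<phi> r)"
      using \<phi>_int by (simp add: integrable_completion)
    moreover have "AE r in lebesgue. norm (indicator ?T r *\<^sub>R kernel_form (v r) f g) \<le> norm (Cf * Cg * \<phi> r)"
    proof (rule AE_completion)
      have Cf0: "0 \<le> Cf" and Cg0: "0 \<le> Cg" using Cf[of "[]"] Cg[of "[]"] norm_ge_zero order_trans by blast+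
      show "AE r in lborel. norm (indicator ?T r *\<^sub>R kernel_form (v r) f g) \<le> norm (Cf * Cg * \<phi> r)"
        using b by eventually_elim (auto simp: indicator_def \<phi>_0 Cf0 Cg0 abs_mult)
    qed
    ultimately show "set_integrable lebesgue ?T (\<lambda>r. kernel_form (v r) f g)"
      unfolding set_integrable_def by (blast intro: Bochner_Integration.integrable_bound)
  qed
qed

text \<open>The index \<open>j\<close> counts the operators applied to the test function. A first
  integration turns the almost everywhere bound into one at every time, by the total mass of
  \<open>\<phi>\<close>. Each further integration costs a factor \<open>K\<close> and integrates a
  power of \<open>t - s\<close>, which produces the factorial that wins in the limit.\<close>

lemma gronwall_zero:
  fixes D :: "nat \<Rightarrow> real \<Rightarrow> 'b::{banach, second_countable_topology}"
  assumes rec: "\<And>j t. s \<le> t \<Longrightarrow> t \<le> T \<Longrightarrow> D j t = (LINT r:{s..t}|lebesgue. D (Suc j) r)"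
    and dom: "\<And>j. AE r in lebesgue. r \<in> {s..T} \<longrightarrow> norm (D j r) \<le> K ^ j * \<phi> r"
    and \<phi>: "integrable lebesgue \<phi>" "\<And>r. 0 \<le> \<phi> r" and K: "0 \<le> K"
    and t: "s \<le> t" "t \<le> T"
  shows "D 0 t = 0"
proof -
  define \<Phi> where "\<Phi> = integral\<^sup>L lebesgue \<phi>"
  \<comment> \<open>Both \<open>j\<close> and \<open>t\<close> vary in the induction on
    \<open>m\<close>, because the equation for \<open>D j t\<close> calls for the bound on
    \<open>D (Suc j)\<close> at all earlier times.\<close>
  have claim: "norm (D j t) \<le> K ^ Suc (j + m) * \<Phi> * ((t - s) ^ m / fact m)" if "s \<le> t" "t \<le> T" for j m t
    using that
  proof (induction m arbitrary: j t)
    case 0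
    have "norm (LINT r:{s..t}|lebesgue. D (Suc j) r) \<le> integral\<^sup>L lebesgue (\<lambda>r. K ^ Suc j * \<phi> r)"
      unfolding set_lebesgue_integral_def
    proof (rule norm_integral_le)
      show "integrable lebesgue (\<lambda>r. K ^ Suc j * \<phi> r)" using \<phi>(1) by simp
      show "AE r in lebesgue. norm (indicator {s..t} r *\<^sub>R D (Suc j) r) \<le> K ^ Suc j * \<phi> r"
        using dom[of "Suc j"]
      proof eventually_elim
        case (elim r)
        then show ?case using 0 K \<phi>(2)[of r] by (cases "r \<in> {s..t}") auto
      qed
    qed
    then show ?case using rec[OF 0] by (simp add: \<Phi>_def)
  next
    case (Suc m)
    define c where "c = K ^ Suc (Suc j + m) * \<Phi>"
    have "has_bochner_integral lborel (\<lambda>r. indicator {s..t} r *\<^sub>R (c * ((r - s) ^ m / fact m)))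
        (c * ((t - s) ^ Suc m / fact (Suc m)) - c * ((s - s) ^ Suc m / fact (Suc m)))"
    proof (rule has_bochner_integral_FTC_Icc[OF \<open>s \<le> t\<close>])
      fix x
      have "((\<lambda>r. c * ((r - s) ^ Suc m / fact (Suc m))) has_real_derivative c * ((x - s) ^ m / fact m)) (at x within {s..t})"
        by (auto intro!: derivative_eq_intros simp: field_simps simp del: power_Suc of_nat_Suc)
      then show "((\<lambda>r. c * ((r - s) ^ Suc m / fact (Suc m))) has_vector_derivative c * ((x - s) ^ m / fact m)) (at x within {s..t})"
        by (simp add: has_real_derivative_iff_has_vector_derivative)
    qed (intro continuous_intros; simp)
    then have hb: "has_bochner_integral lborel (\<lambda>r. indicator {s..t} r *\<^sub>R (c * ((r - s) ^ m / fact m)))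
        (c * ((t - s) ^ Suc m / fact (Suc m)))" by simp
    have "norm (LINT r:{s..t}|lebesgue. D (Suc j) r) \<le> integral\<^sup>L lebesgue (\<lambda>r. indicator {s..t} r *\<^sub>R (c * ((r - s) ^ m / fact m)))"
      unfolding set_lebesgue_integral_def
    proof (rule norm_integral_le)
      show "integrable lebesgue (\<lambda>r. indicator {s..t} r *\<^sub>R (c * ((r - s) ^ m / fact m)))"
        using hb by (subst integrable_completion) (auto simp: has_bochner_integral_iff)
      show "AE r in lebesgue. norm (indicator {s..t} r *\<^sub>R D (Suc j) r) \<le> indicator {s..t} r *\<^sub>R (c * ((r - s) ^ m / fact m))"
        using Suc.IH[of _ "Suc j"] Suc.prems by (intro AE_I2) (auto simp: indicator_def c_def)
    qed
    also have "\<dots> = c * ((t - s) ^ Suc m / fact (Suc m))"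
      using hb by (subst integral_completion) (auto simp: has_bochner_integral_iff)
    finally show ?case using rec[OF Suc.prems] by (simp add: c_def)
  qed
  have "(\<lambda>m. K * \<Phi> * (inverse (fact m) * (K * (t - s)) ^ m)) \<longlonglongrightarrow> K * \<Phi> * 0"
    by (intro tendsto_mult_left summable_LIMSEQ_zero summable_exp)
  moreover have "norm (D 0 t) \<le> K * \<Phi> * (inverse (fact m) * (K * (t - s)) ^ m)" for m
    using claim[OF t, of 0 m] by (simp add: power_mult_distrib divide_inverse mult_ac)
  ultimately have "norm (D 0 t) \<le> 0"
    by (intro LIMSEQ_le_const) auto
  then show ?thesis by simp
qed

lemma kernel_form_zero: "kernel_form F (\<lambda>_. 0) g = 0" "kernel_form F f (\<lambda>_. 0) = 0"
  by (simp_all add: kernel_form_def cinner.zero_left cinner.zero_right case_prod_unfold)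

text \<open>After this move a term with a coefficient is again a form with the original kernel, so
  that an induction hypothesis about all test functions applies to it.\<close>

lemma kernel_form_lmult_adjoint:
  assumes "\<And>x y. cinner (blinfun_apply A' x) y = cinner x (blinfun_apply A y)"
  shows "kernel_form (kernel_lmult A F) f g = kernel_form F (\<lambda>xs. A' (f xs)) g"
  by (simp add: kernel_form_def kernel_lmult_def assms)

text \<open>The induction is on the sum of the point bounds for \<open>f\<close> and
  \<open>g\<close>, since the terms with \<open>A1\<close> and \<open>Am1\<close> lower only one of
  them. The term with \<open>B\<close> lowers neither and is left to the iteration.\<close>

lemma solution_unique:
  fixes u v :: "real \<Rightarrow> 'k::{complex_hilbert_space, second_countable_topology} kernel"
  assumes A: "A1 \<in> bounded_ops" "A0 \<in> bounded_ops" "Am1 \<in> bounded_ops" "B \<in> bounded_ops"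
    and u: "admissible s u" "solves_equation A1 A0 Am1 B s u"
    and v: "admissible s v" "solves_equation A1 A0 Am1 B s v"
    and f: "f \<in> test_functions" and g: "g \<in> test_functions" and t: "s \<le> t"
  shows "kernel_form (v t) f g = kernel_form (u t) f g"
proof -
  obtain A1' :: "'k \<Rightarrow>\<^sub>L 'k" where A1': "\<And>x y. cinner (A1' x) y = cinner x (A1 y)" using bounded_ops_adjoint[OF A(1)] by blast
  obtain A0' :: "'k \<Rightarrow>\<^sub>L 'k" where A0': "\<And>x y. cinner (A0' x) y = cinner x (A0 y)" using bounded_ops_adjoint[OF A(2)] by blast
  obtain Am1' :: "'k \<Rightarrow>\<^sub>L 'k" where Am1': "\<And>x y. cinner (Am1' x) y = cinner x (Am1 y)" using bounded_ops_adjoint[OF A(3)] by blast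
  obtain B' :: "'k \<Rightarrow>\<^sub>L 'k" where B': "\<And>x y. cinner (B' x) y = cinner x (B y)" using bounded_ops_adjoint[OF A(4)] by blast
  have main: "\<forall>t\<ge>s. kernel_form (v t) f g = kernel_form (u t) f g"
    if "f \<in> test_functions" "g \<in> test_functions" "\<And>xs. length xs \<ge> a \<Longrightarrow> f xs = 0" "\<And>xs. length xs \<ge> b \<Longrightarrow> g xs = 0"
    for a b f g
    using that
  proof (induction "a + b" arbitrary: a b f g rule: less_induct)
    case less
    show ?case
    proof (cases "a = 0 \<or> b = 0")
      case True
      \<comment> \<open>The bounds are strict, so the value 0 means that the function vanishes even
        at the empty list. This starts the induction without appeal to the equation.\<close>
      then have "f = (\<lambda>_. 0) \<or> g = (\<lambda>_. 0)" using less.prems by auto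
      then show ?thesis using kernel_form_zero by metis
    next
      case False
      then obtain a' b' where ab: "a = Suc a'" "b = Suc b'" by (metis not0_implies_Suc)
      have g_ann: "annihilate r g \<in> test_functions" "\<And>xs. length xs \<ge> b' \<Longrightarrow> annihilate r g xs = 0" for r
        using annihilate_test_functions[OF less.prems(2)] less.prems(4) ab by (auto simp: annihilate_def)
      \<comment> \<open>Iterating the equation in its last term applies the adjoint of
        \<open>B\<close> over and over; all these functions keep the support of
        \<open>f\<close>.\<close>
      define fj where "fj j xs = blinfun_power B' j (f xs)" for j xs
      have fj: "fj j \<in> test_functions" "\<And>xs. length xs \<ge> a \<Longrightarrow> fj j xs = 0" for j
        unfolding fj_def using less.prems by (auto intro!: blinfun_test_functions)
      have fj_ann: "annihilate r (fj j) \<in> test_functions" "\<And>xs. length xs \<ge> a' \<Longrightarrow> annihilate r (fj j) xs = 0" for r j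
        using annihilate_test_functions[OF fj(1)] fj(2) ab by (auto simp: annihilate_def)
      have fj_at_0: "fj 0 = f" by (simp add: fj_def fun_eq_iff)
      have fj_Suc: "fj (Suc j) = (\<lambda>xs. B' (fj j xs))" for j by (simp add: fj_def fun_eq_iff)
      \<comment> \<open>The operator goes to the left argument, whose point bound has dropped to
        \<open>a'\<close>. The equality holds at every time from \<open>s\<close> on.\<close>
      have t1: "kernel_form (kernel_lmult A1 (v r)) (annihilate r (fj j)) g = kernel_form (kernel_lmult A1 (u r)) (annihilate r (fj j)) g"
        if "s \<le> r" for r j
        unfolding kernel_form_lmult_adjoint[OF A1']
        using less.hyps[of a' b "\<lambda>xs. A1' (annihilate r (fj j) xs)" g] that fj_ann less.prems ab
        by (simp add: blinfun_test_functions)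
      have t2: "kernel_form (kernel_lmult A0 (v r)) (annihilate r (fj j)) (annihilate r g) = kernel_form (kernel_lmult A0 (u r)) (annihilate r (fj j)) (annihilate r g)"
        if "s \<le> r" for r j
        unfolding kernel_form_lmult_adjoint[OF A0']
        using less.hyps[of a' b' "\<lambda>xs. A0' (annihilate r (fj j) xs)" "annihilate r g"] that fj_ann g_ann ab
        by (simp add: blinfun_test_functions)
      have t3: "kernel_form (kernel_lmult Am1 (v r)) (fj j) (annihilate r g) = kernel_form (kernel_lmult Am1 (u r)) (fj j) (annihilate r g)"
        if "s \<le> r" for r j
        unfolding kernel_form_lmult_adjoint[OF Am1']
        using less.hyps[of a b' "\<lambda>xs. Am1' (fj j xs)" "annihilate r g"] that fj g_ann ab
        by (simp add: blinfun_test_functions)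
      show ?thesis
      proof (intro allI impI)
        fix t assume t: "s \<le> t"
        obtain n1 where n1: "\<And>xs. xs \<notin> config_box n1 \<Longrightarrow> f xs = 0" using test_functions_support less.prems(1) by blast
        obtain n2 where n2: "\<And>xs. xs \<notin> config_box n2 \<Longrightarrow> g xs = 0" using test_functions_support less.prems(2) by blast
        obtain n3 :: nat where n3: "t - s \<le> real n3" using real_arch_simple by blast
        \<comment> \<open>A single \<open>n\<close> covers both supports and the time interval, as
          in the exhausting sets of \<open>admissible\<close>.\<close>
        define n where "n = max n1 (max n2 n3)"
        have f_0: "f xs = 0" if "xs \<notin> config_box n" for xs
          using that config_box_mono[of n1 n] n1 by (auto simp: n_def)
        have g_0: "g xs = 0" if "xs \<notin> config_box n" for xs
          using that config_box_mono[of n2 n] n2 by (auto simp: n_def le_max_iff_disj)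
        have tn: "t \<le> s + real n" using n3 by (simp add: n_def)
        have fj_0: "fj j xs = 0" if "xs \<notin> config_box n" for j xs using f_0[OF that] by (simp add: fj_def)
        obtain Cf where Cf: "Cf > 0" "\<And>xs. norm (f xs) \<le> Cf" using test_functions_bounded[OF less.prems(1)] by blast
        obtain Cg where Cg: "Cg > 0" "\<And>xs. norm (g xs) \<le> Cg" using test_functions_bounded[OF less.prems(2)] by blast
        have fj_le: "norm (fj j xs) \<le> norm B' ^ j * Cf" for j xs
          unfolding fj_def using Cf norm_blinfun_power_le
          by (intro order_trans[OF norm_blinfun] mult_mono) auto
        have fj_on: "fj j \<in> test_functions_on n" for j using fj fj_0 by (simp add: test_functions_on_def)
        have g_on: "g \<in> test_functions_on n" using less.prems(2) g_0 by (simp add: test_functions_on_def)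
        obtain \<phi> where \<phi>: "integrable lborel \<phi>" "\<And>r. 0 \<le> \<phi> r"
          and iu: "\<And>j. set_integrable lebesgue {s..s + real n} (\<lambda>r. kernel_form (u r) (fj j) g)"
          and bu: "\<And>j. AE r in lebesgue. r \<in> {s..s + real n} \<longrightarrow> norm (kernel_form (u r) (fj j) g) \<le> (norm B' ^ j * Cf) * Cg * \<phi> r"
        proof (rule admissible_form_dominated[OF u(1), of n])
          fix \<theta> :: "real \<Rightarrow> real"
          assume "integrable lborel \<theta>" "\<And>r. 0 \<le> \<theta> r"
            and si: "\<And>f g. f \<in> test_functions_on n \<Longrightarrow> g \<in> test_functions_on n \<Longrightarrow>
              set_integrable lebesgue {s..s + real n} (\<lambda>r. kernel_form (u r) f g)"
            and sb: "\<And>f g Cf Cg. f \<in> test_functions_on n \<Longrightarrow> g \<in> test_functions_on n \<Longrightarrow>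
              \<forall>xs. norm (f xs) \<le> Cf \<Longrightarrow> \<forall>xs. norm (g xs) \<le> Cg \<Longrightarrow>
              AE r in lebesgue. r \<in> {s..s + real n} \<longrightarrow> norm (kernel_form (u r) f g) \<le> Cf * Cg * \<theta> r"
          then show thesis
            using that[of \<theta>] si[OF fj_on g_on] sb[OF fj_on g_on] fj_le Cg(2) by simp
        qed
        obtain \<psi> where \<psi>: "integrable lborel \<psi>" "\<And>r. 0 \<le> \<psi> r"
          and iv: "\<And>j. set_integrable lebesgue {s..s + real n} (\<lambda>r. kernel_form (v r) (fj j) g)"
          and bv: "\<And>j. AE r in lebesgue. r \<in> {s..s + real n} \<longrightarrow> norm (kernel_form (v r) (fj j) g) \<le> (norm B' ^ j * Cf) * Cg * \<psi> r"
        proof (rule admissible_form_dominated[OF v(1), of n])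
          fix \<theta> :: "real \<Rightarrow> real"
          assume "integrable lborel \<theta>" "\<And>r. 0 \<le> \<theta> r"
            and si: "\<And>f g. f \<in> test_functions_on n \<Longrightarrow> g \<in> test_functions_on n \<Longrightarrow>
              set_integrable lebesgue {s..s + real n} (\<lambda>r. kernel_form (v r) f g)"
            and sb: "\<And>f g Cf Cg. f \<in> test_functions_on n \<Longrightarrow> g \<in> test_functions_on n \<Longrightarrow>
              \<forall>xs. norm (f xs) \<le> Cf \<Longrightarrow> \<forall>xs. norm (g xs) \<le> Cg \<Longrightarrow>
              AE r in lebesgue. r \<in> {s..s + real n} \<longrightarrow> norm (kernel_form (v r) f g) \<le> Cf * Cg * \<theta> r"
          then show thesis
            using that[of \<theta>] si[OF fj_on g_on] sb[OF fj_on g_on] fj_le Cg(2) by simp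
        qed
        define D where "D j r = kernel_form (v r) (fj j) g - kernel_form (u r) (fj j) g" for j r
        have "D 0 t = 0"
        proof (rule gronwall_zero[where s = s and T = "s + real n" and K = "norm B'" and \<phi> = "\<lambda>r. Cf * Cg * (\<psi> r + \<phi> r)"])
          show "integrable lebesgue (\<lambda>r. Cf * Cg * (\<psi> r + \<phi> r))"
            using \<phi>(1) \<psi>(1) by (simp add: integrable_completion)
          show "0 \<le> Cf * Cg * (\<psi> r + \<phi> r)" for r using Cf Cg \<phi>(2) \<psi>(2) by simp
          show "AE r in lebesgue. r \<in> {s..s + real n} \<longrightarrow> norm (D j r) \<le> norm B' ^ j * (Cf * Cg * (\<psi> r + \<phi> r))" for j
            using bu[of j] bv[of j]
          proof eventually_elim
            case (elim r)
            show ?case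
            proof
              assume "r \<in> {s..s + real n}"
              then have "norm (kernel_form (v r) (fj j) g) + norm (kernel_form (u r) (fj j) g) \<le>
                  (norm B' ^ j * Cf) * Cg * \<psi> r + (norm B' ^ j * Cf) * Cg * \<phi> r"
                using elim by (intro add_mono) auto
              then show "norm (D j r) \<le> norm B' ^ j * (Cf * Cg * (\<psi> r + \<phi> r))"
                unfolding D_def using norm_triangle_ineq4[of "kernel_form (v r) (fj j) g" "kernel_form (u r) (fj j) g"]
                by (simp add: algebra_simps)
            qed
          qed
          fix j t' assume t': "s \<le> t'" "t' \<le> s + real n"
          have sub: "{s..t'} \<subseteq> {s..s + real n}" using t' by auto
          have eqv: "kernel_form (v t') (fj j) g = test_inner (fj j) g
            + (LINT r:{s..t'}|lebesgue. kernel_form (kernel_lmult A1 (v r)) (annihilate r (fj j)) g)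
            + (LINT r:{s..t'}|lebesgue. kernel_form (kernel_lmult A0 (v r)) (annihilate r (fj j)) (annihilate r g))
            + (LINT r:{s..t'}|lebesgue. kernel_form (kernel_lmult Am1 (v r)) (fj j) (annihilate r g))
            + (LINT r:{s..t'}|lebesgue. kernel_form (v r) (fj (Suc j)) g)"
            unfolding fj_Suc kernel_form_lmult_adjoint[OF B', symmetric]
            using v(2) t'(1) fj(1) less.prems(2) unfolding solves_equation_def by blast
          have equ: "kernel_form (u t') (fj j) g = test_inner (fj j) g
            + (LINT r:{s..t'}|lebesgue. kernel_form (kernel_lmult A1 (u r)) (annihilate r (fj j)) g)
            + (LINT r:{s..t'}|lebesgue. kernel_form (kernel_lmult A0 (u r)) (annihilate r (fj j)) (annihilate r g))
            + (LINT r:{s..t'}|lebesgue. kernel_form (kernel_lmult Am1 (u r)) (fj j) (annihilate r g))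
            + (LINT r:{s..t'}|lebesgue. kernel_form (u r) (fj (Suc j)) g)"
            unfolding fj_Suc kernel_form_lmult_adjoint[OF B', symmetric]
            using u(2) t'(1) fj(1) less.prems(2) unfolding solves_equation_def by blast
          \<comment> \<open>The integrands coincide on the whole interval, so the integrals agree
            whether or not they exist.\<close>
          have c1: "(LINT r:{s..t'}|lebesgue. kernel_form (kernel_lmult A1 (v r)) (annihilate r (fj j)) g) =
              (LINT r:{s..t'}|lebesgue. kernel_form (kernel_lmult A1 (u r)) (annihilate r (fj j)) g)"
            by (rule set_lebesgue_integral_cong) (auto intro: t1)
          have c2: "(LINT r:{s..t'}|lebesgue. kernel_form (kernel_lmult A0 (v r)) (annihilate r (fj j)) (annihilate r g)) =
              (LINT r:{s..t'}|lebesgue. kernel_form (kernel_lmult A0 (u r)) (annihilate r (fj j)) (annihilate r g))"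
            by (rule set_lebesgue_integral_cong) (auto intro: t2)
          have c3: "(LINT r:{s..t'}|lebesgue. kernel_form (kernel_lmult Am1 (v r)) (fj j) (annihilate r g)) =
              (LINT r:{s..t'}|lebesgue. kernel_form (kernel_lmult Am1 (u r)) (fj j) (annihilate r g))"
            by (rule set_lebesgue_integral_cong) (auto intro: t3)
          have "D j t' = (LINT r:{s..t'}|lebesgue. kernel_form (v r) (fj (Suc j)) g) - (LINT r:{s..t'}|lebesgue. kernel_form (u r) (fj (Suc j)) g)"
            unfolding D_def eqv equ c1 c2 c3 by simp
          \<comment> \<open>Subtracting under the integral does require integrability of both forms;
            it comes from the joint local integrability in time and the kernel variables.\<close>
          also have "\<dots> = (LINT r:{s..t'}|lebesgue. D (Suc j) r)"
            unfolding D_def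
            by (rule set_integral_diff(2)[symmetric]) (auto intro!: set_integrable_subset[OF iv _ sub] set_integrable_subset[OF iu _ sub])
          finally show "D j t' = (LINT r:{s..t'}|lebesgue. D (Suc j) r)" .
        qed (use t tn in auto)
        then show "kernel_form (v t) f g = kernel_form (u t) f g"
          using fj_at_0 by (simp add: D_def)
      qed
    qed
  qed
  obtain a where "\<And>xs. xs \<notin> config_box a \<Longrightarrow> f xs = 0" using test_functions_support[OF f] by blast
  moreover obtain b where "\<And>xs. xs \<notin> config_box b \<Longrightarrow> g xs = 0" using test_functions_support[OF g] by blast
  ultimately show ?thesis
    using main[OF f g, of "Suc a" "Suc b"] t by (auto simp: config_box_def)
qed

theorem theorem4p2p1:
  fixes A1 A0 Am1 B :: "'k::{complex_hilbert_space, second_countable_topology} \<Rightarrow>\<^sub>L 'k"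
    and s :: real
  assumes "A1 \<in> bounded_ops" and "A0 \<in> bounded_ops" and "Am1 \<in> bounded_ops" and "B \<in> bounded_ops"
  shows "admissible s (explicit_kernel A1 A0 Am1 B s) \<and>
    solves_equation A1 A0 Am1 B s (explicit_kernel A1 A0 Am1 B s) \<and>
    (\<forall>v. admissible s v \<and> solves_equation A1 A0 Am1 B s v \<longrightarrow>
       (\<forall>t\<ge>s. \<forall>f\<in>test_functions. \<forall>g\<in>test_functions.
          kernel_form (v t) f g = kernel_form (explicit_kernel A1 A0 Am1 B s t) f g))"
  using explicit_kernel_admissible[OF assms] explicit_kernel_solves[of A1 A0 Am1 B s]
    solution_unique[OF assms] by blast

end
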